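(* Let $R$ be a Nagata local ring with nilradical $N$ such that $\dim N<\dim R$, and let $R_{\mathrm{red}}=R/N$. If $I^{\mathrm{sat}}R_{\mathrm{red}}=(IR_{\mathrm{red}})^{\mathrm{sat}}$ holds for all ideals $I$ in $R$, then $\varepsilon(I)=\varepsilon(IR_{\mathrm{red}})$ for any ideal $I\subset R$.
   Context: Local rings are Noetherian. For an ideal $K$ of a local ring $(A,\mathfrak m_A)$, the saturation of $K$ is $K^{\mathrm{sat}}=\bigcup_{i\ge 1}(K:_A\mathfrak m_A^i)$. A domain $D$ with fraction field $F$ is Japanese if for every finite field extension $L/F$ the integral closure of $D$ in $L$ is a finite $D$-module; a Noetherian ring $R$ is Nagata if $R/P$ is Japanese for every prime $P$ of $R$. $\dim N$ is the Krull dimension of $N$ as an $R$-module (the zero module having dimension less than that of any nonzero module). For an ideal $K$ in a $d$-dimensional local ring $(A,\mathfrak m_A)$, the epsilon multiplicity is $$\varepsilon(K)=\limsup_{n\to\infty}\frac{\ell_A\big(H^0_{\mathfrak m_A}(A/K^n)\big)}{n^d/d!},$$ where $\ell_A$ denotes length; $\varepsilon(IR_{\mathrm{red}})$ is computed in the local ring $R_{\mathrm{red}}$. *)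

theory Defs
  imports "HOL-Algebra.Algebra" "HOL-Library.Extended_Real"
begin

section \<open>Modules attached to a commutative ring\<close>

text \<open>
  An algebra given by \<open>\<phi> : R \<rightarrow> S\<close>, cut down to a subset \<open>H\<close> of \<open>S\<close> and viewed as an \<open>R\<close>-module.
  It is used for ideals of \<open>R\<close> (with \<open>\<phi> = id\<close>), for quotients \<open>R/I\<close> (with \<open>\<phi>\<close> the projection),
  and for the integral closure of a domain in an extension field.
\<close>
definition restr_module :: "('a \<Rightarrow> 'b) \<Rightarrow> ('b, 'c) ring_scheme \<Rightarrow> 'b set \<Rightarrow> ('a, 'b) module"
  where "restr_module \<phi> S H =
    \<lparr>carrier = H, monoid.mult = monoid.mult S, one = \<one>\<^bsub>S\<^esub>, ring.zero = \<zero>\<^bsub>S\<^esub>, ring.add = ring.add S,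
     smult = (\<lambda>r x. \<phi> r \<otimes>\<^bsub>S\<^esub> x)\<rparr>"

definition ideal_module :: "('a, 'b) ring_scheme \<Rightarrow> 'a set \<Rightarrow> ('a, 'a) module"
  where "ideal_module R I = restr_module id R I"

definition quot_module :: "('a, 'b) ring_scheme \<Rightarrow> 'a set \<Rightarrow> ('a, 'a set) module"
  where "quot_module R I = restr_module ((+>\<^bsub>R\<^esub>) I) (R Quot I) (carrier (R Quot I))"

definition fin_gen_module :: "('a, 'b) ring_scheme \<Rightarrow> ('a, 'c, 'd) module_scheme \<Rightarrow> bool"
  where "fin_gen_module R M \<longleftrightarrow>
    (\<exists>S \<subseteq> carrier M. finite S \<and>
      (\<forall>x \<in> carrier M. \<exists>c \<in> S \<rightarrow> carrier R. x = (\<Oplus>\<^bsub>M\<^esub>s\<in>S. c s \<odot>\<^bsub>M\<^esub> s)))"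

definition annihilator :: "('a, 'b) ring_scheme \<Rightarrow> ('a, 'c, 'd) module_scheme \<Rightarrow> 'a set"
  where "annihilator R M = {r \<in> carrier R. \<forall>x \<in> carrier M. r \<odot>\<^bsub>M\<^esub> x = \<zero>\<^bsub>M\<^esub>}"

definition module_length :: "('a, 'b) ring_scheme \<Rightarrow> ('a, 'c, 'd) module_scheme \<Rightarrow> enat"
  where "module_length R M =
    Sup {enat n | n. \<exists>H :: nat \<Rightarrow> 'c set.
      (\<forall>i\<le>n. submodule (H i) R M) \<and> (\<forall>i<n. H i \<subset> H (Suc i))}"

section \<open>Dimension\<close>

text \<open>The supremum is taken in \<^typ>\<open>ereal\<close>, so that the zero ring has dimension \<open>-\<infinity>\<close>.\<close>
definition krull_dim :: "('a, 'b) ring_scheme \<Rightarrow> ereal"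
  where "krull_dim R =
    Sup {ereal (real n) | n. \<exists>P :: nat \<Rightarrow> 'a set.
      (\<forall>i\<le>n. primeideal (P i) R) \<and> (\<forall>i<n. P i \<subset> P (Suc i))}"

text \<open>The zero module has annihilator \<open>R\<close>, hence dimension \<open>-\<infinity>\<close>.\<close>
definition module_dim :: "('a, 'b) ring_scheme \<Rightarrow> ('a, 'c, 'd) module_scheme \<Rightarrow> ereal"
  where "module_dim R M = krull_dim (R Quot annihilator R M)"

section \<open>Nagata rings\<close>

text \<open>\<open>F\<close> is a fraction field of \<open>D\<close> via the embedding \<open>\<iota>\<close>.\<close>
definition is_fraction_field ::
    "('a, 'b) ring_scheme \<Rightarrow> ('c, 'd) ring_scheme \<Rightarrow> ('a \<Rightarrow> 'c) \<Rightarrow> bool"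
  where "is_fraction_field D F \<iota> \<longleftrightarrow>
    field F \<and> \<iota> \<in> ring_hom D F \<and> inj_on \<iota> (carrier D) \<and>
    (\<forall>x \<in> carrier F. \<exists>a \<in> carrier D. \<exists>b \<in> carrier D - {\<zero>\<^bsub>D\<^esub>}. x \<otimes>\<^bsub>F\<^esub> \<iota> b = \<iota> a)"

definition integral_closure :: "'a set \<Rightarrow> ('a, 'b) ring_scheme \<Rightarrow> 'a set"
  where "integral_closure A L =
    {x \<in> carrier L. \<exists>p. polynomial\<^bsub>L\<^esub> A p \<and> p \<noteq> [] \<and> lead_coeff p = \<one>\<^bsub>L\<^esub> \<and>
      ring.eval L p x = \<zero>\<^bsub>L\<^esub>}"

text \<open>
  The extension fields \<open>L\<close> of a domain over \<open>'a\<close> range over the type \<open>'a list\<close>.  This loses no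
  generality: a finite extension of the fraction field of \<open>D\<close> is finite if \<open>D\<close> is finite and
  equipotent to \<open>D\<close> otherwise, so it has an isomorphic copy with carrier in the infinite
  type \<open>'a list\<close>.
\<close>
definition japanese :: "('a, 'b) ring_scheme \<Rightarrow> bool"
  where "japanese D \<longleftrightarrow> domain D \<and>
    (\<forall>(L :: 'a list ring) F \<iota>.
      field L \<and> subfield F L \<and> is_fraction_field D (L\<lparr>carrier := F\<rparr>) \<iota> \<and>
      ring.finite_dimension L F (carrier L) \<longrightarrow>
      fin_gen_module D (restr_module \<iota> L (integral_closure (\<iota> ` carrier D) L)))"

locale nagata_ring = cring R + noetherian_ring R for R (structure) +
  assumes quotients_japanese: "primeideal P R \<Longrightarrow> japanese (R Quot P)"

section \<open>Local rings and saturation\<close>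

locale noetherian_local_ring = cring R + noetherian_ring R for R (structure) +
  assumes unique_maximal: "\<exists>!\<mm>. maximalideal \<mm> R"

definition max_ideal :: "('a, 'b) ring_scheme \<Rightarrow> 'a set"
  where "max_ideal R = (THE \<mm>. maximalideal \<mm> R)"

definition ideal_pow :: "('a, 'b) ring_scheme \<Rightarrow> 'a set \<Rightarrow> nat \<Rightarrow> 'a set"
  where "ideal_pow R I n = I [^]\<^bsub>ideals_set R\<^esub> n"

definition ideal_colon :: "('a, 'b) ring_scheme \<Rightarrow> 'a set \<Rightarrow> 'a set \<Rightarrow> 'a set"
  where "ideal_colon R K J = {a \<in> carrier R. \<forall>j \<in> J. a \<otimes>\<^bsub>R\<^esub> j \<in> K}"

definition saturation :: "('a, 'b) ring_scheme \<Rightarrow> 'a set \<Rightarrow> 'a set"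
  where "saturation R K = (\<Union>i\<in>{1..}. ideal_colon R K (ideal_pow R (max_ideal R) i))"

definition nilradical :: "('a, 'b) ring_scheme \<Rightarrow> 'a set"
  where "nilradical R = {x \<in> carrier R. \<exists>n::nat. x [^]\<^bsub>R\<^esub> n = \<zero>\<^bsub>R\<^esub>}"

definition reduced_ring :: "('a, 'b) ring_scheme \<Rightarrow> 'a set ring"
  where "reduced_ring R = R Quot nilradical R"

text \<open>The extended ideal \<open>I R\<^sub>r\<^sub>e\<^sub>d\<close>.\<close>
definition extend_red :: "('a, 'b) ring_scheme \<Rightarrow> 'a set \<Rightarrow> 'a set set"
  where "extend_red R I = genideal (reduced_ring R) ((+>\<^bsub>R\<^esub>) (nilradical R) ` I)"

section \<open>Epsilon multiplicity\<close>

text \<open>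
  \<open>H\<^sup>0\<close> with support in the maximal ideal: the submodule of elements killed by some power of
  the maximal ideal.
\<close>
definition local_cohomology_0 :: "('a, 'b) ring_scheme \<Rightarrow> ('a, 'c) module \<Rightarrow> ('a, 'c) module"
  where "local_cohomology_0 R M =
    M\<lparr>carrier := {x \<in> carrier M.
      \<exists>i. \<forall>a \<in> ideal_pow R (max_ideal R) i. a \<odot>\<^bsub>M\<^esub> x = \<zero>\<^bsub>M\<^esub>}\<rparr>"

text \<open>Meaningful for rings of finite dimension, in particular for Noetherian local rings.\<close>
definition fin_krull_dim :: "('a, 'b) ring_scheme \<Rightarrow> nat"
  where "fin_krull_dim R = (THE d. krull_dim R = ereal (real d))"

definition epsilon_mult :: "('a, 'b) ring_scheme \<Rightarrow> 'a set \<Rightarrow> ereal"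
  where "epsilon_mult A K =
    limsup (\<lambda>n. ereal_of_enat
        (module_length A (local_cohomology_0 A (quot_module A (ideal_pow A K n))))
      / ereal (real n ^ fin_krull_dim A / fact (fin_krull_dim A)))"

end

theory Submission
  imports Defs
begin

text \<open>
  Put \<open>d = dim R\<close>, let \<open>\<mm>\<close> be the maximal ideal, \<open>N\<close> the nilradical, and write \<open>S\<close> for the
  saturation of \<open>I ^ n\<close>. The module \<open>H\<^sup>0\<close> of \<open>R/I ^ n\<close> is \<open>S/I ^ n\<close>. By the hypothesis on
  saturations, applied to \<open>I ^ n\<close>, the corresponding module over the reduced ring is
  \<open>(S + N)/(I ^ n + N)\<close>. So the two lengths differ by the length of
  \<open>(S \<inter> N)/(I ^ n \<inter> N)\<close>, and the theorem says that this defect is \<open>o(n ^ d)\<close>.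

  The defect is bounded in two steps. There is a constant \<open>c\<close> with
  \<open>S \<inter> \<mm> ^ (c n) \<subseteq> I ^ n\<close> for all \<open>n\<close> (\<open>saturation_linear_growth\<close>); therefore the defect
  embeds into \<open>N/\<mm> ^ (c n) N\<close>. The length of \<open>N/\<mm> ^ k N\<close> is \<open>O(k ^ e)\<close> for every
  natural number \<open>e \<ge> dim N\<close> (\<open>ilen_mpow_prod_bound\<close>), and \<open>e = d - 1\<close> is allowed
  because \<open>dim N < d\<close>. If \<open>d = 0\<close> then \<open>N = 0\<close> and there is no defect.

  Linear growth comes from the Rees ring \<open>S' = R[I t]\<close>. In \<open>S'\<close> consider the extension \<open>\<qq>\<close> of
  \<open>\<mm>\<close> and the ideal \<open>Z\<close> with \<open>I ^ (i + 1)\<close> in degree \<open>i\<close>. The ideal \<open>T\<close> of elements that a power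
  of \<open>\<qq>\<close> carries into \<open>Z\<close> satisfies \<open>\<qq> ^ e T \<subseteq> Z\<close> for some \<open>e\<close>, and Artin--Rees gives
  \<open>\<qq> ^ a \<inter> T \<subseteq> \<qq> ^ (a - c) Z\<close>. Read in degree \<open>i\<close>, this improves membership in
  \<open>\<mm> ^ a I ^ i\<close> to membership in \<open>\<mm> ^ (a - c) I ^ (i + 1)\<close> at the price of \<open>c\<close> powers
  of \<open>\<mm>\<close>, uniformly in \<open>i\<close>; after \<open>n\<close> steps an element of \<open>S \<inter> \<mm> ^ (c n)\<close> lies in \<open>I ^ n\<close>.
  Artin--Rees itself is the ascending chain condition in a Rees ring, which is Noetherian by
  Hilbert's argument with leading coefficients.

  The second step rests on the existence of
  parameters \<open>x\<^sub>1, \<dots>, x\<^sub>e\<close>, because \<open>R/(x\<^sub>1 ^ k, \<dots>, x\<^sub>e ^ k)\<close> has length at most \<open>k ^ e\<close> times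
  the length of \<open>R/(x\<^sub>1, \<dots>, x\<^sub>e)\<close>. In addition \<open>dim R\<close> has to be finite, so that \<open>d\<close> is the
  exponent in the definition of the multiplicities (\<open>krull_dim_finite\<close>). This holds because
  enlarging a prime \<open>P\<close> lowers the degree of growth of the length of \<open>R/(\<mm> ^ k + P)\<close>.

  All lengths are lengths of chains of ideals of \<open>R\<close> between two given ideals (\<open>ilen\<close>). Additivity
  and the isomorphism theorems then become statements about the modular lattice of ideals, and
  quotient rings and modules enter only in the translation of the definitions.
\<close>

no_notation Sum_Type.Plus (infixr \<open><+>\<close> 65)

section \<open>Arithmetic of ideals\<close>

lemma (in ring) ideal_subset_carrier: "ideal I R \<Longrightarrow> I \<subseteq> carrier R"
  by (simp add: additive_subgroup.a_subset ideal.axioms(1))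

lemma (in ring) ideal_closed:
  assumes "ideal I R"
  shows "\<zero> \<in> I" "\<And>x y. x \<in> I \<Longrightarrow> y \<in> I \<Longrightarrow> x \<oplus> y \<in> I" "\<And>x. x \<in> I \<Longrightarrow> \<ominus> x \<in> I"
    "\<And>x y. x \<in> I \<Longrightarrow> y \<in> I \<Longrightarrow> x \<ominus> y \<in> I"
    "\<And>x r. x \<in> I \<Longrightarrow> r \<in> carrier R \<Longrightarrow> r \<otimes> x \<in> I" "\<And>x r. x \<in> I \<Longrightarrow> r \<in> carrier R \<Longrightarrow> x \<otimes> r \<in> I"
    "\<And>x. x \<in> I \<Longrightarrow> x \<in> carrier R"
proof -
  interpret ideal I R by fact
  show "\<zero> \<in> I" "\<And>x y. x \<in> I \<Longrightarrow> y \<in> I \<Longrightarrow> x \<oplus> y \<in> I" "\<And>x. x \<in> I \<Longrightarrow> \<ominus> x \<in> I"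
    "\<And>x r. x \<in> I \<Longrightarrow> r \<in> carrier R \<Longrightarrow> r \<otimes> x \<in> I" "\<And>x r. x \<in> I \<Longrightarrow> r \<in> carrier R \<Longrightarrow> x \<otimes> r \<in> I"
    "\<And>x. x \<in> I \<Longrightarrow> x \<in> carrier R"
    by (auto simp: I_l_closed I_r_closed)
  then show "\<And>x y. x \<in> I \<Longrightarrow> y \<in> I \<Longrightarrow> x \<ominus> y \<in> I" by (simp add: a_minus_def)
qed

lemma (in cring) idealI_comm:
  assumes "I \<subseteq> carrier R" "\<zero> \<in> I" "\<And>x y. x \<in> I \<Longrightarrow> y \<in> I \<Longrightarrow> x \<oplus> y \<in> I"
    "\<And>x r. x \<in> I \<Longrightarrow> r \<in> carrier R \<Longrightarrow> r \<otimes> x \<in> I"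
  shows "ideal I R"
proof (rule idealI[OF ring_axioms])
  have neg: "\<ominus> x \<in> I" if "x \<in> I" for x
  proof -
    have "\<ominus> x = (\<ominus> \<one>) \<otimes> x" using that assms(1) l_minus[of \<one> x] by auto
    then show ?thesis using assms(4)[OF that, of "\<ominus> \<one>"] by simp
  qed
  show "subgroup I (add_monoid R)"
    by (rule add.subgroupI) (use assms neg in \<open>auto simp: a_inv_def\<close>)
  show "\<And>a x. a \<in> I \<Longrightarrow> x \<in> carrier R \<Longrightarrow> x \<otimes> a \<in> I" by fact
  show "\<And>a x. a \<in> I \<Longrightarrow> x \<in> carrier R \<Longrightarrow> a \<otimes> x \<in> I"
    using assms m_comm by (metis subsetD)
qed

lemma (in ring) ideal_sum_mem: "x \<in> I <+> J \<longleftrightarrow> (\<exists>i\<in>I. \<exists>j\<in>J. x = i \<oplus> j)"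
  unfolding set_add_def' by auto

lemma (in ring) ideal_sum_upper:
  assumes "ideal I R" "ideal J R"
  shows "I \<subseteq> I <+> J" "J \<subseteq> I <+> J"
proof -
  show "I \<subseteq> I <+> J"
  proof
    fix x assume "x \<in> I"
    then show "x \<in> I <+> J" unfolding ideal_sum_mem
      using ideal_closed[OF assms(1)] ideal_closed(1)[OF assms(2)] by (metis r_zero)
  qed
  show "J \<subseteq> I <+> J"
  proof
    fix x assume "x \<in> J"
    then show "x \<in> I <+> J" unfolding ideal_sum_mem
      using ideal_closed[OF assms(2)] ideal_closed(1)[OF assms(1)] by (metis l_zero)
  qed
qed

lemma (in ring) ideal_sum_least:
  assumes "ideal K R" "I \<subseteq> K" "J \<subseteq> K"
  shows "I <+> J \<subseteq> K"
  using ideal_closed(2)[OF assms(1)] assms(2,3) by (fastforce simp: ideal_sum_mem)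

lemma (in ring) ideal_sum_mono: "I \<subseteq> I' \<Longrightarrow> J \<subseteq> J' \<Longrightarrow> I <+> J \<subseteq> I' <+> J'"
  by (auto simp: ideal_sum_mem) blast

lemma (in ring) ideal_sum_absorb:
  assumes "ideal I R" "ideal J R" "J \<subseteq> I"
  shows "I <+> J = I"
  using ideal_sum_least[OF assms(1) subset_refl assms(3)] ideal_sum_upper[OF assms(1,2)] by auto

text \<open>The modular law for the lattice of ideals; it carries the whole theory of lengths below.\<close>
lemma (in ring) ideal_modular:
  assumes "ideal A R" "ideal B R" "ideal C R" "A \<subseteq> C"
  shows "(A <+> B) \<inter> C = A <+> (B \<inter> C)"
proof (intro equalityI subsetI)
  fix x assume "x \<in> (A <+> B) \<inter> C"
  then obtain a b where ab: "a \<in> A" "b \<in> B" "x = a \<oplus> b" "x \<in> C" by (auto simp: ideal_sum_mem)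
  have "b = x \<ominus> a"
    using ab ideal_closed(7)[OF assms(1)] ideal_closed(7)[OF assms(2)] by algebra
  then have "b \<in> C" using ab assms(4) ideal_closed(4)[OF assms(3)] by blast
  then show "x \<in> A <+> (B \<inter> C)" using ab by (auto simp: ideal_sum_mem)
next
  fix x assume "x \<in> A <+> (B \<inter> C)"
  then show "x \<in> (A <+> B) \<inter> C"
    using assms(4) ideal_closed(2)[OF assms(3)] by (fastforce simp: ideal_sum_mem)
qed

lemma (in ring) ideal_prod_least:
  assumes "ideal K R" "\<And>i j. i \<in> I \<Longrightarrow> j \<in> J \<Longrightarrow> i \<otimes> j \<in> K"
  shows "I \<cdot> J \<subseteq> K"
proof
  fix x assume "x \<in> I \<cdot> J"
  then show "x \<in> K"
    by induction (use assms ideal_closed(2) in auto)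
qed

lemma (in ring) ideal_prod_mono:
  assumes "I \<subseteq> I'" "J \<subseteq> J'"
  shows "I \<cdot> J \<subseteq> I' \<cdot> J'"
proof
  fix x assume "x \<in> I \<cdot> J"
  then show "x \<in> I' \<cdot> J'"
    by induction (use assms in \<open>auto intro: ideal_prod.intros\<close>)
qed


lemma (in cring) ideal_colon_ideal:
  assumes "ideal K R" "J \<subseteq> carrier R"
  shows "ideal (ideal_colon R K J) R"
  by (rule idealI_comm)
    (use assms ideal_closed[OF assms(1)] in \<open>auto simp: ideal_colon_def subset_iff l_distr m_assoc\<close>)

lemma (in cring) ideal_pow_simps:
  "ideal_pow R I 0 = carrier R" "ideal_pow R I (Suc n) = ideal_pow R I n \<cdot> I"
proof -
  interpret M: comm_monoid "ideals_set R" by (rule ideals_set_is_comm_monoid)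
  show "ideal_pow R I 0 = carrier R" "ideal_pow R I (Suc n) = ideal_pow R I n \<cdot> I"
    by (simp_all add: ideal_pow_def ideals_set_def)
qed

lemma (in cring) ideal_pow_ideal [intro, simp]:
  "ideal I R \<Longrightarrow> ideal (ideal_pow R I n) R"
  by (induction n) (auto simp: ideal_pow_simps oneideal ideal_prod_is_ideal)

lemma (in cring) ideal_pow_add:
  assumes "ideal I R"
  shows "ideal_pow R I (m + n) = ideal_pow R I m \<cdot> ideal_pow R I n"
proof -
  interpret M: comm_monoid "ideals_set R" by (rule ideals_set_is_comm_monoid)
  have "I \<in> carrier (ideals_set R)" using assms by (simp add: ideals_set_def)
  from M.nat_pow_mult[OF this, of m n] show ?thesis
    by (simp add: ideal_pow_def ideals_set_def)
qed


lemma (in cring) ideal_pow_1: "ideal I R \<Longrightarrow> ideal_pow R I (Suc 0) = I"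
  using ideal_prod_one[of I] ideal_prod_commute[OF _ oneideal, of I] by (simp add: ideal_pow_simps)

lemma (in cring) ideal_pow_antimono:
  assumes "ideal I R" "m \<le> n"
  shows "ideal_pow R I n \<subseteq> ideal_pow R I m"
proof -
  from assms(2) obtain k where "n = m + k" by (metis le_add_diff_inverse)
  then show ?thesis
    using ideal_prod_inter[of "ideal_pow R I m" "ideal_pow R I k"] assms(1)
    by (auto simp: ideal_pow_add)
qed


lemma (in ring) ideal_finsum_closed:
  assumes "ideal I R" "finite A" "\<And>a. a \<in> A \<Longrightarrow> f a \<in> I"
  shows "(\<Oplus>a\<in>A. f a) \<in> I"
  using assms(2,3)
proof (induction A)
  case empty then show ?case by (simp add: ideal_closed[OF assms(1)])
next
  case (insert a A)
  then have "f \<in> A \<rightarrow> carrier R" "f a \<in> carrier R"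
    using ideal_closed(7)[OF assms(1)] by auto
  with insert show ?case by (simp add: ideal_closed[OF assms(1)])
qed

section \<open>Noetherian rings\<close>

text \<open>  A chain of ideals of the family contains its own union, because finitely many generators of the
  union already lie in one member; so Zorn's lemma applies.\<close>
lemma (in noetherian_ring) maximal_ideal_in_family:
  assumes "S \<noteq> {}" "\<And>I. I \<in> S \<Longrightarrow> ideal I R"
  obtains M where "M \<in> S" "\<And>I. I \<in> S \<Longrightarrow> M \<subseteq> I \<Longrightarrow> I = M"
proof -
  have "\<exists>M\<in>S. \<forall>I\<in>S. M \<subseteq> I \<longrightarrow> I = M"
  proof (rule subset_Zorn)
    fix C assume C: "subset.chain S C"
    show "\<exists>U\<in>S. \<forall>Y\<in>C. Y \<subseteq> U"
    proof (cases "C = {}")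
      case True then show ?thesis using assms(1) by auto
    next
      case False
      have "subset.chain {I. ideal I R} C"
        using C assms(2) by (auto simp: pred_on.chain_def)
      then have "\<Union>C \<in> C" using ideal_chain_is_trivial False by blast
      then show ?thesis using C by (auto simp: pred_on.chain_def)
    qed
  qed
  then show ?thesis using that by blast
qed

lemma (in noetherian_ring) ascending_chain_stationary:
  fixes J :: "nat \<Rightarrow> 'a set"
  assumes "\<And>n. ideal (J n) R" "\<And>n. J n \<subseteq> J (Suc n)"
  obtains N where "\<And>n. n \<ge> N \<Longrightarrow> J n = J N"
proof -
  obtain M where M: "M \<in> range J" "\<And>I. I \<in> range J \<Longrightarrow> M \<subseteq> I \<Longrightarrow> I = M"
    using maximal_ideal_in_family[of "range J"] assms(1) by blast
  then obtain N where "M = J N" by auto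
  moreover have "J N \<subseteq> J n" if "n \<ge> N" for n
    using that assms(2) by (rule lift_Suc_mono_le[rotated])
  ultimately show ?thesis using that[of N] M(2) by blast
qed

lemma (in ring_hom_ring) noetherian_image:
  assumes "noetherian_ring R" "h ` carrier R = carrier S"
  shows "noetherian_ring S"
proof (rule S.noetherian_ringI)
  fix I assume I: "ideal I S"
  let ?J = "{r \<in> carrier R. h r \<in> I}"
  obtain A where A: "A \<subseteq> carrier R" "finite A" "?J = Idl\<^bsub>R\<^esub> A"
    using noetherian_ring.finetely_gen[OF assms(1) ideal_vimage[OF I]] by blast
  have hA: "h ` A \<subseteq> carrier S" using A by auto
  have "I = Idl\<^bsub>S\<^esub> (h ` A)"
  proof
    have "A \<subseteq> {r \<in> carrier R. h r \<in> Idl\<^bsub>S\<^esub> (h ` A)}"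
      using A(1) S.genideal_self[OF hA] by auto
    then have "?J \<subseteq> {r \<in> carrier R. h r \<in> Idl\<^bsub>S\<^esub> (h ` A)}"
      unfolding A(3) by (rule R.genideal_minimal[OF ideal_vimage[OF S.genideal_ideal[OF hA]]])
    then show "I \<subseteq> Idl\<^bsub>S\<^esub> (h ` A)"
      using S.ideal_subset_carrier[OF I] assms(2) by (auto simp: subset_iff image_iff) (metis imageE)
    show "Idl\<^bsub>S\<^esub> (h ` A) \<subseteq> I"
      using A R.genideal_self[OF A(1)] by (intro S.genideal_minimal[OF I]) auto
  qed
  then show "\<exists>A\<subseteq>carrier S. finite A \<and> I = Idl\<^bsub>S\<^esub> A" using A hA by blast
qed

section \<open>The Hilbert basis theorem\<close>

text \<open>  The combinations of \<open>1, x, \<dots>, x ^ (n - 1)\<close> with coefficients in \<open>A\<close>. The element \<open>x\<close> need not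
  be transcendental over \<open>A\<close>, so an element of \<open>A[x]\<close> has no degree; it only belongs to all
  sufficiently large levels of this filtration.\<close>
primrec combos :: "('a, 'b) ring_scheme \<Rightarrow> 'a set \<Rightarrow> 'a \<Rightarrow> nat \<Rightarrow> 'a set" where
  "combos R A x 0 = {\<zero>\<^bsub>R\<^esub>}"
| "combos R A x (Suc n) = {p \<oplus>\<^bsub>R\<^esub> a \<otimes>\<^bsub>R\<^esub> x [^]\<^bsub>R\<^esub> n | p a. p \<in> combos R A x n \<and> a \<in> A}"

definition adjoin :: "('a, 'b) ring_scheme \<Rightarrow> 'a set \<Rightarrow> 'a \<Rightarrow> 'a set" where
  "adjoin R A x = (\<Union>n. combos R A x n)"

text \<open>  Hilbert's ideal of coefficients of \<open>x ^ n\<close> in the elements of \<open>J\<close> at level \<open>n + 1\<close>.\<close>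
definition leading_coeffs :: "('a, 'b) ring_scheme \<Rightarrow> 'a set \<Rightarrow> 'a \<Rightarrow> 'a set \<Rightarrow> nat \<Rightarrow> 'a set" where
  "leading_coeffs R A x J n = {a \<in> A. \<exists>p\<in>combos R A x n. p \<oplus>\<^bsub>R\<^esub> a \<otimes>\<^bsub>R\<^esub> x [^]\<^bsub>R\<^esub> n \<in> J}"

locale subring_with_element = cring R for R (structure) +
  fixes A x
  assumes subring: "subring A R" and x_closed [simp]: "x \<in> carrier R"
begin

abbreviation "C \<equiv> combos R A x"

lemmas A_ring = subringE[OF subring]

lemma A_closed [simp]: "a \<in> A \<Longrightarrow> a \<in> carrier R" using A_ring(1) by auto

lemma combos_closed: "p \<in> C n \<Longrightarrow> p \<in> carrier R"
  by (induction n arbitrary: p) auto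

lemma combos_zero: "\<zero> \<in> C n"
proof (induction n)
  case (Suc n)
  have "\<zero> = \<zero> \<oplus> \<zero> \<otimes> x [^] n" by simp
  then show ?case using Suc A_ring(2) unfolding combos.simps by blast
qed simp

lemma combos_Suc: "p \<in> C n \<Longrightarrow> p \<in> C (Suc n)"
proof -
  assume p: "p \<in> C n"
  have "p = p \<oplus> \<zero> \<otimes> x [^] n" using combos_closed[OF p] by simp
  then show ?thesis using p A_ring(2) unfolding combos.simps by blast
qed

lemma combos_mono: "p \<in> C n \<Longrightarrow> n \<le> m \<Longrightarrow> p \<in> C m"
  using lift_Suc_mono_le[of C n m] combos_Suc by blast

lemma combos_add: "p \<in> C n \<Longrightarrow> q \<in> C n \<Longrightarrow> p \<oplus> q \<in> C n"
proof (induction n arbitrary: p q)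
  case (Suc n)
  then obtain p' a q' b where *: "p = p' \<oplus> a \<otimes> x [^] n" "q = q' \<oplus> b \<otimes> x [^] n"
    "p' \<in> C n" "q' \<in> C n" "a \<in> A" "b \<in> A" by auto
  have "p \<oplus> q = (p' \<oplus> q') \<oplus> (a \<oplus> b) \<otimes> x [^] n"
    using * combos_closed by (simp add: l_distr a_ac)
  then show ?case using Suc.IH[of p' q'] * A_ring(7) unfolding combos.simps by blast
qed simp

lemma combos_scale: "p \<in> C n \<Longrightarrow> a \<in> A \<Longrightarrow> a \<otimes> p \<in> C n"
proof (induction n arbitrary: p)
  case (Suc n)
  then obtain p' b where *: "p = p' \<oplus> b \<otimes> x [^] n" "p' \<in> C n" "b \<in> A" by auto
  have "a \<otimes> p = a \<otimes> p' \<oplus> (a \<otimes> b) \<otimes> x [^] n"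
    using * Suc.prems combos_closed by (simp add: r_distr m_assoc)
  then show ?case using Suc.IH[of p'] * Suc.prems A_ring(6) unfolding combos.simps by blast
qed simp

lemma combos_neg: "p \<in> C n \<Longrightarrow> \<ominus> p \<in> C n"
proof -
  assume p: "p \<in> C n"
  have "(\<ominus> \<one>) \<otimes> p \<in> C n" using combos_scale[OF p] A_ring(3,5) by blast
  moreover have "(\<ominus> \<one>) \<otimes> p = \<ominus> p" using combos_closed[OF p] by (simp add: l_minus)
  ultimately show ?thesis by simp
qed

lemma combos_shift: "p \<in> C n \<Longrightarrow> p \<otimes> x \<in> C (Suc n)"
proof (induction n arbitrary: p)
  case 0
  then show ?case using combos_zero by (simp del: combos.simps(2))
next
  case (Suc n)
  then obtain p' b where *: "p = p' \<oplus> b \<otimes> x [^] n" "p' \<in> C n" "b \<in> A" by auto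
  have "p \<otimes> x = p' \<otimes> x \<oplus> b \<otimes> x [^] Suc n"
    using * combos_closed by (simp add: l_distr m_assoc)
  moreover have "p' \<otimes> x \<in> C (Suc n)" by (rule Suc.IH[OF *(2)])
  ultimately show ?case unfolding combos.simps(2)[of R A x "Suc n"] using *(3) by blast
qed

lemma combos_shift_pow: "p \<in> C n \<Longrightarrow> p \<otimes> x [^] k \<in> C (n + k)"
proof (induction k)
  case 0 then show ?case using combos_closed[OF 0] by simp
next
  case (Suc k)
  have "p \<otimes> x [^] Suc k = (p \<otimes> x [^] k) \<otimes> x" using combos_closed[OF Suc.prems] by (simp add: m_assoc)
  then show ?case using combos_shift[OF Suc.IH[OF Suc.prems]] by simp
qed

lemma combos_mult: "p \<in> C n \<Longrightarrow> q \<in> C m \<Longrightarrow> p \<otimes> q \<in> C (n + m)"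
proof (induction m arbitrary: q)
  case 0 then show ?case using combos_zero combos_closed[OF 0(1)] by simp
next
  case (Suc m)
  then obtain q' b where *: "q = q' \<oplus> b \<otimes> x [^] m" "q' \<in> C m" "b \<in> A" by auto
  have "p \<otimes> q = p \<otimes> q' \<oplus> b \<otimes> (p \<otimes> x [^] m)"
    using * combos_closed[OF Suc.prems(1)] combos_closed[OF *(2)] by (simp add: r_distr m_ac)
  moreover have "p \<otimes> q' \<in> C (n + Suc m)"
    using combos_mono[OF Suc.IH[OF Suc.prems(1) *(2)]] by (simp del: combos.simps)
  moreover have "b \<otimes> (p \<otimes> x [^] m) \<in> C (n + Suc m)"
    using combos_mono[OF combos_scale[OF combos_shift_pow[OF Suc.prems(1), of m] *(3)]]
    by (simp del: combos.simps)
  ultimately show ?case using combos_add by (simp del: combos.simps)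
qed

lemma combos_const: "a \<in> A \<Longrightarrow> a \<in> C (Suc 0)"
proof -
  assume a: "a \<in> A"
  then have "a = \<zero> \<oplus> a \<otimes> x [^] (0::nat)" by simp
  then show ?thesis using a unfolding combos.simps by blast
qed

lemma base_subset_adjoin: "A \<subseteq> adjoin R A x"
  using combos_const unfolding adjoin_def by blast

lemma subring_adjoin: "subring (adjoin R A x) R"
proof (rule subringI)
  have join: "\<exists>n. p \<in> C n \<and> q \<in> C n" if "p \<in> adjoin R A x" "q \<in> adjoin R A x" for p q
    using that combos_mono unfolding adjoin_def by (metis UN_E max.cobounded1 max.cobounded2)
  show "adjoin R A x \<subseteq> carrier R" using combos_closed by (auto simp: adjoin_def)
  show "\<one> \<in> adjoin R A x" using base_subset_adjoin A_ring(3) by blast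
  show "\<ominus> p \<in> adjoin R A x" if "p \<in> adjoin R A x" for p
    using that combos_neg by (auto simp: adjoin_def)
  show "p \<otimes> q \<in> adjoin R A x" "p \<oplus> q \<in> adjoin R A x"
    if pq: "p \<in> adjoin R A x" "q \<in> adjoin R A x" for p q
  proof -
    obtain n where "p \<in> C n" "q \<in> C n" using join[OF pq] by blast
    then have "p \<otimes> q \<in> C (n + n)" "p \<oplus> q \<in> C n" using combos_mult combos_add by auto
    then show "p \<otimes> q \<in> adjoin R A x" "p \<oplus> q \<in> adjoin R A x" unfolding adjoin_def by blast+
  qed
qed

lemma element_in_adjoin: "x \<in> adjoin R A x"
  using combos_shift[OF combos_const[OF A_ring(3)]] unfolding adjoin_def
  by (simp del: combos.simps) blast

lemma adjoin_least: "subring B R \<Longrightarrow> A \<subseteq> B \<Longrightarrow> x \<in> B \<Longrightarrow> adjoin R A x \<subseteq> B"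
proof -
  assume B: "subring B R" "A \<subseteq> B" "x \<in> B"
  note B' = subringE[OF B(1)]
  have pow: "x [^] n \<in> B" for n :: nat by (induction n) (use B B' in auto)
  have "C n \<subseteq> B" for n
    by (induction n) (use B B' pow in \<open>auto simp: subset_iff\<close>)
  then show ?thesis unfolding adjoin_def by blast
qed

lemma cring_A: "cring (R\<lparr>carrier := A\<rparr>)"
  using subcring_iff[OF A_ring(1)] subcringI' subring by blast

lemma cring_adjoin: "cring (R\<lparr>carrier := adjoin R A x\<rparr>)"
  using subcring_iff subcringI' subring_adjoin subringE(1) by blast

lemma leading_coeffs_ideal:
  assumes J: "ideal J (R\<lparr>carrier := adjoin R A x\<rparr>)"
  shows "ideal (leading_coeffs R A x J n) (R\<lparr>carrier := A\<rparr>)"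
proof (rule cring.idealI_comm[OF cring_A])
  interpret A': cring "R\<lparr>carrier := adjoin R A x\<rparr>" by (rule cring_adjoin)
  note Jc = A'.ideal_closed[OF J, simplified]
  let ?L = "leading_coeffs R A x J n"
  show "?L \<subseteq> carrier (R\<lparr>carrier := A\<rparr>)" by (auto simp: leading_coeffs_def)
  have "\<zero> \<oplus> \<zero> \<otimes> x [^] n \<in> J" using Jc(1) by simp
  then show "\<zero>\<^bsub>R\<lparr>carrier := A\<rparr>\<^esub> \<in> ?L"
    using A_ring(2) combos_zero unfolding leading_coeffs_def by (auto intro!: bexI[of _ \<zero>])
  show "a \<oplus>\<^bsub>R\<lparr>carrier := A\<rparr>\<^esub> b \<in> ?L" if "a \<in> ?L" "b \<in> ?L" for a b
  proof -
    from that obtain p q where *: "a \<in> A" "b \<in> A" "p \<in> C n" "q \<in> C n"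
      "p \<oplus> a \<otimes> x [^] n \<in> J" "q \<oplus> b \<otimes> x [^] n \<in> J" by (auto simp: leading_coeffs_def)
    have "(p \<oplus> a \<otimes> x [^] n) \<oplus> (q \<oplus> b \<otimes> x [^] n) = (p \<oplus> q) \<oplus> (a \<oplus> b) \<otimes> x [^] n"
      using * combos_closed by (simp add: l_distr a_ac)
    then have "(p \<oplus> q) \<oplus> (a \<oplus> b) \<otimes> x [^] n \<in> J" using Jc(2) * by metis
    then show ?thesis using * A_ring(7) combos_add unfolding leading_coeffs_def by auto
  qed
  show "r \<otimes>\<^bsub>R\<lparr>carrier := A\<rparr>\<^esub> a \<in> ?L" if "a \<in> ?L" "r \<in> carrier (R\<lparr>carrier := A\<rparr>)" for a r
  proof -
    from that obtain p where *: "a \<in> A" "r \<in> A" "p \<in> C n" "p \<oplus> a \<otimes> x [^] n \<in> J"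
      by (auto simp: leading_coeffs_def)
    have "r \<otimes> (p \<oplus> a \<otimes> x [^] n) = r \<otimes> p \<oplus> (r \<otimes> a) \<otimes> x [^] n"
      using * combos_closed by (simp add: r_distr m_assoc)
    moreover have "r \<otimes> (p \<oplus> a \<otimes> x [^] n) \<in> J" using Jc(5) * base_subset_adjoin by blast
    ultimately show ?thesis using * A_ring(6) combos_scale unfolding leading_coeffs_def by auto
  qed
qed

lemma leading_coeffs_Suc:
  assumes J: "ideal J (R\<lparr>carrier := adjoin R A x\<rparr>)"
  shows "leading_coeffs R A x J n \<subseteq> leading_coeffs R A x J (Suc n)"
proof
  interpret A': cring "R\<lparr>carrier := adjoin R A x\<rparr>" by (rule cring_adjoin)
  fix a assume "a \<in> leading_coeffs R A x J n"
  then obtain p where *: "a \<in> A" "p \<in> C n" "p \<oplus> a \<otimes> x [^] n \<in> J"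
    by (auto simp: leading_coeffs_def)
  have "(p \<oplus> a \<otimes> x [^] n) \<otimes> x = p \<otimes> x \<oplus> a \<otimes> x [^] Suc n"
    using * combos_closed by (simp add: l_distr m_assoc)
  moreover have "(p \<oplus> a \<otimes> x [^] n) \<otimes> x \<in> J"
    using A'.ideal_closed(6)[OF J *(3), of x] element_in_adjoin by simp
  ultimately show "a \<in> leading_coeffs R A x J (Suc n)"
    using *(1) combos_shift[OF *(2)] unfolding leading_coeffs_def by (auto simp del: combos.simps)
qed

text \<open>  Subtracting from an element of \<open>J\<close> an element of \<open>K\<close> with the same leading term lowers
  the level, so an element of \<open>J\<close> is used up by elements of \<open>K\<close>.\<close>
lemma ideal_eq_of_leading_coeffs:
  assumes J: "ideal J (R\<lparr>carrier := adjoin R A x\<rparr>)" and K: "ideal K (R\<lparr>carrier := adjoin R A x\<rparr>)"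
    and "K \<subseteq> J" and lead: "\<And>n. leading_coeffs R A x J n \<subseteq> leading_coeffs R A x K n"
  shows "J = K"
proof -
  interpret A': cring "R\<lparr>carrier := adjoin R A x\<rparr>" by (rule cring_adjoin)
  note Jc = A'.ideal_closed[OF J, simplified] and Kc = A'.ideal_closed[OF K, simplified]
  have sub: "adjoin R A x \<subseteq> carrier R" using subringE(1)[OF subring_adjoin] .
  have "f \<in> K" if "f \<in> J" "f \<in> C n" for f n
    using that
  proof (induction n arbitrary: f)
    case 0 then show ?case using Kc(1) by simp
  next
    case (Suc n)
    then obtain p a where f: "f = p \<oplus> a \<otimes> x [^] n" "p \<in> C n" "a \<in> A" by auto
    then have "a \<in> leading_coeffs R A x J n" using Suc.prems unfolding leading_coeffs_def by auto
    then obtain q where q: "q \<in> C n" "q \<oplus> a \<otimes> x [^] n \<in> K"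
      using lead unfolding leading_coeffs_def by blast
    let ?g = "q \<oplus> a \<otimes> x [^] n"
    have pq: "p \<in> carrier R" "q \<in> carrier R" "a \<otimes> x [^] n \<in> carrier R"
      using f q combos_closed by auto
    have cs: "f \<in> adjoin R A x" "?g \<in> adjoin R A x" using Jc(7) Kc(7) q(2) Suc.prems by auto
    have m1: "(\<ominus> \<one>) \<in> adjoin R A x" using subringE(3,5)[OF subring_adjoin] by blast
    have "(\<ominus> \<one>) \<otimes> ?g = \<ominus> ?g" using pq by (simp add: l_minus)
    moreover have "(\<ominus> \<one>) \<otimes> ?g \<in> K" using Kc(5)[OF q(2) m1] .
    ultimately have ng: "\<ominus> ?g \<in> K" by simp
    have "f \<oplus> \<ominus> ?g = p \<oplus> \<ominus> q" unfolding f(1) using pq by algebra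
    moreover have "f \<oplus> \<ominus> ?g \<in> J" using Jc(2)[OF Suc.prems(1)] ng assms(3) by blast
    moreover have "p \<oplus> \<ominus> q \<in> C n" using combos_add[OF f(2) combos_neg[OF q(1)]] .
    ultimately have "f \<oplus> \<ominus> ?g \<in> K" using Suc.IH by simp
    then have "(f \<oplus> \<ominus> ?g) \<oplus> ?g \<in> K" using Kc(2)[OF _ q(2)] by blast
    moreover have "(f \<oplus> \<ominus> ?g) \<oplus> ?g = f" unfolding f(1) using pq by algebra
    ultimately show ?case by simp
  qed
  moreover have "\<exists>n. f \<in> C n" if "f \<in> J" for f
    using Jc(7)[OF that] unfolding adjoin_def by auto
  ultimately show ?thesis using assms(3) by blast
qed

text \<open>  Hilbert's basis theorem for a subring \<open>A\<close> of a fixed ring and one more element of that ring. In this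
  form it can be iterated without a change of type, unlike the passage to a polynomial ring.

  The ideals of leading coefficients form an ascending chain that is constant from some \<open>N\<close> on.
  Lifting generators of the first \<open>N + 1\<close> of them gives an ideal with the same leading coefficients.\<close>
theorem noetherian_adjoin:
  assumes noeth: "noetherian_ring (R\<lparr>carrier := A\<rparr>)"
  shows "noetherian_ring (R\<lparr>carrier := adjoin R A x\<rparr>)"
proof -
  interpret A': cring "R\<lparr>carrier := adjoin R A x\<rparr>" by (rule cring_adjoin)
  interpret NA: noetherian_ring "R\<lparr>carrier := A\<rparr>" by fact
  let ?S = "R\<lparr>carrier := adjoin R A x\<rparr>"
  show ?thesis
  proof (rule A'.noetherian_ringI)
    fix J assume J: "ideal J ?S"
    let ?L = "leading_coeffs R A x"
    obtain N where N: "\<And>n. n \<ge> N \<Longrightarrow> ?L J n = ?L J N"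
      using NA.ascending_chain_stationary[of "?L J"] leading_coeffs_ideal[OF J]
        leading_coeffs_Suc[OF J] by blast
    have "\<exists>G. finite G \<and> G \<subseteq> A \<and> ?L J n = genideal (R\<lparr>carrier := A\<rparr>) G" for n
      using NA.finetely_gen[OF leading_coeffs_ideal[OF J, of n]] by auto
    then obtain G where G: "\<And>n. finite (G n)" "\<And>n. G n \<subseteq> A"
      "\<And>n. ?L J n = genideal (R\<lparr>carrier := A\<rparr>) (G n)" by metis
    have "\<exists>f\<in>J. \<exists>p\<in>C n. f = p \<oplus> a \<otimes> x [^] n" if "a \<in> G n" for a n
    proof -
      have "a \<in> ?L J n" using NA.genideal_self[of "G n"] that G(2,3) by auto
      then show ?thesis by (auto simp: leading_coeffs_def)
    qed
    then have "\<exists>g. g \<in> J \<and> (\<exists>p\<in>C n. g = p \<oplus> a \<otimes> x [^] n)" if "a \<in> G n" for a n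
      using that by blast
    note ex = this
    define f where "f n a = (SOME g. g \<in> J \<and> (\<exists>p\<in>C n. g = p \<oplus> a \<otimes> x [^] n))" for n a
    have f: "f n a \<in> J \<and> (\<exists>p\<in>C n. f n a = p \<oplus> a \<otimes> x [^] n)" if "a \<in> G n" for a n
      unfolding f_def by (rule someI_ex[OF ex[OF that]])
    define F where "F = (\<Union>n\<in>{..N}. f n ` G n)"
    have F: "finite F" "F \<subseteq> J" using G(1) f by (auto simp: F_def)
    have FS: "F \<subseteq> carrier ?S" using F(2) A'.ideal_subset_carrier[OF J] by auto
    let ?K = "genideal ?S F"
    have K: "ideal ?K ?S" using A'.genideal_ideal[OF FS] .
    have KJ: "?K \<subseteq> J" by (rule A'.genideal_minimal[OF J F(2)])
    have low: "?L J n \<subseteq> ?L ?K n" if "n \<le> N" for n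
    proof -
      have "G n \<subseteq> ?L ?K n"
      proof
        fix a assume a: "a \<in> G n"
        then have "f n a \<in> ?K" using that A'.genideal_self[OF FS] by (auto simp: F_def)
        then show "a \<in> ?L ?K n" using f[OF a] a G(2) by (auto simp: leading_coeffs_def)
      qed
      then show ?thesis unfolding G(3) by (rule NA.genideal_minimal[OF leading_coeffs_ideal[OF K]])
    qed
    have up: "?L ?K n \<subseteq> ?L ?K m" if "n \<le> m" for n m
      using that leading_coeffs_Suc[OF K] by (rule lift_Suc_mono_le[rotated])
    have "?L J n \<subseteq> ?L ?K n" for n
    proof (cases "n \<le> N")
      case False
      then show ?thesis using N[of n] low[of N] up[of N n] by auto
    qed (rule low)
    then have "J = ?K" by (rule ideal_eq_of_leading_coeffs[OF J K KJ])
    then show "\<exists>A\<subseteq>carrier ?S. finite A \<and> J = genideal ?S A" using F(1) FS by blast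
  qed
qed

end

section \<open>Rees rings\<close>

definition graded :: "('a, 'b) ring_scheme \<Rightarrow> (nat \<Rightarrow> 'a set) \<Rightarrow> (nat \<Rightarrow> 'a) set" where
  "graded R F = {p \<in> carrier (UP R). \<forall>n. p n \<in> F n}"

definition rees :: "('a, 'b) ring_scheme \<Rightarrow> 'a set \<Rightarrow> ('a, nat \<Rightarrow> 'a) up_ring" where
  "rees R q = (UP R)\<lparr>carrier := graded R (ideal_pow R q)\<rparr>"

lemma graded_mono: "(\<And>n. F n \<subseteq> G n) \<Longrightarrow> graded R F \<subseteq> graded R G"
  unfolding graded_def by blast

context UP_cring
begin

lemma coeff_eq: "p \<in> carrier P \<Longrightarrow> up_ring.coeff P p n = p n"
  unfolding P_def UP_def by (simp only: up_ring.simps partial_object.simps restrict_apply' module.simps)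

lemma UP_apply:
  assumes "p \<in> carrier P" "q \<in> carrier P"
  shows "(p \<oplus>\<^bsub>P\<^esub> q) n = p n \<oplus> q n" "(p \<otimes>\<^bsub>P\<^esub> q) n = (\<Oplus>i\<in>{..n}. p i \<otimes> q (n - i))"
    "(\<ominus>\<^bsub>P\<^esub> p) n = \<ominus> p n" "p n \<in> carrier R"
  using assms coeff_add[of p q n] coeff_mult[of p q n] coeff_a_inv[of p n] coeff_closed[of p n]
  by (simp_all add: coeff_eq)

lemma UP_apply_consts:
  "\<zero>\<^bsub>P\<^esub> n = \<zero>" "\<one>\<^bsub>P\<^esub> n = (if n = 0 then \<one> else \<zero>)"
  "a \<in> carrier R \<Longrightarrow> up_ring.monom P a m n = (if m = n then a else \<zero>)"
  using coeff_zero[of n, unfolded coeff_eq[OF UP_zero_closed]]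
    coeff_one[of n, unfolded coeff_eq[OF UP_one_closed]]
    coeff_monom[of a m n] coeff_eq[OF monom_closed, of a m n] by simp_all

lemma graded_subset: "graded R F \<subseteq> carrier P"
  by (auto simp: graded_def P_def)

lemma graded_mem: "p \<in> graded R F \<longleftrightarrow> p \<in> carrier P \<and> (\<forall>n. p n \<in> F n)"
  by (auto simp: graded_def P_def)

lemma graded_monom: 
  assumes "\<And>n. ideal (F n) R" "a \<in> carrier R"
  shows "up_ring.monom P a n \<in> graded R F \<longleftrightarrow> a \<in> F n"
proof -
  have "(\<forall>k. up_ring.monom P a n k \<in> F k) \<longleftrightarrow> a \<in> F n"
    using assms R.ideal_closed(1)[OF assms(1)] UP_apply_consts(3)[OF assms(2)] by metis
  then show ?thesis using assms(2) by (simp add: graded_mem)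
qed

lemma graded_zero: "(\<And>n. ideal (F n) R) \<Longrightarrow> \<zero>\<^bsub>P\<^esub> \<in> graded R F"
  using R.ideal_closed(1) by (auto simp: graded_mem UP_apply_consts)

lemma graded_add:
  assumes "\<And>n. ideal (F n) R" "p \<in> graded R F" "q \<in> graded R F"
  shows "p \<oplus>\<^bsub>P\<^esub> q \<in> graded R F"
  using assms(2,3) R.ideal_closed(2)[OF assms(1)] by (auto simp: graded_mem UP_apply)

lemma graded_mult:
  assumes H: "\<And>n. ideal (H n) R" and pq: "p \<in> graded R F" "q \<in> graded R G"
    and FG: "\<And>a b x y. x \<in> F a \<Longrightarrow> y \<in> G b \<Longrightarrow> x \<otimes> y \<in> H (a + b)"
  shows "p \<otimes>\<^bsub>P\<^esub> q \<in> graded R H"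
proof -
  have pq': "p \<in> carrier P" "q \<in> carrier P" using pq by (auto simp: graded_mem)
  have "(\<Oplus>i\<in>{..n}. p i \<otimes> q (n - i)) \<in> H n" for n
  proof (rule R.ideal_finsum_closed[OF H])
    fix i assume "i \<in> {..n}"
    then show "p i \<otimes> q (n - i) \<in> H n"
      using FG[of "p i" i "q (n - i)" "n - i"] pq by (simp add: graded_mem)
  qed simp
  then show ?thesis using pq' by (simp add: graded_mem UP_apply)
qed

lemma rees_simps:
  "carrier (rees R q) = graded R (ideal_pow R q)" "monoid.mult (rees R q) = monoid.mult P"
  "ring.add (rees R q) = ring.add P" "\<one>\<^bsub>rees R q\<^esub> = \<one>\<^bsub>P\<^esub>" "\<zero>\<^bsub>rees R q\<^esub> = \<zero>\<^bsub>P\<^esub>"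
  by (auto simp: rees_def P_def)

lemma ideal_pow_mem_add:
  assumes "ideal q R" "x \<in> ideal_pow R q a" "y \<in> ideal_pow R q b"
  shows "x \<otimes> y \<in> ideal_pow R q (a + b)"
  using assms by (simp add: R.ideal_pow_add ideal_prod.prod)

lemma rees_subring:
  assumes q: "ideal q R"
  shows "subring (graded R (ideal_pow R q)) P"
proof -
  show ?thesis
  proof (rule P.subringI)
    show "graded R (ideal_pow R q) \<subseteq> carrier P" by (rule graded_subset)
    show "\<one>\<^bsub>P\<^esub> \<in> graded R (ideal_pow R q)"
      using R.ideal_closed(1)[OF R.ideal_pow_ideal[OF q]]
      by (auto simp: graded_mem UP_apply_consts R.ideal_pow_simps)
    show "\<ominus>\<^bsub>P\<^esub> p \<in> graded R (ideal_pow R q)" if "p \<in> graded R (ideal_pow R q)" for p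
      using that R.ideal_closed(3)[OF R.ideal_pow_ideal[OF q]] by (auto simp: graded_mem UP_apply)
    show "p \<otimes>\<^bsub>P\<^esub> r \<in> graded R (ideal_pow R q)"
      if "p \<in> graded R (ideal_pow R q)" "r \<in> graded R (ideal_pow R q)" for p r
      by (rule graded_mult[OF R.ideal_pow_ideal[OF q] that]) (rule ideal_pow_mem_add[OF q])
    show "p \<oplus>\<^bsub>P\<^esub> r \<in> graded R (ideal_pow R q)"
      if "p \<in> graded R (ideal_pow R q)" "r \<in> graded R (ideal_pow R q)" for p r
      using graded_add[OF R.ideal_pow_ideal[OF q] that] .
  qed
qed

lemma rees_cring: "ideal q R \<Longrightarrow> cring (rees R q)"
  using cring.subcringI'[OF UP_cring rees_subring]
    ring.subcring_iff[OF UP_ring graded_subset] by (auto simp: rees_def P_def)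

text \<open>  Homogeneous ideals of the Rees ring are families of ideals of \<open>R\<close> on which the powers of \<open>q\<close> act.\<close>
lemma graded_ideal:
  assumes q: "ideal q R" and F: "\<And>n. ideal (F n) R" "\<And>n. F n \<subseteq> ideal_pow R q n"
    and act: "\<And>a b x y. x \<in> ideal_pow R q a \<Longrightarrow> y \<in> F b \<Longrightarrow> x \<otimes> y \<in> F (a + b)"
  shows "ideal (graded R F) (rees R q)"
proof (rule cring.idealI_comm[OF rees_cring[OF q]])
  show "graded R F \<subseteq> carrier (rees R q)" using graded_mono[OF F(2)] by (simp add: rees_simps)
  show "\<zero>\<^bsub>rees R q\<^esub> \<in> graded R F" using graded_zero[OF F(1)] by (simp add: rees_simps)
  show "x \<oplus>\<^bsub>rees R q\<^esub> y \<in> graded R F" if "x \<in> graded R F" "y \<in> graded R F" for x y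
    using graded_add[OF F(1) that] by (simp add: rees_simps)
  show "r \<otimes>\<^bsub>rees R q\<^esub> x \<in> graded R F" if "x \<in> graded R F" "r \<in> carrier (rees R q)" for x r
    using graded_mult[OF F(1) _ that(1), of r "ideal_pow R q"] act that(2) by (simp add: rees_simps)
qed

lemma subring_finsum_closed:
  assumes "subring B P" "finite A" "\<And>a. a \<in> A \<Longrightarrow> f a \<in> B"
  shows "(\<Oplus>\<^bsub>P\<^esub>a\<in>A. f a) \<in> B"
proof -
  note B = subringE[OF assms(1)]
  show ?thesis using assms(2,3)
  proof (induction A)
    case empty then show ?case using B by simp
  next
    case (insert a A)
    then have "f \<in> A \<rightarrow> carrier P" "f a \<in> carrier P" using B(1) by auto
    with insert show ?case using B by simp
  qed
qed

lemma noetherian_constants: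
  assumes "noetherian_ring R"
  shows "subring ((\<lambda>a. up_ring.monom P a 0) ` carrier R) P"
    "noetherian_ring (P\<lparr>carrier := (\<lambda>a. up_ring.monom P a 0) ` carrier R\<rparr>)"
proof -
  let ?h = "\<lambda>a. up_ring.monom P a 0" and ?B = "(\<lambda>a. up_ring.monom P a 0) ` carrier R"
  interpret h: ring_hom_ring R P ?h
    by (rule ring_hom_ringI2[OF R.ring_axioms UP_ring const_ring_hom])
  show sub: "subring ?B P" using h.img_is_subring[OF R.carrier_is_subring] .
  have "ring (P\<lparr>carrier := ?B\<rparr>)" using h.img_is_ring .
  moreover have "?h \<in> ring_hom R (P\<lparr>carrier := ?B\<rparr>)"
    using const_ring_hom by (auto simp: ring_hom_def)
  ultimately interpret h': ring_hom_ring R "P\<lparr>carrier := ?B\<rparr>" ?h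
    using R.ring_axioms by (simp add: ring_hom_ringI2)
  show "noetherian_ring (P\<lparr>carrier := ?B\<rparr>)" by (rule h'.noetherian_image[OF assms]) simp
qed

text \<open>  The Rees ring is generated over the constants by the monomials \<open>y t\<close>, where \<open>y\<close> runs through finitely
  many generators of \<open>q\<close>. Adjoining them one at a time preserves the Noetherian property.\<close>
theorem noetherian_rees:
  assumes noeth: "noetherian_ring R" and q: "ideal q R"
  shows "noetherian_ring (rees R q)"
proof -
  let ?R0 = "(\<lambda>a. up_ring.monom P a 0) ` carrier R" and ?S = "graded R (ideal_pow R q)"
  obtain Y where Y: "Y \<subseteq> carrier R" "finite Y" "q = Idl Y"
    using noetherian_ring.finetely_gen[OF noeth q] by blast
  have Yq: "Y \<subseteq> q" unfolding Y(3) by (rule R.genideal_self[OF Y(1)])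
  have "\<exists>B. subring B P \<and> noetherian_ring (P\<lparr>carrier := B\<rparr>) \<and> ?R0 \<subseteq> B \<and> B \<subseteq> ?S
     \<and> (\<forall>y\<in>Y. up_ring.monom P y 1 \<in> B)"
    using Y(2) Yq
    \<comment> \<open>\<open>B\<close> is obtained by adjoining the monomials \<open>y t\<close> to the constants\<close>
  proof (induction Y)
    case empty
    have "?R0 \<subseteq> ?S" using q by (auto simp: graded_monom R.ideal_pow_simps)
    then show ?case using noetherian_constants[OF noeth] by blast
  next
    case (insert y Y)
    then obtain B where B: "subring B P" "noetherian_ring (P\<lparr>carrier := B\<rparr>)" "?R0 \<subseteq> B" "B \<subseteq> ?S"
      "\<forall>y\<in>Y. up_ring.monom P y 1 \<in> B" by auto
    have y: "y \<in> carrier R" "y \<in> q" using insert.prems R.ideal_closed(7)[OF q] by auto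
    interpret adj: subring_with_element P B "up_ring.monom P y 1"
      by (intro subring_with_element.intro subring_with_element_axioms.intro UP_cring
        B(1) monom_closed y(1))
    have "up_ring.monom P y 1 \<in> ?S" using q y by (simp add: graded_monom R.ideal_pow_1)
    then have "adjoin P B (up_ring.monom P y 1) \<subseteq> ?S"
      using adj.adjoin_least[OF rees_subring[OF q] B(4)] by blast
    moreover have "\<forall>z\<in>insert y Y. up_ring.monom P z 1 \<in> adjoin P B (up_ring.monom P y 1)"
      using B(5) adj.base_subset_adjoin adj.element_in_adjoin by auto
    moreover have "?R0 \<subseteq> adjoin P B (up_ring.monom P y 1)"
      using B(3) adj.base_subset_adjoin by blast
    ultimately show ?case
      using adj.subring_adjoin adj.noetherian_adjoin[OF B(2)] by blast
  qed
  then obtain B where B: "subring B P" "noetherian_ring (P\<lparr>carrier := B\<rparr>)" "?R0 \<subseteq> B" "B \<subseteq> ?S"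
    "\<And>y. y \<in> Y \<Longrightarrow> up_ring.monom P y 1 \<in> B" by blast
  note Bc = subringE[OF B(1)]
  let ?T = "\<lambda>n. {a \<in> carrier R. up_ring.monom P a n \<in> B}"
  \<comment> \<open>\<open>B\<close> is everything: degree by degree, the coefficients occurring in \<open>B\<close> form an ideal\<close>
  have pre: "ideal (?T n) R" for n
  proof (rule R.idealI_comm)
    show "\<zero> \<in> ?T n" using Bc(2) by simp
    show "a \<oplus> b \<in> ?T n"
      if "a \<in> ?T n" "b \<in> ?T n" for a b
      using that Bc(7) by simp
    show "r \<otimes> a \<in> ?T n"
      if "a \<in> ?T n" "r \<in> carrier R" for a r
      using that Bc(6)[of "up_ring.monom P r 0" "up_ring.monom P a n"] B(3) monom_mult[of r a 0 n] by auto
  qed auto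
  have q1: "q \<subseteq> ?T 1"
    unfolding Y(3) by (rule R.genideal_minimal[OF pre]) (use Y B in auto)
  have mon: "ideal_pow R q n \<subseteq> ?T n" for n
  proof (induction n)
    case 0 then show ?case using B(3) by (auto simp: R.ideal_pow_simps)
  next
    case (Suc n)
    show ?case unfolding R.ideal_pow_simps
    proof (rule R.ideal_prod_least[OF pre])
      fix i j assume "i \<in> ideal_pow R q n" "j \<in> q"
      then have ij: "i \<in> carrier R" "j \<in> carrier R" "up_ring.monom P i n \<in> B" "up_ring.monom P j 1 \<in> B"
        using Suc q1 by auto
      then show "i \<otimes> j \<in> ?T (Suc n)"
        using Bc(6)[of "up_ring.monom P i n" "up_ring.monom P j 1"] monom_mult[of i j n 1] by simp
    qed
  qed
  have "?S \<subseteq> B"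
  proof
    fix p assume p: "p \<in> ?S"
    then have pP: "p \<in> carrier P" by (simp add: graded_mem)
    have "(\<Oplus>\<^bsub>P\<^esub> i \<in> {..UnivPoly.deg R p}. up_ring.monom P (up_ring.coeff P p i) i) \<in> B"
      by (rule subring_finsum_closed[OF B(1)])
        (use p mon in \<open>auto simp: coeff_eq[OF pP] graded_mem\<close>)
    then show "p \<in> B" using up_repr[OF pP] by simp
  qed
  then have "?S = B" using B(4) by blast
  then show ?thesis using B(2) by (simp add: rees_def P_def)
qed

end

section \<open>The Artin--Rees lemma\<close>

context cring begin

lemma ideal_prod_act:
  assumes "ideal q R" "ideal T R" "x \<in> ideal_pow R q a" "y \<in> ideal_pow R q b \<cdot> T"
  shows "x \<otimes> y \<in> ideal_pow R q (a + b) \<cdot> T"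
  using assms ideal_prod_assoc[of "ideal_pow R q a" "ideal_pow R q b" T]
  by (simp add: ideal_pow_add ideal_prod.prod)

text \<open>  The homogeneous ideal with components \<open>q ^ a \<inter> T\<close> of the Rees ring is the union of an ascending
  chain, whose \<open>n\<close>-th member agrees with it up to degree \<open>n\<close> and is generated from degree \<open>n\<close> onwards.
  The index \<open>c\<close> from which on the chain is constant has the required property.\<close>
theorem artin_rees:
  assumes noeth: "noetherian_ring R" and q: "ideal q R" and T: "ideal T R"
  obtains c where "\<And>a. a \<ge> c \<Longrightarrow> ideal_pow R q a \<inter> T \<subseteq> ideal_pow R q (a - c) \<cdot> T"
proof -
  interpret U: UP_cring R "UP R" by unfold_locales (rule reflexive)
  let ?q = "ideal_pow R q"
  define F where "F n a = (if a \<le> n then ?q a \<inter> T else ?q (a - n) \<cdot> (?q n \<inter> T))" for n a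
  have qT: "ideal (?q n \<inter> T) R" for n by (rule i_intersect) (use q T in auto)
  have F_id: "ideal (F n a) R" for n a
    using q qT by (auto simp: F_def intro!: ideal_prod_is_ideal)
  have F_sub: "F n a \<subseteq> ?q a \<inter> T" for n a
  proof (cases "a \<le> n")
    case False
    have "?q (a - n) \<cdot> (?q n \<inter> T) \<subseteq> ?q a \<inter> T"
    proof (rule ideal_prod_least[OF qT])
      fix i j assume ij: "i \<in> ?q (a - n)" "j \<in> ?q n \<inter> T"
      then have "i \<otimes> j \<in> ?q (a - n + n)" using q U.ideal_pow_mem_add by blast
      then show "i \<otimes> j \<in> ?q a \<inter> T"
        using ij False ideal_closed(5)[OF T] ideal_closed(7)[OF ideal_pow_ideal[OF q]] by auto
    qed
    then show ?thesis using False by (simp add: F_def)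
  qed (simp add: F_def)
  have act: "x \<otimes> y \<in> F n (a + b)" if x: "x \<in> ?q a" and y: "y \<in> F n b" for x y n a b
  proof -
    have xc: "x \<in> carrier R" using x ideal_closed(7)[OF ideal_pow_ideal[OF q]] by blast
    show ?thesis
    proof (cases "a + b \<le> n")
      case True
      then have "y \<in> ?q b" "y \<in> T" using y F_sub by auto
      then show ?thesis
        using True x q U.ideal_pow_mem_add ideal_closed(5)[OF T _ xc] by (auto simp: F_def)
    next
      case False
      show ?thesis
      proof (cases "b \<le> n")
        case True
        then have y': "y \<in> ?q b" "y \<in> T" using y by (auto simp: F_def)
        have "x \<in> ?q (a + b - n) \<cdot> ?q (n - b)"
          using x False True ideal_pow_add[OF q, of "a + b - n" "n - b"] by simp
        then have "x \<otimes> y \<in> ?q (a + b - n) \<cdot> (?q n \<inter> T)"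
        proof induction
          case (prod i j)
          then have ijc: "i \<in> carrier R" "j \<in> carrier R" "y \<in> carrier R"
            using ideal_closed(7)[OF ideal_pow_ideal[OF q]] y' by auto
          have "j \<otimes> y \<in> ?q (n - b + b)" using q U.ideal_pow_mem_add prod y' by blast
          then have "j \<otimes> y \<in> ?q n \<inter> T" using True ideal_closed(5)[OF T y'(2) ijc(2)] by simp
          then have "i \<otimes> (j \<otimes> y) \<in> ?q (a + b - n) \<cdot> (?q n \<inter> T)" using prod by (simp add: ideal_prod.prod)
          then show ?case using ijc by (simp add: m_assoc)
        next
          case (sum s t)
          have "ideal (?q (a + b - n) \<cdot> ?q (n - b)) R" using q by (simp add: ideal_prod_is_ideal)
          then have "s \<in> carrier R" "t \<in> carrier R" "y \<in> carrier R"
            using sum ideal_closed(7) ideal_closed(7)[OF T y'(2)] by auto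
          then show ?case using sum by (simp add: l_distr ideal_prod.sum)
        qed
        then show ?thesis using False by (simp add: F_def)
      next
        case bn: False
        then have "y \<in> ?q (b - n) \<cdot> (?q n \<inter> T)" using y by (simp add: F_def)
        from ideal_prod_act[OF q qT x this] show ?thesis using bn False by (simp add: F_def)
      qed
    qed
  qed
  have id: "ideal (graded R (F n)) (rees R q)" for n
    by (rule U.graded_ideal[OF q F_id]) (use F_sub act in auto)
  have up: "F n a \<subseteq> F (Suc n) a" for n a
  proof (cases "a \<le> n")
    case True then show ?thesis by (simp add: F_def)
  next
    case False
    show ?thesis
    proof (cases "a = Suc n")
      case True then show ?thesis using F_sub[of n a] by (simp add: F_def)
    next
      case a: False
      have "?q (a - n) \<cdot> (?q n \<inter> T) = ?q (a - Suc n) \<cdot> (?q 1 \<cdot> (?q n \<inter> T))"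
        using ideal_prod_assoc[of "?q (a - Suc n)" "?q 1" "?q n \<inter> T"]
          ideal_pow_add[OF q, of "a - Suc n" 1] q qT a False by (simp add: Suc_diff_Suc)
      moreover have "?q 1 \<cdot> (?q n \<inter> T) \<subseteq> ?q (Suc n) \<inter> T"
      proof (rule ideal_prod_least[OF qT])
        fix i j assume ij: "i \<in> ?q 1" "j \<in> ?q n \<inter> T"
        then have "i \<otimes> j \<in> ?q (1 + n)" using q U.ideal_pow_mem_add by blast
        then show "i \<otimes> j \<in> ?q (Suc n) \<inter> T"
          using ij ideal_closed(5)[OF T] ideal_closed(7)[OF ideal_pow_ideal[OF q]] by auto
      qed
      ultimately show ?thesis using a False by (simp add: F_def ideal_prod_mono)
    qed
  qed
  interpret N: noetherian_ring "rees R q" using U.noetherian_rees[OF noeth q] .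
  have "graded R (F n) \<subseteq> graded R (F (Suc n))" for n by (rule graded_mono[OF up])
  then obtain c where c: "\<And>n. n \<ge> c \<Longrightarrow> graded R (F n) = graded R (F c)"
    using N.ascending_chain_stationary[of "\<lambda>n. graded R (F n)"] id by blast
  show ?thesis
  proof (rule that[of c])
    fix a assume a: "c \<le> a"
    show "?q a \<inter> T \<subseteq> ?q (a - c) \<cdot> T"
    proof
      fix x assume x: "x \<in> ?q a \<inter> T"
      then have xc: "x \<in> carrier R" using ideal_closed(7)[OF T] by blast
      have "x \<in> F a a" using x by (simp add: F_def)
      then have "x \<in> F c a"
        using U.graded_monom[of "F a" x a, OF F_id xc] U.graded_monom[of "F c" x a, OF F_id xc] c[OF a]
        by simp
      moreover have "F c a \<subseteq> ?q (a - c) \<cdot> T"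
      proof (cases "a = c")
        case True
        have "carrier R \<cdot> T = T" using ideal_prod_one[OF T] ideal_prod_commute[OF oneideal T] by simp
        then show ?thesis using True by (simp add: F_def ideal_pow_simps)
      next
        case False
        then have "F c a = ?q (a - c) \<cdot> (?q c \<inter> T)" using a by (simp add: F_def)
        then show ?thesis using ideal_prod_mono[OF subset_refl Int_lower2] by metis
      qed
      ultimately show "x \<in> ?q (a - c) \<cdot> T" by blast
    qed
  qed
qed

end

section \<open>Linear growth of saturations\<close>

context cring begin

lemma ideal_prod_one_left: "ideal I R \<Longrightarrow> carrier R \<cdot> I = I"
  using ideal_prod_one[of I] ideal_prod_commute[OF oneideal, of I] by simp

lemma ideal_prod_interchange:
  assumes "ideal A R" "ideal B R" "ideal C R" "ideal D R"
    and "x \<in> A \<cdot> B" "y \<in> C \<cdot> D"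
  shows "x \<otimes> y \<in> (A \<cdot> C) \<cdot> (B \<cdot> D)"
proof -
  interpret M: comm_monoid "ideals_set R" by (rule ideals_set_is_comm_monoid)
  have "(A \<cdot> B) \<cdot> (C \<cdot> D) = (A \<cdot> C) \<cdot> (B \<cdot> D)"
    using M.m_ac[of A B] M.m_ac[of A C] M.m_ac[of B C] M.m_lcomm[of B C D] assms(1-4) ideal_prod_is_ideal
    by (simp add: ideals_set_def)
  moreover have "x \<otimes> y \<in> (A \<cdot> B) \<cdot> (C \<cdot> D)" using assms(5,6) by (rule ideal_prod.prod)
  ultimately show ?thesis by simp
qed

text \<open>  The colon ideals \<open>(Z : q ^ l)\<close> stabilise at some \<open>T = (Z : q ^ e)\<close>, so \<open>q ^ e T \<subseteq> Z\<close>. With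
  \<open>q ^ a \<inter> T \<subseteq> q ^ (a - c) T\<close> from Artin--Rees, the constant \<open>c + e\<close> works.\<close>
lemma torsion_artin_rees:
  assumes noeth: "noetherian_ring R" and q: "ideal q R" and Z: "ideal Z R"
  obtains c where "\<And>a l x. a \<ge> c \<Longrightarrow> x \<in> ideal_pow R q a \<Longrightarrow> \<forall>y\<in>ideal_pow R q l. x \<otimes> y \<in> Z
    \<Longrightarrow> x \<in> ideal_pow R q (a - c) \<cdot> Z"
proof -
  interpret N: noetherian_ring R by fact
  let ?q = "ideal_pow R q" and ?K = "\<lambda>l. ideal_colon R Z (ideal_pow R q l)"
  have qid: "ideal (?q l) R" for l using q by simp
  have K: "ideal (?K l) R" for l
    by (rule ideal_colon_ideal[OF Z ideal_subset_carrier[OF qid]])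
  have "?K l \<subseteq> ?K (Suc l)" for l
    using ideal_pow_antimono[OF q, of l "Suc l"] by (auto simp: ideal_colon_def)
  then obtain e where e: "\<And>l. l \<ge> e \<Longrightarrow> ?K l = ?K e"
    using N.ascending_chain_stationary[of ?K] K by blast
  have up: "?K l \<subseteq> ?K e" for l
  proof (cases "l \<ge> e")
    case False
    then show ?thesis using ideal_pow_antimono[OF q, of l e] by (auto simp: ideal_colon_def)
  next
    case True
    show ?thesis by (rule equalityD1[OF e[OF True]])
  qed
  have eZ: "?q e \<cdot> ?K e \<subseteq> Z"
  proof (rule ideal_prod_least[OF Z])
    fix i j assume ij: "i \<in> ?q e" "j \<in> ?K e"
    have "i \<in> carrier R" by (rule ideal_closed(7)[OF qid ij(1)])
    moreover have "j \<in> carrier R" "j \<otimes> i \<in> Z" using ij by (simp_all add: ideal_colon_def)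
    ultimately show "i \<otimes> j \<in> Z" using m_comm[of i j] by simp
  qed
  obtain c where c: "\<And>a. a \<ge> c \<Longrightarrow> ?q a \<inter> ?K e \<subseteq> ?q (a - c) \<cdot> ?K e"
    using artin_rees[OF noeth q K, of e] by blast
  show ?thesis
  proof (rule that[of "c + e"])
    fix a l x assume a: "c + e \<le> a" and x: "x \<in> ?q a" "\<forall>y\<in>?q l. x \<otimes> y \<in> Z"
    have "x \<in> ?K l" using x ideal_closed(7)[OF qid] by (auto simp: ideal_colon_def)
    then have "x \<in> ?q (a - c) \<cdot> ?K e" using x(1) c[of a] up[of l] a by auto
    also have "?q (a - c) = ?q (a - (c + e)) \<cdot> ?q e"
      using ideal_pow_add[OF q, of "a - (c + e)" e] a by simp
    also have "(?q (a - (c + e)) \<cdot> ?q e) \<cdot> ?K e = ?q (a - (c + e)) \<cdot> (?q e \<cdot> ?K e)"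
      by (rule ideal_prod_assoc[OF qid qid K])
    also have "\<dots> \<subseteq> ?q (a - (c + e)) \<cdot> Z" by (rule ideal_prod_mono[OF subset_refl eZ])
    finally show "x \<in> ?q (a - (c + e)) \<cdot> Z" .
  qed
qed

text \<open>  This is the degree \<open>i\<close> part of the preceding lemma for the Rees ring of \<open>I\<close>, with the
  extension of \<open>\<mm>\<close> in the role of \<open>q\<close> and the ideal with components \<open>I ^ (i + 1)\<close> in the role of
  \<open>Z\<close>. Working in the Rees ring is what makes \<open>c\<close> independent of \<open>i\<close>.\<close>
lemma graded_torsion_step:
  assumes noeth: "noetherian_ring R" and \<mm>: "ideal \<mm> R" and I: "ideal I R"
  obtains c where "\<And>a i l x. a \<ge> c \<Longrightarrow> x \<in> ideal_pow R \<mm> a \<cdot> ideal_pow R I i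
    \<Longrightarrow> \<forall>y\<in>ideal_pow R \<mm> l. x \<otimes> y \<in> ideal_pow R I (Suc i)
    \<Longrightarrow> x \<in> ideal_pow R \<mm> (a - c) \<cdot> ideal_pow R I (Suc i)"
proof -
  interpret U: UP_cring R "UP R" by unfold_locales (rule reflexive)
  let ?S = "rees R I" and ?m = "ideal_pow R \<mm>" and ?I = "ideal_pow R I"
  let ?mon = "\<lambda>x i. up_ring.monom (UP R) x i"
  interpret S: cring ?S by (rule U.rees_cring[OF I])
  have NS: "noetherian_ring ?S" by (rule U.noetherian_rees[OF noeth I])
  have mid: "ideal (?m a) R" and Iid: "ideal (?I a) R" for a using \<mm> I by auto
  have mI: "ideal (?m a \<cdot> ?I i) R" for a i by (rule ideal_prod_is_ideal[OF mid Iid])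
  define Q where "Q = graded R (\<lambda>i. ?m 1 \<cdot> ?I i)"
  define Z where "Z = graded R (\<lambda>i. ?I (Suc i))"
  \<comment> \<open>one family covers both: \<open>k = 0\<close> gives the powers of \<open>Q\<close>, and \<open>k = 1\<close> their products with \<open>Z\<close>\<close>
  have G: "ideal (graded R (\<lambda>i. ?m a \<cdot> ?I (i + k))) ?S" for a k
  proof (rule U.graded_ideal[OF I mI])
    show "?m a \<cdot> ?I (n + k) \<subseteq> ?I n" for n
      using ideal_prod_inter[OF mid Iid] ideal_pow_antimono[OF I, of n "n + k"] by fastforce
    fix u v x y assume x: "x \<in> ?I u" and y: "y \<in> ?m a \<cdot> ?I (v + k)"
    have "x \<in> carrier R \<cdot> ?I u" using x ideal_prod_one_left[OF Iid] by simp
    from ideal_prod_interchange[OF oneideal Iid mid Iid this y]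
    show "x \<otimes> y \<in> ?m a \<cdot> ?I (u + v + k)"
      using ideal_prod_one_left[OF mid] ideal_pow_add[OF I, of u "v + k"] by (simp add: add.assoc)
  qed
  have Qid: "ideal Q ?S" using G[of 1 0] by (simp add: Q_def)
  have Zid: "ideal Z ?S" using G[of 0 1] by (simp add: Z_def ideal_pow_simps(1) ideal_prod_one_left[OF Iid])
  let ?V = "\<lambda>i K. {x \<in> carrier R. ?mon x i \<in> K}"
  have pre: "ideal (?V i K) R" if K: "ideal K ?S" for K i
  proof (rule idealI_comm)
    note Kc = S.ideal_closed[OF K, unfolded U.rees_simps]
    show "\<zero> \<in> ?V i K" using Kc(1) by simp
    show "x \<oplus> y \<in> ?V i K"
      if "x \<in> ?V i K" "y \<in> ?V i K" for x y
      using that Kc(2) by simp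
    show "r \<otimes> x \<in> ?V i K"
      if "x \<in> ?V i K" "r \<in> carrier R" for x r
    proof -
      have "?mon r 0 \<in> graded R ?I"
        using that U.graded_monom[of ?I r 0] Iid by (simp add: ideal_pow_simps)
      then show ?thesis using that Kc(5)[of "?mon x i" "?mon r 0"] U.monom_mult[of r x 0 i] by simp
    qed
  qed auto
  have up: "?m a \<cdot> ?I i \<subseteq> ?V i (ideal_pow ?S Q a)" for a i
  proof (induction a)
    case 0
    have "?I i \<subseteq> carrier R" using ideal_subset_carrier[OF Iid] .
    then show ?case
      using U.graded_monom[of ?I _ i] Iid
      by (auto simp: S.ideal_pow_simps U.rees_simps ideal_pow_simps(1) ideal_prod_one_left[OF Iid])
  next
    case (Suc a)
    have "?m (Suc a) \<cdot> ?I i = (?m a \<cdot> ?I i) \<cdot> \<mm>"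
      using ideal_prod_assoc[OF mid Iid \<mm>, of a i] ideal_prod_assoc[OF mid \<mm> Iid, of a i]
        ideal_prod_commute[OF \<mm> Iid, of i] by (simp add: ideal_pow_simps)
    also have "\<dots> \<subseteq> ?V i (ideal_pow ?S Q (Suc a))"
    proof (rule ideal_prod_least[OF pre])
      show "ideal (ideal_pow ?S Q (Suc a)) ?S" by (rule S.ideal_pow_ideal[OF Qid])
      fix x y assume x: "x \<in> ?m a \<cdot> ?I i" and y: "y \<in> \<mm>"
      have yc: "y \<in> carrier R" using y ideal_closed(7)[OF \<mm>] by auto
      have "y \<in> ?m 1 \<cdot> ?I 0"
        using y ideal_prod_one[OF \<mm>] ideal_pow_1[OF \<mm>] by (simp add: ideal_pow_simps(1))
      then have "?mon y 0 \<in> Q"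
        using U.graded_monom[of "\<lambda>i. ?m 1 \<cdot> ?I i" y 0, OF mI yc] by (simp add: Q_def)
      moreover have xc: "x \<in> carrier R" and "?mon x i \<in> ideal_pow ?S Q a" using Suc x by auto
      ultimately have "?mon x i \<otimes>\<^bsub>?S\<^esub> ?mon y 0 \<in> ideal_pow ?S Q (Suc a)"
        unfolding S.ideal_pow_simps by (intro ideal_prod.prod)
      moreover have "?mon (x \<otimes> y) i = ?mon x i \<otimes>\<^bsub>?S\<^esub> ?mon y 0"
        using xc yc U.monom_mult[of x y i 0] by (simp add: U.rees_simps)
      ultimately have "x \<otimes> y \<in> carrier R" "?mon (x \<otimes> y) i \<in> ideal_pow ?S Q (Suc a)"
        using xc yc by simp_all
      then show "x \<otimes> y \<in> ?V i (ideal_pow ?S Q (Suc a))" by simp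
    qed
    finally show ?case .
  qed
  have mult: "x \<otimes>\<^bsub>?S\<^esub> y \<in> graded R (\<lambda>i. ?m (a + b) \<cdot> ?I (i + (k + j)))"
    if "x \<in> graded R (\<lambda>i. ?m a \<cdot> ?I (i + k))" "y \<in> graded R (\<lambda>i. ?m b \<cdot> ?I (i + j))" for x y a b k j
    unfolding U.rees_simps
  proof (rule U.graded_mult[OF mI that])
    fix u v x y assume "x \<in> ?m a \<cdot> ?I (u + k)" "y \<in> ?m b \<cdot> ?I (v + j)"
    from ideal_prod_interchange[OF mid Iid mid Iid this]
    show "x \<otimes> y \<in> ?m (a + b) \<cdot> ?I (u + v + (k + j))"
      using ideal_pow_add[OF I, of "u + k" "v + j"] ideal_pow_add[OF \<mm>, of a b] by (simp add: ac_simps)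
  qed
  have down: "ideal_pow ?S Q a \<subseteq> graded R (\<lambda>i. ?m a \<cdot> ?I (i + 0))" for a
  proof (induction a)
    case 0
    then show ?case
      by (simp add: S.ideal_pow_simps U.rees_simps ideal_pow_simps(1) ideal_prod_one_left[OF Iid])
  next
    case (Suc a)
    show ?case unfolding S.ideal_pow_simps
    proof (rule S.ideal_prod_least[OF G])
      fix x y assume "x \<in> ideal_pow ?S Q a" "y \<in> Q"
      then show "x \<otimes>\<^bsub>?S\<^esub> y \<in> graded R (\<lambda>i. ?m (Suc a) \<cdot> ?I (i + 0))"
        using mult[of x a 0 y 1 0] Suc by (auto simp: Q_def)
    qed
  qed
  have downZ: "ideal_prod ?S (ideal_pow ?S Q a) Z \<subseteq> graded R (\<lambda>i. ?m a \<cdot> ?I (i + 1))" for a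
  proof (rule S.ideal_prod_least[OF G])
    fix x y assume "x \<in> ideal_pow ?S Q a" "y \<in> Z"
    then show "x \<otimes>\<^bsub>?S\<^esub> y \<in> graded R (\<lambda>i. ?m a \<cdot> ?I (i + 1))"
      using mult[of x a 0 y 0 1] down
      by (auto simp: Z_def ideal_pow_simps(1) ideal_prod_one_left[OF Iid])
  qed
  obtain c where c: "\<And>a l x. a \<ge> c \<Longrightarrow> x \<in> ideal_pow ?S Q a
    \<Longrightarrow> \<forall>y\<in>ideal_pow ?S Q l. x \<otimes>\<^bsub>?S\<^esub> y \<in> Z \<Longrightarrow> x \<in> ideal_prod ?S (ideal_pow ?S Q (a - c)) Z"
    using S.torsion_artin_rees[OF NS Qid Zid] by blast
  show ?thesis
  proof (rule that[of c])
    fix a i l x assume a: "c \<le> a" and x: "x \<in> ?m a \<cdot> ?I i" "\<forall>y\<in>?m l. x \<otimes> y \<in> ?I (Suc i)"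
    have xc: "x \<in> carrier R" using ideal_closed(7)[OF mI x(1)] .
    let ?F = "\<lambda>k. ideal_colon R (?I (Suc k)) (?m l)"
    have F: "ideal (?F k) R" for k by (rule ideal_colon_ideal[OF Iid ideal_subset_carrier[OF mid]])
    have "?mon x i \<otimes>\<^bsub>?S\<^esub> y \<in> Z" if y: "y \<in> ideal_pow ?S Q l" for y
      unfolding Z_def U.rees_simps
    proof (rule U.graded_mult[OF Iid])
      show "?mon x i \<in> graded R ?F"
        using U.graded_monom[of ?F x i, OF F xc] x(2) xc by (simp add: ideal_colon_def)
      show "y \<in> graded R (\<lambda>j. ?m l \<cdot> ?I j)" using y down[of l] by auto
      fix k j s z assume s: "s \<in> ?F k" and z: "z \<in> ?m l \<cdot> ?I j"
      have "?m l \<cdot> ?I j \<subseteq> ideal_colon R (?I (Suc (k + j))) {s}"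
      proof (rule ideal_prod_least[OF ideal_colon_ideal[OF Iid]])
        fix u v assume uv: "u \<in> ?m l" "v \<in> ?I j"
        then have cs: "u \<in> carrier R" "v \<in> carrier R" "s \<in> carrier R"
          using ideal_closed(7)[OF mid] ideal_closed(7)[OF Iid] s by (auto simp: ideal_colon_def)
        have "(s \<otimes> u) \<otimes> v \<in> ?I (Suc k + j)"
          using s uv by (intro U.ideal_pow_mem_add[OF I]) (auto simp: ideal_colon_def)
        then show "u \<otimes> v \<in> ideal_colon R (?I (Suc (k + j))) {s}"
          using cs m_comm[of s "u \<otimes> v"] by (simp add: ideal_colon_def m_assoc)
      qed (use s in \<open>auto simp: ideal_colon_def\<close>)
      then show "s \<otimes> z \<in> ?I (Suc (k + j))"
        using z s m_comm[of s z] by (auto simp: ideal_colon_def)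
    qed
    then have "?mon x i \<in> ideal_prod ?S (ideal_pow ?S Q (a - c)) Z"
      using c[OF a, of "?mon x i" l] up[of a i] x(1) by blast
    then have "?mon x i \<in> graded R (\<lambda>i. ?m (a - c) \<cdot> ?I (i + 1))" using downZ by blast
    then show "x \<in> ?m (a - c) \<cdot> ?I (Suc i)"
      using U.graded_monom[of "\<lambda>i. ?m (a - c) \<cdot> ?I (i + 1)" x i, OF mI xc] by simp
  qed
qed

text \<open>  An element of \<open>\<mm> ^ (c n)\<close> that a power of \<open>\<mm>\<close> carries into \<open>I ^ n\<close> is carried into every lower
  power of \<open>I\<close> as well. So the preceding lemma can be applied for \<open>i = 0, \<dots>, n - 1\<close>; each step spends
  \<open>c\<close> of the \<open>c n\<close> powers of \<open>\<mm>\<close>.\<close>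
theorem saturation_linear_growth:
  assumes noeth: "noetherian_ring R" and \<mm>: "ideal \<mm> R" and I: "ideal I R"
  obtains c where "\<And>n l x. x \<in> ideal_pow R \<mm> (c * n)
    \<Longrightarrow> \<forall>y\<in>ideal_pow R \<mm> l. x \<otimes> y \<in> ideal_pow R I n \<Longrightarrow> x \<in> ideal_pow R I n"
proof -
  let ?m = "ideal_pow R \<mm>" and ?I = "ideal_pow R I"
  obtain c where c: "\<And>a i l x. a \<ge> c \<Longrightarrow> x \<in> ?m a \<cdot> ?I i \<Longrightarrow> \<forall>y\<in>?m l. x \<otimes> y \<in> ?I (Suc i)
    \<Longrightarrow> x \<in> ?m (a - c) \<cdot> ?I (Suc i)"
    using graded_torsion_step[OF assms] by blast
  show ?thesis
  proof (rule that[of c])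
    fix n l x assume x: "x \<in> ?m (c * n)" "\<forall>y\<in>?m l. x \<otimes> y \<in> ?I n"
    have "x \<in> ?m (c * (n - i)) \<cdot> ?I i" if "i \<le> n" for i
      using that
    proof (induction i)
      case 0
      then show ?case using x(1) ideal_prod_one \<mm> by (simp add: ideal_pow_simps(1))
    next
      case (Suc i)
      then have IH: "x \<in> ?m (c * (n - i)) \<cdot> ?I i" by simp
      have "?I n \<subseteq> ?I (Suc i)" using ideal_pow_antimono[OF I Suc.prems] .
      then have "\<forall>y\<in>?m l. x \<otimes> y \<in> ?I (Suc i)" using x(2) by blast
      moreover have "n - i = Suc (n - Suc i)" using Suc.prems by simp
      then have "c * (n - i) \<ge> c" "c * (n - i) - c = c * (n - Suc i)" by simp_all
      ultimately show ?case using c[OF _ IH] by metis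
    qed
    from this[of n] show "x \<in> ?I n"
      using ideal_prod_one_left[OF ideal_pow_ideal[OF I]] by (simp add: ideal_pow_simps(1))
  qed
qed

end

section \<open>Lengths of intervals of ideals\<close>

definition has_chain :: "('a, 'b) ring_scheme \<Rightarrow> 'a set \<Rightarrow> 'a set \<Rightarrow> nat \<Rightarrow> bool" where
  "has_chain R K L n \<longleftrightarrow> (\<exists>H. (\<forall>i\<le>n. ideal (H i) R \<and> K \<subseteq> H i \<and> H i \<subseteq> L) \<and> (\<forall>i<n. H i \<subset> H (Suc i)))"

text \<open>The length of \<open>L/K\<close> for ideals \<open>K \<subseteq> L\<close>, measured inside \<open>R\<close>.\<close>
definition ilen :: "('a, 'b) ring_scheme \<Rightarrow> 'a set \<Rightarrow> 'a set \<Rightarrow> enat" where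
  "ilen R K L = Sup {enat n | n. has_chain R K L n}"

lemma enat_le_ext: "(\<And>n. enat n \<le> x \<Longrightarrow> enat n \<le> y) \<Longrightarrow> x \<le> (y :: enat)"
proof (cases y)
  case (enat k)
  assume *: "\<And>n. enat n \<le> x \<Longrightarrow> enat n \<le> y"
  show ?thesis
  proof (cases x)
    case infinity
    then show ?thesis using *[of "Suc k"] enat by simp
  qed (use * in auto)
qed simp

lemma has_chain_le: "has_chain R K L n \<Longrightarrow> m \<le> n \<Longrightarrow> has_chain R K L m"
  unfolding has_chain_def by (meson le_trans less_le_trans)

lemma has_chain_mono:
  "has_chain R K L n \<Longrightarrow> K' \<subseteq> K \<Longrightarrow> L \<subseteq> L' \<Longrightarrow> has_chain R K' L' n"
  unfolding has_chain_def by (meson subset_trans)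

lemma has_chain_0: "ideal K R \<Longrightarrow> K \<subseteq> L \<Longrightarrow> has_chain R K L 0"
  unfolding has_chain_def by (intro exI[of _ "\<lambda>_. K"]) simp

lemma has_chain_prepend:
  assumes "has_chain R K' L n" "ideal K R" "K \<subset> K'" "K' \<subseteq> L"
  shows "has_chain R K L (Suc n)"
proof -
  obtain H where H: "\<forall>i\<le>n. ideal (H i) R \<and> K' \<subseteq> H i \<and> H i \<subseteq> L" "\<forall>i<n. H i \<subset> H (Suc i)"
    using assms(1) unfolding has_chain_def by blast
  define G where "G i = (case i of 0 \<Rightarrow> K | Suc j \<Rightarrow> H j)" for i
  have "\<forall>i\<le>Suc n. ideal (G i) R \<and> K \<subseteq> G i \<and> G i \<subseteq> L"
    using H(1) assms(2-4) by (auto simp: G_def split: nat.split) blast+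
  moreover have "\<forall>i<Suc n. G i \<subset> G (Suc i)"
    using H assms(3) by (auto simp: G_def split: nat.split) blast+
  ultimately show ?thesis unfolding has_chain_def by blast
qed

lemma has_chain_append:
  assumes "has_chain R K M a" "has_chain R M L b" "K \<subseteq> M" "M \<subseteq> L"
  shows "has_chain R K L (a + b)"
proof -
  obtain H where H: "\<forall>i\<le>a. ideal (H i) R \<and> K \<subseteq> H i \<and> H i \<subseteq> M" "\<forall>i<a. H i \<subset> H (Suc i)"
    using assms(1) unfolding has_chain_def by blast
  obtain G where G: "\<forall>i\<le>b. ideal (G i) R \<and> M \<subseteq> G i \<and> G i \<subseteq> L" "\<forall>i<b. G i \<subset> G (Suc i)"
    using assms(2) unfolding has_chain_def by blast
  define F where "F i = (if i \<le> a then H i else G (i - a))" for i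
  have "ideal (F i) R \<and> K \<subseteq> F i \<and> F i \<subseteq> L" if "i \<le> a + b" for i
  proof (cases "i \<le> a")
    case True then show ?thesis using H(1) assms(4) by (auto simp: F_def)
  next
    case False
    then have "i - a \<le> b" using that by simp
    then have "ideal (G (i - a)) R \<and> M \<subseteq> G (i - a) \<and> G (i - a) \<subseteq> L" using G(1) by blast
    then show ?thesis using False assms(3) by (auto simp: F_def)
  qed
  moreover have "F i \<subset> F (Suc i)" if "i < a + b" for i
  proof -
    consider "i < a" | "i = a" | "i > a" by linarith
    then show ?thesis
    proof cases
      case 1 then show ?thesis using H(2) by (simp add: F_def)
    next
      case 2
      then have b: "0 < b" using that by simp
      have "H a \<subseteq> M" using H(1) by blast
      also have "M \<subseteq> G 0" using G(1) by blast
      also have "G 0 \<subset> G (Suc 0)" using G(2) b by blast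
      finally show ?thesis using 2 by (simp add: F_def)
    next
      case 3
      then have "i - a < b" using that by simp
      then have "G (i - a) \<subset> G (Suc (i - a))" using G(2) by blast
      then show ?thesis using 3 by (simp add: F_def Suc_diff_le)
    qed
  qed
  ultimately show ?thesis unfolding has_chain_def by blast
qed

lemma enat_le_ilen_iff:
  assumes "ideal K R" "K \<subseteq> L"
  shows "enat n \<le> ilen R K L \<longleftrightarrow> has_chain R K L n"
proof
  assume "has_chain R K L n"
  then show "enat n \<le> ilen R K L" unfolding ilen_def by (blast intro: Sup_upper)
next
  assume *: "enat n \<le> ilen R K L"
  show "has_chain R K L n"
  proof (cases n)
    case 0 then show ?thesis using has_chain_0[OF assms] by simp
  next
    case (Suc m)
    then have "enat m < ilen R K L" using * by (metis enat_ord_simps(2) lessI less_le_trans)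
    then obtain k where "enat m < enat k" "has_chain R K L k" unfolding ilen_def less_Sup_iff by blast
    then show ?thesis using has_chain_le[of R K L k n] Suc by simp
  qed
qed

lemma ilen_mono:
  "K \<subseteq> K' \<Longrightarrow> L' \<subseteq> L \<Longrightarrow> ilen R K' L' \<le> ilen R K L"
  unfolding ilen_def by (rule Sup_subset_mono) (auto intro: has_chain_mono)

lemma ilen_trivial: "L \<subseteq> K \<Longrightarrow> ilen R K L = 0"
proof -
  assume sub: "L \<subseteq> K"
  have "\<not> has_chain R K L (Suc n)" for n
  proof
    assume "has_chain R K L (Suc n)"
    then obtain H where H: "\<forall>i\<le>Suc n. ideal (H i) R \<and> K \<subseteq> H i \<and> H i \<subseteq> L"
      "\<forall>i<Suc n. H i \<subset> H (Suc i)" unfolding has_chain_def by blast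
    have "K \<subseteq> H 0" "H (Suc 0) \<subseteq> L" "H 0 \<subset> H (Suc 0)"
      using H(1)[rule_format, of 0] H(1)[rule_format, of "Suc 0"] H(2)[rule_format, of 0] by auto
    then show False using sub by blast
  qed
  then have "n = 0" if "has_chain R K L n" for n using that by (cases n) auto
  then have "ilen R K L \<le> 0"
    unfolding ilen_def by (intro Sup_least) (auto simp: zero_enat_def)
  then show ?thesis by simp
qed

lemma ilen_le_map:
  assumes "\<And>H. ideal H R \<Longrightarrow> K \<subseteq> H \<Longrightarrow> H \<subseteq> L \<Longrightarrow> ideal (f H) S \<and> K' \<subseteq> f H \<and> f H \<subseteq> L'"
    and mono: "\<And>H H'. ideal H R \<Longrightarrow> ideal H' R \<Longrightarrow> K \<subseteq> H \<Longrightarrow> H' \<subseteq> L \<Longrightarrow> H \<subseteq> H' \<Longrightarrow> f H \<subseteq> f H'"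
    and inj: "\<And>H H'. ideal H R \<Longrightarrow> ideal H' R \<Longrightarrow> K \<subseteq> H \<Longrightarrow> H' \<subseteq> L \<Longrightarrow> H \<subseteq> H' \<Longrightarrow> f H = f H' \<Longrightarrow> H' \<subseteq> H"
  shows "ilen R K L \<le> ilen S K' L'"
  unfolding ilen_def
proof (rule Sup_subset_mono, safe)
  fix n assume "has_chain R K L n"
  then obtain H where H: "\<And>i. i \<le> n \<Longrightarrow> ideal (H i) R \<and> K \<subseteq> H i \<and> H i \<subseteq> L" "\<And>i. i < n \<Longrightarrow> H i \<subset> H (Suc i)"
    unfolding has_chain_def by blast
  have 1: "\<forall>i\<le>n. ideal (f (H i)) S \<and> K' \<subseteq> f (H i) \<and> f (H i) \<subseteq> L'" using H(1) assms(1) by simp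
  have 2: "f (H i) \<subset> f (H (Suc i))" if i: "i < n" for i
  proof
    note Hi = H(1)[of i] H(1)[of "Suc i"] H(2)[OF i]
    show "f (H i) \<subseteq> f (H (Suc i))" by (rule mono) (use Hi i in auto)
    show "f (H i) \<noteq> f (H (Suc i))"
    proof
      assume "f (H i) = f (H (Suc i))"
      then have "H (Suc i) \<subseteq> H i" by (rule inj[rotated -1]) (use Hi i in auto)
      then show False using Hi(3) by blast
    qed
  qed
  have "has_chain S K' L' n" unfolding has_chain_def using 1 2 by (intro exI[of _ "\<lambda>i. f (H i)"]) blast
  then show "\<exists>m. enat n = enat m \<and> has_chain S K' L' m" by blast
qed

lemma one_le_ilen:
  assumes "ideal K R" "ideal L R" "K \<subset> L"
  shows "1 \<le> ilen R K L"
proof -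
  have "has_chain R K L (Suc 0)"
    by (rule has_chain_prepend[OF has_chain_0[OF assms(2) subset_refl] assms(1,3) subset_refl])
  then have "enat (Suc 0) \<le> ilen R K L" using enat_le_ilen_iff[of K R L] assms by blast
  then show ?thesis by (simp add: one_enat_def)
qed

context ring begin

text \<open>  Intersect a chain with \<open>M\<close> and add \<open>M\<close> to it. By the modular law, a strict step of the chain
  stays strict in at least one of the two new chains.\<close>
lemma has_chain_split:
  assumes M: "ideal M R" "M \<subseteq> L" and L: "ideal L R"
    and "\<forall>i\<le>n. ideal (H i) R \<and> H i \<subseteq> L" "\<forall>i<n. H i \<subset> H (Suc i)"
  shows "\<exists>a b. n \<le> a + b \<and> has_chain R (H 0 \<inter> M) M a \<and> has_chain R (H 0 <+> M) L b"
  using assms(4,5)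
proof (induction n arbitrary: H)
  case 0
  then have H: "ideal (H 0) R" "H 0 \<subseteq> L" by auto
  have "has_chain R (H 0 \<inter> M) M 0" by (rule has_chain_0[OF i_intersect[OF H(1) M(1)]]) simp
  moreover have "has_chain R (H 0 <+> M) L 0"
    by (rule has_chain_0[OF add_ideals[OF H(1) M(1)] ideal_sum_least[OF L H(2) M(2)]])
  ultimately show ?case by blast
next
  case (Suc n)
  obtain a b where ab: "n \<le> a + b" "has_chain R (H (Suc 0) \<inter> M) M a" "has_chain R (H (Suc 0) <+> M) L b"
    using Suc.IH[of "\<lambda>i. H (Suc i)"] Suc.prems by auto
  have H: "ideal (H 0) R" "ideal (H 1) R" "H 0 \<subset> H 1" "H 1 \<subseteq> L" "H 0 \<subseteq> L"
    using Suc.prems(1)[rule_format, of 0] Suc.prems(1)[rule_format, of 1] Suc.prems(2)[rule_format, of 0] by auto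
  have le: "H 0 \<inter> M \<subseteq> H 1 \<inter> M" "H 0 <+> M \<subseteq> H 1 <+> M" using H(3) ideal_sum_mono by auto
  show ?case
  proof (cases "H 0 \<inter> M = H 1 \<inter> M")
    case False
    have "has_chain R (H 0 \<inter> M) M (Suc a)"
      by (rule has_chain_prepend[OF ab(2) i_intersect[OF H(1) M(1)]]) (use False le in auto)
    moreover have "has_chain R (H 0 <+> M) L b"
      using has_chain_mono[OF ab(3) _ subset_refl] le(2) by simp
    ultimately show ?thesis using ab(1) by (intro exI[of _ "Suc a"] exI[of _ b]) simp
  next
    case True
    have "H 0 <+> M \<noteq> H 1 <+> M"
    proof
      assume eq: "H 0 <+> M = H 1 <+> M"
      have "H 1 = (H 0 <+> M) \<inter> H 1" unfolding eq using ideal_sum_upper(1)[OF H(2) M(1)] by blast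
      also have "\<dots> = H 0 <+> (M \<inter> H 1)" using ideal_modular[OF H(1) M(1) H(2)] H(3) by blast
      also have "\<dots> = H 0"
        by (rule ideal_sum_absorb[OF H(1) i_intersect[OF M(1) H(2)]]) (use True in auto)
      finally show False using H(3) by blast
    qed
    then have "has_chain R (H 0 <+> M) L (Suc b)"
      using has_chain_prepend[OF ab(3) add_ideals[OF H(1) M(1)]] le(2) ideal_sum_least[OF L H(4) M(2)] by auto
    moreover have "has_chain R (H 0 \<inter> M) M a"
      using has_chain_mono[OF ab(2) _ subset_refl] le(1) by simp
    ultimately show ?thesis using ab(1) by (intro exI[of _ a] exI[of _ "Suc b"]) simp
  qed
qed

theorem ilen_additive:
  assumes K: "ideal K R" and M: "ideal M R" and L: "ideal L R" and sub: "K \<subseteq> M" "M \<subseteq> L"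
  shows "ilen R K L = ilen R K M + ilen R M L"
proof (rule antisym)
  show "ilen R K L \<le> ilen R K M + ilen R M L"
  proof (rule enat_le_ext)
    fix n assume "enat n \<le> ilen R K L"
    then have "has_chain R K L n" using enat_le_ilen_iff[OF K] sub by blast
    then obtain H where H: "\<forall>i\<le>n. ideal (H i) R \<and> K \<subseteq> H i \<and> H i \<subseteq> L" "\<forall>i<n. H i \<subset> H (Suc i)"
      unfolding has_chain_def by blast
    then obtain a b where ab: "n \<le> a + b" "has_chain R (H 0 \<inter> M) M a" "has_chain R (H 0 <+> M) L b"
      using has_chain_split[OF M sub(2) L, of n H] by blast
    have "K \<subseteq> H 0 \<inter> M" "M \<subseteq> H 0 <+> M" using H(1) sub ideal_sum_upper(2)[OF _ M] by blast+
    then have "has_chain R K M a" "has_chain R M L b"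
      using ab has_chain_mono by blast+
    then have "enat a \<le> ilen R K M" "enat b \<le> ilen R M L"
      using enat_le_ilen_iff K M sub by blast+
    then have "enat a + enat b \<le> ilen R K M + ilen R M L" by (rule add_mono)
    then show "enat n \<le> ilen R K M + ilen R M L" using ab(1) by (metis enat_ord_simps(1) order_trans plus_enat_simps(1))
  qed
  show "ilen R K M + ilen R M L \<le> ilen R K L"
  proof (rule enat_le_ext)
    fix n assume n: "enat n \<le> ilen R K M + ilen R M L"
    have "\<exists>a b. n \<le> a + b \<and> enat a \<le> ilen R K M \<and> enat b \<le> ilen R M L"
    proof (cases "ilen R K M")
      case (enat a)
      show ?thesis
      proof (cases "ilen R M L")
        case (enat b) then show ?thesis using n \<open>ilen R K M = enat a\<close> by (intro exI[of _ a] exI[of _ b]) simp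
      next
        case infinity
        then have "n \<le> 0 + n \<and> enat 0 \<le> ilen R K M \<and> enat n \<le> ilen R M L"
          by (simp add: zero_enat_def[symmetric])
        then show ?thesis by blast
      qed
    next
      case infinity
      then have "n \<le> n + 0 \<and> enat n \<le> ilen R K M \<and> enat 0 \<le> ilen R M L"
        by (simp add: zero_enat_def[symmetric])
      then show ?thesis by blast
    qed
    then obtain a b where ab: "n \<le> a + b" "has_chain R K M a" "has_chain R M L b"
      using enat_le_ilen_iff K M sub by blast
    then have "has_chain R K L (a + b)" using has_chain_append sub by blast
    then have "has_chain R K L n" using has_chain_le ab(1) by blast
    then show "enat n \<le> ilen R K L" using enat_le_ilen_iff[OF K] sub by blast
  qed
qed

text \<open>  Adding \<open>B\<close> is injective on the ideals between \<open>K\<close> and \<open>A\<close>; this is the embedding of \<open>A/K\<close> into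
  \<open>C/B\<close>.\<close>
lemma ilen_sum_le:
  assumes A: "ideal A R" and B: "ideal B R" and C: "ideal C R"
    and "B \<inter> A \<subseteq> K" "A \<subseteq> C" "B \<subseteq> C"
  shows "ilen R K A \<le> ilen R B C"
proof (rule ilen_le_map[where f = "\<lambda>H. H <+> B"])
  fix H assume H: "ideal H R" "K \<subseteq> H" "H \<subseteq> A"
  show "ideal (H <+> B) R \<and> B \<subseteq> H <+> B \<and> H <+> B \<subseteq> C"
    using add_ideals[OF H(1) B] ideal_sum_upper(2)[OF H(1) B] ideal_sum_least[OF C, of H B] H assms(5,6) by blast
next
  fix H H' assume H: "ideal H R" "ideal H' R" "K \<subseteq> H" "H' \<subseteq> A" "H \<subseteq> H'"
  show "H <+> B \<subseteq> H' <+> B" using H(5) by (rule ideal_sum_mono) simp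
  have *: "(V <+> B) \<inter> A = V" if V: "ideal V R" "K \<subseteq> V" "V \<subseteq> A" for V
  proof -
    have "(V <+> B) \<inter> A = V <+> (B \<inter> A)" by (rule ideal_modular[OF V(1) B A V(3)])
    also have "\<dots> = V" by (rule ideal_sum_absorb[OF V(1) i_intersect[OF B A]]) (use assms(4) V(2) in blast)
    finally show ?thesis .
  qed
  assume "H <+> B = H' <+> B"
  then show "H' \<subseteq> H" using *[of H] *[of H'] H by (metis order_refl subset_trans)
qed

lemma ilen_second_iso:
  assumes A: "ideal A R" and B: "ideal B R"
  shows "ilen R (A \<inter> B) A = ilen R B (A <+> B)"
proof (rule antisym)
  show "ilen R (A \<inter> B) A \<le> ilen R B (A <+> B)"
    by (rule ilen_sum_le[OF A B add_ideals[OF A B]]) (use ideal_sum_upper[OF A B] in auto)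
  show "ilen R B (A <+> B) \<le> ilen R (A \<inter> B) A"
  proof (rule ilen_le_map[where f = "\<lambda>H. A \<inter> H"])
    fix H assume H: "ideal H R" "B \<subseteq> H" "H \<subseteq> A <+> B"
    show "ideal (A \<inter> H) R \<and> A \<inter> B \<subseteq> A \<inter> H \<and> A \<inter> H \<subseteq> A"
      using i_intersect[OF A H(1)] H(2) by blast
  next
    fix H H' assume H: "ideal H R" "ideal H' R" "B \<subseteq> H" "H' \<subseteq> A <+> B" "H \<subseteq> H'"
    show "A \<inter> H \<subseteq> A \<inter> H'" using H(5) by blast
    have *: "B <+> (A \<inter> V) = V" if V: "ideal V R" "B \<subseteq> V" "V \<subseteq> A <+> B" for V
    proof -
      have "B <+> (A \<inter> V) = (B <+> A) \<inter> V" by (rule ideal_modular[OF B A V(1,2), symmetric])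
      also have "B <+> A = A <+> B" by (rule set_add_comm[OF ideal_subset_carrier[OF B] ideal_subset_carrier[OF A]])
      finally show ?thesis using V(3) by blast
    qed
    assume "A \<inter> H = A \<inter> H'"
    then show "H' \<subseteq> H" using *[of H] *[of H'] H by (metis order_refl subset_trans)
  qed
qed

text \<open>  The comparison of the two multiplicities for a single ideal: the second summand becomes the length
  over the quotient ring \<open>R/N\<close>, and the first is the defect.\<close>
lemma length_split:
  assumes K: "ideal K R" and S: "ideal S R" and N: "ideal N R" and KS: "K \<subseteq> S"
  shows "ilen R K S = ilen R (S \<inter> N \<inter> K) (S \<inter> N) + ilen R (K <+> N) (S <+> N)"
proof -
  note SN = i_intersect[OF S N] and KN = add_ideals[OF K N]
  have M: "ideal (K <+> (S \<inter> N)) R" by (rule add_ideals[OF K SN])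
  have comm: "(S \<inter> N) <+> K = K <+> (S \<inter> N)"
    by (rule set_add_comm[OF ideal_subset_carrier[OF SN] ideal_subset_carrier[OF K]])
  have "ilen R K S = ilen R K (K <+> (S \<inter> N)) + ilen R (K <+> (S \<inter> N)) S"
    by (rule ilen_additive[OF K M S ideal_sum_upper(1)[OF K SN] ideal_sum_least[OF S KS Int_lower1]])
  also have "ilen R K (K <+> (S \<inter> N)) = ilen R (S \<inter> N \<inter> K) (S \<inter> N)"
    using ilen_second_iso[OF SN K] unfolding comm by (rule sym)
  also have "ilen R (K <+> (S \<inter> N)) S = ilen R (S \<inter> (K <+> N)) S"
    using ideal_modular[OF K N S KS] by (simp add: Int_commute)
  also have "\<dots> = ilen R (K <+> N) (S <+> (K <+> N))" by (rule ilen_second_iso[OF S KN])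
  also have "S <+> (K <+> N) = S <+> N"
  proof
    note u = ideal_sum_upper[OF S N]
    have "K <+> N \<subseteq> S <+> N" by (rule ideal_sum_mono[OF KS subset_refl])
    then show "S <+> (K <+> N) \<subseteq> S <+> N" by (rule ideal_sum_least[OF add_ideals[OF S N] u(1)])
    show "S <+> N \<subseteq> S <+> (K <+> N)"
      by (rule ideal_sum_mono[OF subset_refl ideal_sum_upper(2)[OF K N]])
  qed
  finally show ?thesis .
qed

end

context cring begin

lemma cgenideal_mem: "y \<in> PIdl x \<longleftrightarrow> (\<exists>r\<in>carrier R. y = r \<otimes> x)"
  unfolding cgenideal_def by auto

text \<open>  The cyclic module \<open>(K + R x)/K\<close> is the quotient of \<open>R\<close> by \<open>(K : x)\<close>. This lemma and the next one use the
  two directions of this isomorphism separately.\<close>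
lemma ilen_cyclic_le:
  assumes K: "ideal K R" and x: "x \<in> carrier R" and Q: "Q \<subseteq> ideal_colon R K {x}"
  shows "ilen R K (K <+> PIdl x) \<le> ilen R Q (carrier R)"
proof (rule ilen_le_map[where f = "\<lambda>H. ideal_colon R H {x}"])
  fix H assume H: "ideal H R" "K \<subseteq> H" "H \<subseteq> K <+> PIdl x"
  have "ideal (ideal_colon R H {x}) R" using x by (intro ideal_colon_ideal[OF H(1)]) simp
  moreover have "ideal_colon R K {x} \<subseteq> ideal_colon R H {x}" using H(2) by (auto simp: ideal_colon_def)
  ultimately show "ideal (ideal_colon R H {x}) R \<and> Q \<subseteq> ideal_colon R H {x} \<and> ideal_colon R H {x} \<subseteq> carrier R"
    using Q by (auto simp: ideal_colon_def)
next
  fix H H' assume H: "ideal H R" "ideal H' R" "K \<subseteq> H" "H' \<subseteq> K <+> PIdl x" "H \<subseteq> H'"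
  show "ideal_colon R H {x} \<subseteq> ideal_colon R H' {x}" using H(5) by (auto simp: ideal_colon_def)
  assume eq: "ideal_colon R H {x} = ideal_colon R H' {x}"
  show "H' \<subseteq> H"
  proof
    fix h assume h: "h \<in> H'"
    have "h \<in> K <+> PIdl x" using h H(4) by (rule rev_subsetD)
    then obtain k j where kj: "k \<in> K" "j \<in> PIdl x" "h = k \<oplus> j"
      unfolding ideal_sum_mem by blast
    then obtain r where kr: "k \<in> K" "r \<in> carrier R" "h = k \<oplus> r \<otimes> x"
      using cgenideal_mem[of j x] by blast
    have kH: "k \<in> H" "k \<in> H'" using kr(1) H(3,5) by auto
    have kc: "k \<in> carrier R" using ideal_closed(7)[OF H(1) kH(1)] .
    have "r \<otimes> x = h \<ominus> k" using kr kc x by algebra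
    then have "r \<otimes> x \<in> H'" using ideal_closed(4)[OF H(2) h kH(2)] by simp
    then have "r \<in> ideal_colon R H {x}" unfolding eq using kr(2) by (simp add: ideal_colon_def)
    then have "r \<otimes> x \<in> H" by (simp add: ideal_colon_def)
    then show "h \<in> H" using kr(3) ideal_closed(2)[OF H(1) kH(1)] by simp
  qed
qed

lemma ilen_cyclic_ge:
  assumes K: "ideal K R" and x: "x \<in> carrier R"
  shows "ilen R (ideal_colon R K {x}) (carrier R) \<le> ilen R K (K <+> PIdl x)"
proof (rule ilen_le_map[where f = "\<lambda>Q. K <+> ((\<lambda>q. q \<otimes> x) ` Q)"])
  have mem: "y \<in> K <+> ((\<lambda>q. q \<otimes> x) ` Q) \<longleftrightarrow> (\<exists>k\<in>K. \<exists>q\<in>Q. y = k \<oplus> q \<otimes> x)" for y Q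
    by (auto simp: ideal_sum_mem)
  fix Q assume Q: "ideal Q R" "ideal_colon R K {x} \<subseteq> Q" "Q \<subseteq> carrier R"
  have 1: "ideal ((\<lambda>q. q \<otimes> x) ` Q) R"
  proof (rule idealI_comm)
    show "(\<lambda>q. q \<otimes> x) ` Q \<subseteq> carrier R" using Q(3) x by auto
    have "\<zero> \<otimes> x \<in> (\<lambda>q. q \<otimes> x) ` Q" using ideal_closed(1)[OF Q(1)] by (rule imageI)
    then show "\<zero> \<in> (\<lambda>q. q \<otimes> x) ` Q" using x by simp
    fix a assume "a \<in> (\<lambda>q. q \<otimes> x) ` Q"
    then obtain q where q: "q \<in> Q" "a = q \<otimes> x" by blast
    have qc: "q \<in> carrier R" using q(1) Q(3) by auto
    { fix b assume "b \<in> (\<lambda>q. q \<otimes> x) ` Q"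
      then obtain p where p: "p \<in> Q" "b = p \<otimes> x" by blast
      have pc: "p \<in> carrier R" using p(1) Q(3) by auto
      have "a \<oplus> b = (q \<oplus> p) \<otimes> x" using q(2) p(2) pc qc x by (simp add: l_distr)
      then show "a \<oplus> b \<in> (\<lambda>q. q \<otimes> x) ` Q" using ideal_closed(2)[OF Q(1) q(1) p(1)] by blast }
    fix r assume r: "r \<in> carrier R"
    have "r \<otimes> a = (r \<otimes> q) \<otimes> x" using q(2) r qc x by (simp add: m_assoc)
    then show "r \<otimes> a \<in> (\<lambda>q. q \<otimes> x) ` Q" using ideal_closed(5)[OF Q(1) q(1) r] by blast
  qed
  have "(\<lambda>q. q \<otimes> x) ` Q \<subseteq> PIdl x" using Q(3) unfolding cgenideal_def by blast
  then show "ideal (K <+> ((\<lambda>q. q \<otimes> x) ` Q)) R \<and> K \<subseteq> K <+> ((\<lambda>q. q \<otimes> x) ` Q)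
    \<and> K <+> ((\<lambda>q. q \<otimes> x) ` Q) \<subseteq> K <+> PIdl x"
    using add_ideals[OF K 1] ideal_sum_upper(1)[OF K 1] ideal_sum_mono[OF subset_refl] by blast
next
  fix Q Q' assume Q: "ideal Q R" "ideal Q' R" "ideal_colon R K {x} \<subseteq> Q" "Q' \<subseteq> carrier R" "Q \<subseteq> Q'"
  show "K <+> ((\<lambda>q. q \<otimes> x) ` Q) \<subseteq> K <+> ((\<lambda>q. q \<otimes> x) ` Q')"
    using Q(5) by (intro ideal_sum_mono) auto
  assume eq: "K <+> ((\<lambda>q. q \<otimes> x) ` Q) = K <+> ((\<lambda>q. q \<otimes> x) ` Q')"
  show "Q' \<subseteq> Q"
  proof
    fix q assume q: "q \<in> Q'"
    have qc: "q \<in> carrier R" using q Q(4) by auto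
    have "\<zero> \<oplus> q \<otimes> x \<in> K <+> ((\<lambda>q. q \<otimes> x) ` Q)"
      unfolding eq ideal_sum_mem using q ideal_closed(1)[OF K] by blast
    then obtain k p where kp: "k \<in> K" "p \<in> Q" "q \<otimes> x = k \<oplus> p \<otimes> x"
      using qc x unfolding ideal_sum_mem by auto
    have c: "p \<in> carrier R" "k \<in> carrier R" using ideal_closed(7)[OF Q(1) kp(2)] ideal_closed(7)[OF K kp(1)] by auto
    have "(q \<ominus> p) \<otimes> x = q \<otimes> x \<ominus> p \<otimes> x" using c qc x by algebra
    also have "\<dots> = k" unfolding kp(3) using c x by algebra
    finally have "q \<ominus> p \<in> ideal_colon R K {x}" using kp(1) c qc by (simp add: ideal_colon_def)
    then have "(q \<ominus> p) \<oplus> p \<in> Q" using Q(3) ideal_closed(2)[OF Q(1) _ kp(2)] by blast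
    moreover have "(q \<ominus> p) \<oplus> p = q" using c qc by algebra
    ultimately show "q \<in> Q" by simp
  qed
qed

end

section \<open>Growth of lengths modulo powers of an ideal\<close>

text \<open>The ideal \<open>A + (x\<^sub>1, \<dots>, x\<^sub>m)\<close>, built in the order in which the generators are treated.\<close>
primrec add_gens :: "('a, 'b) ring_scheme \<Rightarrow> 'a set \<Rightarrow> 'a list \<Rightarrow> 'a set" where
  "add_gens R A [] = A"
| "add_gens R A (x # xs) = add_gens R (A <+>\<^bsub>R\<^esub> PIdl\<^bsub>R\<^esub> x) xs"

context cring begin

lemma add_gens_ideal: "ideal A R \<Longrightarrow> set xs \<subseteq> carrier R \<Longrightarrow> ideal (add_gens R A xs) R"
  by (induction xs arbitrary: A) (auto simp: add_ideals cgenideal_ideal)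

lemma add_gens_upper:
  "ideal A R \<Longrightarrow> set xs \<subseteq> carrier R \<Longrightarrow> A \<subseteq> add_gens R A xs \<and> set xs \<subseteq> add_gens R A xs"
proof (induction xs arbitrary: A)
  case (Cons x xs)
  then have x: "ideal (PIdl x) R" "x \<in> PIdl x" by (auto simp: cgenideal_ideal cgenideal_self)
  have "A <+> PIdl x \<subseteq> add_gens R A (x # xs) \<and> set xs \<subseteq> add_gens R A (x # xs)"
    using Cons.IH[of "A <+> PIdl x"] Cons.prems add_ideals[OF Cons.prems(1) x(1)] by simp
  then show ?case using ideal_sum_upper[OF Cons.prems(1) x(1)] x(2) by auto
qed simp

lemma add_gens_least:
  "ideal A R \<Longrightarrow> ideal K R \<Longrightarrow> A \<subseteq> K \<Longrightarrow> set xs \<subseteq> K \<Longrightarrow> add_gens R A xs \<subseteq> K"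
proof (induction xs arbitrary: A)
  case (Cons x xs)
  then have xK: "x \<in> K" by auto
  have "PIdl x \<subseteq> K" by (rule cgenideal_minimal[OF Cons.prems(2) xK])
  then have "A <+> PIdl x \<subseteq> K" by (rule ideal_sum_least[OF Cons.prems(2,3)])
  then show ?case
    using Cons.IH[of "A <+> PIdl x"] Cons.prems
      add_ideals[OF Cons.prems(1) cgenideal_ideal[OF ideal_closed(7)[OF Cons.prems(2) xK]]] by simp
qed simp

lemma add_gens_sum:
  assumes A: "ideal A R" and B: "ideal B R" and xs: "set xs \<subseteq> carrier R"
  shows "add_gens R (A <+> B) xs = add_gens R A xs <+> B"
proof
  note AB = add_ideals[OF A B]
  note l = add_gens_ideal[OF A xs] and r = add_gens_ideal[OF AB xs]
  note u = add_gens_upper[OF A xs] and v = add_gens_upper[OF AB xs]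
  note s = ideal_sum_upper[OF l B] and t = ideal_sum_upper[OF A B]
  show "add_gens R (A <+> B) xs \<subseteq> add_gens R A xs <+> B"
    by (rule add_gens_least[OF AB add_ideals[OF l B] ideal_sum_least[OF add_ideals[OF l B]]])
      (use u s in auto)
  show "add_gens R A xs <+> B \<subseteq> add_gens R (A <+> B) xs"
    by (rule ideal_sum_least[OF r add_gens_least[OF A r]]) (use v t in auto)
qed

text \<open>  The quotient of \<open>Q + (x ^ j)\<close> by \<open>Q + (x ^ (j + 1))\<close> is cyclic, generated by \<open>x ^ j\<close> and killed
  by \<open>Q + (x)\<close>; there are \<open>k\<close> such quotients.\<close>
lemma ilen_power_generator:
  assumes Q: "ideal Q R" and x: "x \<in> carrier R"
  shows "ilen R (Q <+> PIdl (x [^] k)) (carrier R) \<le> of_nat k * ilen R (Q <+> PIdl x) (carrier R)"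
proof (induction k)
  case 0
  have "PIdl \<one> = carrier R" using cgenideal_eq_genideal[of \<one>] genideal_one by simp
  moreover have "Q <+> carrier R = carrier R"
    using ideal_sum_upper(2)[OF Q oneideal] ideal_subset_carrier[OF add_ideals[OF Q oneideal]] by blast
  ultimately show ?case by (simp add: ilen_trivial)
next
  case (Suc k)
  let ?K = "Q <+> PIdl (x [^] Suc k)" and ?J = "Q <+> PIdl (x [^] k)" and ?z = "x [^] k"
  have z: "?z \<in> carrier R" "x [^] Suc k \<in> carrier R" using x by auto
  have pz: "ideal (PIdl ?z) R" "ideal (PIdl (x [^] Suc k)) R" "ideal (PIdl x) R"
    using z x by (auto intro: cgenideal_ideal)
  have K: "ideal ?K R" and J: "ideal ?J R" by (rule add_ideals[OF Q] pz)+
  have zK: "x [^] Suc k \<in> ?K"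
    using cgenideal_self[OF z(2)] ideal_sum_upper(2)[OF Q pz(2)] by blast
  have "x [^] Suc k = x \<otimes> ?z" using x by (simp add: m_comm)
  then have "x [^] Suc k \<in> PIdl ?z" using x unfolding cgenideal_mem by blast
  then have sub: "PIdl (x [^] Suc k) \<subseteq> PIdl ?z" by (rule cgenideal_minimal[OF pz(1)])
  then have KJ: "?K \<subseteq> ?J" by (rule ideal_sum_mono[OF subset_refl])
  have QK: "Q \<subseteq> ?K" by (rule ideal_sum_upper(1)[OF Q pz(2)])
  have "?K <+> PIdl ?z = ?J"
  proof
    show "?K <+> PIdl ?z \<subseteq> ?J"
      by (rule ideal_sum_least[OF J KJ ideal_sum_upper(2)[OF Q pz(1)]])
    show "?J \<subseteq> ?K <+> PIdl ?z" by (rule ideal_sum_mono[OF QK subset_refl])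
  qed
  moreover have "Q <+> PIdl x \<subseteq> ideal_colon R ?K {?z}"
  proof (rule ideal_sum_least)
    show I: "ideal (ideal_colon R ?K {?z}) R" by (rule ideal_colon_ideal[OF K]) (use z in simp)
    show "Q \<subseteq> ideal_colon R ?K {?z}"
      using ideal_closed(6)[OF Q _ z(1)] ideal_subset_carrier[OF Q] QK by (auto simp: ideal_colon_def)
    show "PIdl x \<subseteq> ideal_colon R ?K {?z}"
    proof (rule cgenideal_minimal[OF I])
      show "x \<in> ideal_colon R ?K {?z}" using zK x m_comm[of x ?z] by (simp add: ideal_colon_def)
    qed
  qed
  ultimately have "ilen R ?K ?J \<le> ilen R (Q <+> PIdl x) (carrier R)"
    using ilen_cyclic_le[OF K z(1), of "Q <+> PIdl x"] by simp
  moreover have "ilen R ?K (carrier R) = ilen R ?K ?J + ilen R ?J (carrier R)"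
    by (rule ilen_additive[OF K J oneideal KJ ideal_subset_carrier[OF J]])
  ultimately have "ilen R ?K (carrier R)
      \<le> ilen R (Q <+> PIdl x) (carrier R) + of_nat k * ilen R (Q <+> PIdl x) (carrier R)"
    using Suc by (metis add_mono)
  then show ?case by (simp add: distrib_right)
qed

lemma ilen_power_generators:
  assumes "ideal A R" "set xs \<subseteq> carrier R"
  shows "ilen R (add_gens R A (map (\<lambda>x. x [^] k) xs)) (carrier R)
    \<le> of_nat (k ^ length xs) * ilen R (add_gens R A xs) (carrier R)"
  using assms
proof (induction xs arbitrary: A)
  case Nil then show ?case by simp
next
  case (Cons x xs)
  let ?xk = "x [^] k"
  have x: "x \<in> carrier R" "?xk \<in> carrier R" "set xs \<subseteq> carrier R" using Cons.prems by auto
  note px = cgenideal_ideal[OF x(1)] and pxk = cgenideal_ideal[OF x(2)]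
  let ?G = "add_gens R A xs"
  have "ilen R (add_gens R A (map (\<lambda>x. x [^] k) (x # xs))) (carrier R)
      \<le> of_nat (k ^ length xs) * ilen R (add_gens R (A <+> PIdl ?xk) xs) (carrier R)"
    using Cons.IH[OF add_ideals[OF Cons.prems(1) pxk] x(3)] by simp
  also have "add_gens R (A <+> PIdl ?xk) xs = ?G <+> PIdl ?xk"
    by (rule add_gens_sum[OF Cons.prems(1) pxk x(3)])
  also have "of_nat (k ^ length xs) * ilen R (?G <+> PIdl ?xk) (carrier R)
      \<le> of_nat (k ^ length xs) * (of_nat k * ilen R (?G <+> PIdl x) (carrier R))"
    by (rule mult_left_mono[OF ilen_power_generator[OF add_gens_ideal[OF Cons.prems(1) x(3)] x(1)]]) simp
  also have "?G <+> PIdl x = add_gens R A (x # xs)"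
    using add_gens_sum[OF Cons.prems(1) px x(3)] by simp
  finally show ?case by (simp add: mult_ac)
qed

lemma pow_in_ideal_pow: "ideal I R \<Longrightarrow> x \<in> I \<Longrightarrow> x [^] (k::nat) \<in> ideal_pow R I k"
  by (induction k) (auto simp: ideal_pow_simps intro: ideal_prod.prod)

text \<open>  The ideal \<open>\<mm> ^ k\<close> contains the \<open>k\<close>-th powers of the given elements, so a quotient with a short
  filtration by cyclic modules maps onto \<open>R/(\<mm> ^ k + A)\<close>.\<close>
lemma ilen_ideal_pow_le:
  assumes A: "ideal A R" and \<mm>: "ideal \<mm> R" and xs: "set xs \<subseteq> \<mm>"
  shows "ilen R (ideal_pow R \<mm> k <+> A) (carrier R)
    \<le> of_nat (k ^ length xs) * ilen R (add_gens R A xs) (carrier R)"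
proof -
  have xc: "set xs \<subseteq> carrier R" using xs ideal_subset_carrier[OF \<mm>] by blast
  note s = ideal_sum_upper[OF ideal_pow_ideal[OF \<mm>] A, of k]
  have "set (map (\<lambda>x. x [^] k) xs) \<subseteq> ideal_pow R \<mm> k"
    using pow_in_ideal_pow[OF \<mm>] xs by auto
  then have "set (map (\<lambda>x. x [^] k) xs) \<subseteq> ideal_pow R \<mm> k <+> A" using s(1) by blast
  then have "add_gens R A (map (\<lambda>x. x [^] k) xs) \<subseteq> ideal_pow R \<mm> k <+> A"
    by (rule add_gens_least[OF A add_ideals[OF ideal_pow_ideal[OF \<mm>] A] s(2)])
  then have "ilen R (ideal_pow R \<mm> k <+> A) (carrier R)
      \<le> ilen R (add_gens R A (map (\<lambda>x. x [^] k) xs)) (carrier R)"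
    by (rule ilen_mono) simp
  also have "\<dots> \<le> of_nat (k ^ length xs) * ilen R (add_gens R A xs) (carrier R)"
    by (rule ilen_power_generators[OF A xc])
  finally show ?thesis .
qed

lemma ilen_add_gens_le:
  assumes "ideal K R" "set ys \<subseteq> carrier R" "\<And>y. y \<in> set ys \<Longrightarrow> Q \<subseteq> ideal_colon R K {y}"
  shows "ilen R K (add_gens R K ys) \<le> of_nat (length ys) * ilen R Q (carrier R)"
  using assms
proof (induction ys arbitrary: K)
  case Nil then show ?case by (simp add: ilen_trivial)
next
  case (Cons y ys)
  have y: "y \<in> carrier R" "set ys \<subseteq> carrier R" using Cons.prems(2) by auto
  let ?L = "K <+> PIdl y"
  have L: "ideal ?L R" by (rule add_ideals[OF Cons.prems(1) cgenideal_ideal[OF y(1)]])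
  have KL: "K \<subseteq> ?L" by (rule ideal_sum_upper(1)[OF Cons.prems(1) cgenideal_ideal[OF y(1)]])
  have "Q \<subseteq> ideal_colon R ?L {z}" if "z \<in> set ys" for z
    using Cons.prems(3)[of z] that KL by (auto simp: ideal_colon_def)
  then have "ilen R ?L (add_gens R ?L ys) \<le> of_nat (length ys) * ilen R Q (carrier R)"
    by (rule Cons.IH[OF L y(2)])
  moreover have "ilen R K ?L \<le> ilen R Q (carrier R)"
    by (rule ilen_cyclic_le[OF Cons.prems(1) y(1)]) (use Cons.prems(3) in simp)
  moreover have "ilen R K (add_gens R ?L ys) = ilen R K ?L + ilen R ?L (add_gens R ?L ys)"
    by (rule ilen_additive[OF Cons.prems(1) L add_gens_ideal[OF L y(2)] KL])
      (use add_gens_upper[OF L y(2)] in blast)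
  ultimately have "ilen R K (add_gens R ?L ys)
      \<le> ilen R Q (carrier R) + of_nat (length ys) * ilen R Q (carrier R)"
    by (metis add_mono)
  then show ?case by (simp add: distrib_right)
qed

section \<open>Primes of Noetherian rings\<close>

abbreviation ideals_prod :: "'a set list \<Rightarrow> 'a set" where
  "ideals_prod Is \<equiv> foldr (ideal_prod R) Is (carrier R)"

lemma ideals_prod_ideal: "(\<And>I. I \<in> set Is \<Longrightarrow> ideal I R) \<Longrightarrow> ideal (ideals_prod Is) R"
  by (induction Is) (auto simp: oneideal ideal_prod_is_ideal)

lemma ideals_prod_append:
  assumes "\<And>I. I \<in> set Is \<Longrightarrow> ideal I R" "\<And>J. J \<in> set Js \<Longrightarrow> ideal J R"
  shows "ideals_prod (Is @ Js) = ideals_prod Is \<cdot> ideals_prod Js"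
  using assms
proof (induction Is)
  case Nil then show ?case using ideal_prod_one_left[OF ideals_prod_ideal] by simp
next
  case (Cons I Is)
  then show ?case
    using ideal_prod_assoc[of I "ideals_prod Is" "ideals_prod Js"]
      ideals_prod_ideal[of Is] ideals_prod_ideal[of Js] by simp
qed

lemma prime_contains_factor:
  assumes P: "primeideal P R" and Is: "\<And>I. I \<in> set Is \<Longrightarrow> ideal I R" and "ideals_prod Is \<subseteq> P"
  shows "\<exists>I\<in>set Is. I \<subseteq> P"
  using assms(2,3)
proof (induction Is)
  case Nil
  then show ?case
    using primeideal.I_notcarr[OF P] ideal_subset_carrier[OF primeideal.axioms(1)[OF P]] by auto
next
  case (Cons I Is)
  then have "I \<subseteq> P \<or> ideals_prod Is \<subseteq> P"
    using primeideal_divides_ideal_prod[OF P, of I "ideals_prod Is"] ideals_prod_ideal[of Is] by simp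
  then show ?case using Cons by auto
qed

text \<open>  Noetherian induction: an ideal \<open>M\<close> that is neither prime nor the whole ring has elements
  \<open>a, b \<notin> M\<close> with \<open>a b \<in> M\<close>, and then \<open>(M + (a)) (M + (b)) \<subseteq> M\<close>. The empty product serves the
  whole ring. Every prime above \<open>I\<close> contains one of the finitely many primes obtained, which therefore
  replace the minimal primes of \<open>I\<close>.\<close>
lemma ideal_contains_prime_product:
  assumes noeth: "noetherian_ring R" and I: "ideal I R"
  obtains Ps where "\<And>P. P \<in> set Ps \<Longrightarrow> primeideal P R \<and> I \<subseteq> P" "ideals_prod Ps \<subseteq> I"
proof -
  interpret N: noetherian_ring R by fact
  define good where "good J \<longleftrightarrow> (\<exists>Ps. (\<forall>P\<in>set Ps. primeideal P R \<and> J \<subseteq> P) \<and> ideals_prod Ps \<subseteq> J)" for J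
  have "good I"
  proof (rule ccontr)
    assume "\<not> good I"
    then have "{J. ideal J R \<and> \<not> good J} \<noteq> {}" using I by blast
    from N.maximal_ideal_in_family[OF this] obtain M
      where "M \<in> {J. ideal J R \<and> \<not> good J}"
        "\<And>J. J \<in> {J. ideal J R \<and> \<not> good J} \<Longrightarrow> M \<subseteq> J \<Longrightarrow> J = M" by auto
    then have M: "ideal M R" "\<not> good M" "\<And>J. ideal J R \<Longrightarrow> \<not> good J \<Longrightarrow> M \<subseteq> J \<Longrightarrow> J = M"
      by simp_all
    have "carrier R \<noteq> M"
    proof
      assume "carrier R = M"
      then have "good M" unfolding good_def by (intro exI[of _ "[]"]) simp
      then show False using M(2) by simp
    qed
    moreover have "\<not> primeideal M R"
    proof
      assume prime: "primeideal M R"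
      have "ideals_prod [M] \<subseteq> M" by (simp add: ideal_prod_one[OF M(1)])
      then have "good M" unfolding good_def using prime by (intro exI[of _ "[M]"]) simp
      then show False using M(2) by simp
    qed
    ultimately obtain a b where ab: "a \<in> carrier R" "b \<in> carrier R" "a \<otimes> b \<in> M" "a \<notin> M" "b \<notin> M"
      using primeidealI[OF M(1) is_cring] by blast
    have bigger: "good (M <+> PIdl z)" if "z \<in> carrier R" "z \<notin> M" for z
    proof (rule ccontr)
      assume "\<not> good (M <+> PIdl z)"
      moreover note pz = cgenideal_ideal[OF that(1)]
      ultimately have "M <+> PIdl z = M"
        using M(3)[OF add_ideals[OF M(1) pz]] ideal_sum_upper(1)[OF M(1) pz] by blast
      then show False using ideal_sum_upper(2)[OF M(1) pz] cgenideal_self[OF that(1)] that(2) by blast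
    qed
    let ?A = "M <+> PIdl a" and ?B = "M <+> PIdl b"
    note pa = cgenideal_ideal[OF ab(1)] and pb = cgenideal_ideal[OF ab(2)]
    obtain Ps where Ps: "\<forall>P\<in>set Ps. primeideal P R \<and> ?A \<subseteq> P" "ideals_prod Ps \<subseteq> ?A"
      using bigger[OF ab(1,4)] unfolding good_def by blast
    obtain Qs where Qs: "\<forall>P\<in>set Qs. primeideal P R \<and> ?B \<subseteq> P" "ideals_prod Qs \<subseteq> ?B"
      using bigger[OF ab(2,5)] unfolding good_def by blast
    have "ideals_prod (Ps @ Qs) = ideals_prod Ps \<cdot> ideals_prod Qs"
    proof (rule ideals_prod_append)
      show "ideal P R" if "P \<in> set Ps" for P by (rule primeideal.axioms(1)[OF conjunct1[OF Ps(1)[rule_format, OF that]]])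
      show "ideal P R" if "P \<in> set Qs" for P by (rule primeideal.axioms(1)[OF conjunct1[OF Qs(1)[rule_format, OF that]]])
    qed
    also have "\<dots> \<subseteq> ?A \<cdot> ?B" by (rule ideal_prod_mono[OF Ps(2) Qs(2)])
    also have "\<dots> \<subseteq> M"
    proof (rule ideal_prod_least[OF M(1)])
      fix i j assume "i \<in> ?A" "j \<in> ?B"
      then obtain m u n v where "m \<in> M" "u \<in> PIdl a" "i = m \<oplus> u" "n \<in> M" "v \<in> PIdl b" "j = n \<oplus> v"
        unfolding ideal_sum_mem by blast
      moreover obtain r where "r \<in> carrier R" "u = r \<otimes> a"
        using \<open>u \<in> PIdl a\<close> cgenideal_mem by blast
      moreover obtain s where "s \<in> carrier R" "v = s \<otimes> b"
        using \<open>v \<in> PIdl b\<close> cgenideal_mem by blast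
      ultimately have *: "m \<in> M" "n \<in> M" "r \<in> carrier R" "s \<in> carrier R"
        "i = m \<oplus> r \<otimes> a" "j = n \<oplus> s \<otimes> b" by auto
      have mn: "m \<in> carrier R" "n \<in> carrier R" using *(1,2) ideal_closed(7)[OF M(1)] by auto
      have "i \<otimes> j = (n \<oplus> s \<otimes> b) \<otimes> m \<oplus> ((r \<otimes> a) \<otimes> n \<oplus> (r \<otimes> s) \<otimes> (a \<otimes> b))"
        unfolding *(5,6) using mn *(3,4) ab(1,2) by algebra
      also have "\<dots> \<in> M"
      proof (intro ideal_closed(2)[OF M(1)])
        show "(n \<oplus> s \<otimes> b) \<otimes> m \<in> M" "(r \<otimes> a) \<otimes> n \<in> M" "(r \<otimes> s) \<otimes> (a \<otimes> b) \<in> M"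
          by (rule ideal_closed(5)[OF M(1)]; use * ab mn in simp)+
      qed
      finally show "i \<otimes> j \<in> M" .
    qed
    finally have "ideals_prod (Ps @ Qs) \<subseteq> M" .
    moreover have "\<forall>P\<in>set (Ps @ Qs). primeideal P R \<and> M \<subseteq> P"
      using Ps(1) Qs(1) subset_trans[OF ideal_sum_upper(1)[OF M(1) pa]]
        subset_trans[OF ideal_sum_upper(1)[OF M(1) pb]] unfolding set_append by blast
    ultimately have "good M" unfolding good_def by blast
    then show False using M(2) by simp
  qed
  then show ?thesis using that unfolding good_def by blast
qed

lemma element_of_ideals_outside_prime:
  assumes P: "primeideal P R" and "finite \<G>" "\<And>G. G \<in> \<G> \<Longrightarrow> ideal G R \<and> \<not> G \<subseteq> P"
  shows "\<exists>z\<in>carrier R. z \<notin> P \<and> (\<forall>G\<in>\<G>. z \<in> G)"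
  using assms(2,3)
proof (induction \<G>)
  case empty
  have "\<one> \<notin> P"
    using ideal.one_imp_carrier[OF primeideal.axioms(1)[OF P]] primeideal.I_notcarr[OF P] by blast
  then show ?case by auto
next
  case (insert G \<G>)
  then obtain z where z: "z \<in> carrier R" "z \<notin> P" "\<forall>G\<in>\<G>. z \<in> G" by auto
  obtain g where g: "g \<in> G" "g \<notin> P" using insert.prems by blast
  have gc: "g \<in> carrier R" using insert.prems g ideal_closed(7) by blast
  have "z \<otimes> g \<notin> P" using primeideal.I_prime[OF P z(1) gc] z(2) g(2) by blast
  moreover have "z \<otimes> g \<in> H" if "H \<in> insert G \<G>" for H
  proof (cases "H = G")
    case True then show ?thesis using ideal_closed(5)[of G] insert.prems g z by blast
  next
    case False
    then have "ideal H R" "z \<in> H" using that insert.prems z(3) by auto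
    then show ?thesis using ideal_closed(6)[of H] gc by blast
  qed
  ultimately show ?case using z(1) gc by blast
qed

text \<open>  It suffices to treat primes without inclusions among them. If \<open>x \<in> J\<close> avoids all but \<open>Q\<close>, correct it by
  an element of \<open>J\<close> that lies in all the others but not in \<open>Q\<close>.\<close>
lemma prime_avoidance:
  assumes "finite \<Q>" "\<And>Q. Q \<in> \<Q> \<Longrightarrow> primeideal Q R \<and> \<not> J \<subseteq> Q" and J: "ideal J R"
  shows "\<exists>x\<in>J. \<forall>Q\<in>\<Q>. x \<notin> Q"
  using assms(1,2)
proof (induction \<Q> rule: finite_psubset_induct)
  case (psubset \<Q>)
  show ?case
  proof (cases "\<exists>Q\<in>\<Q>. \<exists>Q'\<in>\<Q>. Q \<noteq> Q' \<and> Q \<subseteq> Q'")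
    case True
    then obtain Q Q' where Q: "Q \<in> \<Q>" "Q' \<in> \<Q>" "Q \<noteq> Q'" "Q \<subseteq> Q'" by blast
    have "\<exists>x\<in>J. \<forall>Q\<in>\<Q> - {Q}. x \<notin> Q"
      by (rule psubset.IH) (use Q psubset.prems in auto)
    then show ?thesis using Q by blast
  next
    case antichain: False
    show ?thesis
    proof (cases "\<Q> = {}")
      case True then show ?thesis using ideal_closed(1)[OF J] by blast
    next
      case False
      then obtain Q where Q: "Q \<in> \<Q>" by blast
      have "\<exists>x\<in>J. \<forall>Q\<in>\<Q> - {Q}. x \<notin> Q"
        by (rule psubset.IH) (use Q psubset.prems in auto)
      then obtain x where x: "x \<in> J" "\<And>Q'. Q' \<in> \<Q> \<Longrightarrow> Q' \<noteq> Q \<Longrightarrow> x \<notin> Q'" by blast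
      show ?thesis
      proof (cases "x \<in> Q")
        case False then show ?thesis using x by blast
      next
        case xQ: True
        have Qp: "primeideal Q R" using psubset.prems[OF Q] by blast
        have "\<exists>z\<in>carrier R. z \<notin> Q \<and> (\<forall>G\<in>insert J (\<Q> - {Q}). z \<in> G)"
        proof (rule element_of_ideals_outside_prime[OF Qp])
          show "finite (insert J (\<Q> - {Q}))" using psubset.hyps by simp
          show "ideal G R \<and> \<not> G \<subseteq> Q" if "G \<in> insert J (\<Q> - {Q})" for G
            using that J psubset.prems Q antichain primeideal.axioms(1) by blast
        qed
        then obtain z where z: "z \<in> J" "z \<notin> Q" "\<And>Q'. Q' \<in> \<Q> \<Longrightarrow> Q' \<noteq> Q \<Longrightarrow> z \<in> Q'" by blast
        have c: "x \<in> carrier R" "z \<in> carrier R" using ideal_closed(7)[OF J] x(1) z(1) by auto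
        have "x \<oplus> z \<notin> Q'" if Q': "Q' \<in> \<Q>" for Q'
        proof
          assume sum: "x \<oplus> z \<in> Q'"
          have Q'i: "ideal Q' R" using psubset.prems[OF Q'] primeideal.axioms(1) by blast
          show False
          proof (cases "Q' = Q")
            case True
            have "(x \<oplus> z) \<ominus> x \<in> Q'" by (rule ideal_closed(4)[OF Q'i sum]) (use xQ True in simp)
            moreover have "(x \<oplus> z) \<ominus> x = z" using c by algebra
            ultimately show False using z(2) True by simp
          next
            case False
            have "(x \<oplus> z) \<ominus> z \<in> Q'" by (rule ideal_closed(4)[OF Q'i sum z(3)[OF Q' False]])
            moreover have "(x \<oplus> z) \<ominus> z = x" using c by algebra
            ultimately show False using x(2)[OF Q' False] by simp
          qed
        qed
        then show ?thesis using ideal_closed(2)[OF J x(1) z(1)] by blast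
      qed
    qed
  qed
qed

end

section \<open>Dimension of Noetherian local rings\<close>

text \<open>  Chains of primes above \<open>A\<close>; they compute the dimension of \<open>R/A\<close> inside \<open>R\<close>.\<close>
definition prime_chain :: "('a, 'b) ring_scheme \<Rightarrow> 'a set \<Rightarrow> nat \<Rightarrow> (nat \<Rightarrow> 'a set) \<Rightarrow> bool" where
  "prime_chain R A n p \<longleftrightarrow>
    (\<forall>j\<le>n. primeideal (p j) R \<and> A \<subseteq> p j) \<and> (\<forall>j<n. p j \<subset> p (Suc j))"

context noetherian_local_ring begin

abbreviation "\<mm> \<equiv> max_ideal R"
abbreviation "mpow \<equiv> ideal_pow R \<mm>"

lemma noetherian: "noetherian_ring R" by (rule noetherian_ring_axioms)

lemma max_maximal: "maximalideal \<mm> R"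
  unfolding max_ideal_def by (rule theI'[OF unique_maximal])

lemma max_ideal: "ideal \<mm> R" by (rule maximalideal.axioms(1)[OF max_maximal])

lemma max_prime: "primeideal \<mm> R" by (rule maximalideal_prime[OF max_maximal])

lemma max_proper: "\<mm> \<noteq> carrier R" using maximalideal.I_notcarr[OF max_maximal] by auto

lemma mpow_ideal: "ideal (mpow k) R" by (rule ideal_pow_ideal[OF max_ideal])

lemma proper_ideal_subset_max:
  assumes I: "ideal I R" and proper: "I \<noteq> carrier R"
  shows "I \<subseteq> \<mm>"
proof -
  let ?F = "{J. ideal J R \<and> I \<subseteq> J \<and> J \<noteq> carrier R}"
  have "?F \<noteq> {}" using assms by blast
  from maximal_ideal_in_family[OF this] obtain M where M: "M \<in> ?F" "\<And>J. J \<in> ?F \<Longrightarrow> M \<subseteq> J \<Longrightarrow> J = M"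
    by auto
  have "maximalideal M R"
  proof (rule maximalidealI)
    show "ideal M R" "carrier R \<noteq> M" using M(1) by auto
    fix J assume "ideal J R" "M \<subseteq> J" "J \<subseteq> carrier R"
    then show "J = M \<or> J = carrier R" using M by blast
  qed
  then have "M = \<mm>" using unique_maximal max_maximal by blast
  then show ?thesis using M(1) by blast
qed

lemma prime_subset_max: "primeideal P R \<Longrightarrow> P \<subseteq> \<mm>"
  using proper_ideal_subset_max[OF primeideal.axioms(1)] primeideal.I_notcarr by blast

lemma finite_generators:
  assumes "ideal I R"
  obtains ys where "set ys \<subseteq> I" "add_gens R {\<zero>} ys = I"
proof -
  obtain Y where Y: "Y \<subseteq> carrier R" "finite Y" "I = Idl Y" using finetely_gen[OF assms] by blast
  obtain ys where ys: "set ys = Y" using finite_list[OF Y(2)] by blast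
  have YI: "set ys \<subseteq> I" unfolding ys Y(3) by (rule genideal_self[OF Y(1)])
  have "{\<zero>} \<subseteq> I" using ideal_closed(1)[OF assms] by simp
  then have "add_gens R {\<zero>} ys \<subseteq> I" by (rule add_gens_least[OF zeroideal assms _ YI])
  moreover have "I \<subseteq> add_gens R {\<zero>} ys"
    unfolding Y(3) using add_gens_ideal[OF zeroideal] add_gens_upper[OF zeroideal] ys Y(1)
    by (intro genideal_minimal) auto
  ultimately show ?thesis using that YI by blast
qed

lemma ilen_max: "ilen R \<mm> (carrier R) = 1"
proof (rule antisym)
  show "1 \<le> ilen R \<mm> (carrier R)"
    by (rule one_le_ilen[OF max_ideal oneideal]) (use max_proper ideal_subset_carrier[OF max_ideal] in blast)
  have "\<not> has_chain R \<mm> (carrier R) 2"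
  proof
    assume "has_chain R \<mm> (carrier R) 2"
    then obtain H where H: "\<forall>i\<le>2. ideal (H i) R \<and> \<mm> \<subseteq> H i \<and> H i \<subseteq> carrier R" "\<forall>i<2. H i \<subset> H (Suc i)"
      unfolding has_chain_def by blast
    have *: "ideal (H 1) R" "\<mm> \<subseteq> H 0" "H 0 \<subset> H 1" "H 1 \<subset> H 2" "H 2 \<subseteq> carrier R"
      using H(1)[rule_format, of 1] H(1)[rule_format, of 0] H(1)[rule_format, of 2]
        H(2)[rule_format, of 0] H(2)[rule_format, of 1] by (auto simp: numeral_2_eq_2)
    then have "H 1 \<subseteq> \<mm>" by (intro proper_ideal_subset_max) auto
    then show False using * by blast
  qed
  then have "n \<le> 1" if "has_chain R \<mm> (carrier R) n" for n
    using has_chain_le[OF that, of 2] by linarith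
  then show "ilen R \<mm> (carrier R) \<le> 1"
    unfolding ilen_def by (intro Sup_least) (auto simp: one_enat_def)
qed

lemma ilen_mpow_polynomial:
  obtains r where "\<And>k A. ideal A R \<Longrightarrow> ilen R (mpow k <+> A) (carrier R) \<le> enat (k ^ r)"
proof -
  obtain ys where ys: "set ys \<subseteq> \<mm>" "add_gens R {\<zero>} ys = \<mm>" using finite_generators[OF max_ideal] .
  show ?thesis
  proof (rule that[of "length ys"])
    fix k A assume A: "ideal A R"
    have "ilen R (mpow k <+> A) (carrier R) \<le> ilen R (mpow k <+> {\<zero>}) (carrier R)"
      by (rule ilen_mono[OF ideal_sum_mono]) (use ideal_closed(1)[OF A] in auto)
    also have "\<dots> \<le> of_nat (k ^ length ys) * ilen R \<mm> (carrier R)"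
      using ilen_ideal_pow_le[OF zeroideal max_ideal ys(1), of k] ys(2) by simp
    finally show "ilen R (mpow k <+> A) (carrier R) \<le> enat (k ^ length ys)"
      by (simp add: ilen_max of_nat_eq_enat)
  qed
qed

lemma one_le_ilen_mpow:
  assumes P: "primeideal P R" and "k \<ge> 1"
  shows "1 \<le> ilen R (mpow k <+> P) (carrier R)"
proof -
  have Pi: "ideal P R" by (rule primeideal.axioms(1)[OF P])
  have "mpow k \<subseteq> mpow 1" by (rule ideal_pow_antimono[OF max_ideal assms(2)])
  then have "mpow k \<subseteq> \<mm>" using ideal_pow_1[OF max_ideal] by simp
  then have "mpow k <+> P \<subseteq> \<mm>" by (rule ideal_sum_least[OF max_ideal _ prime_subset_max[OF P]])
  then have "mpow k <+> P \<subset> carrier R" using max_proper ideal_subset_carrier[OF max_ideal] by blast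
  then show ?thesis by (rule one_le_ilen[OF add_ideals[OF mpow_ideal Pi] oneideal])
qed

text \<open>  Choose \<open>x \<in> P' - P\<close> and split the length of \<open>R/(\<mm> ^ k + P)\<close> at \<open>\<mm> ^ k + P + (x)\<close>. The upper part
  dominates \<open>R/(\<mm> ^ k + P')\<close>. The lower part is \<open>R/(\<mm> ^ k + P : x)\<close>, and Artin--Rees for
  \<open>P + (x)\<close> gives \<open>(\<mm> ^ k + P : x) \<subseteq> \<mm> ^ (k - c) + P\<close>, because \<open>x\<close> is not a zero divisor
  modulo \<open>P\<close>.\<close>
lemma ilen_mpow_recursion:
  assumes P: "primeideal P R" and P': "ideal P' R" and sub: "P \<subset> P'"
  obtains c where "c \<ge> 1" "\<And>k. k \<ge> c \<Longrightarrow> ilen R (mpow (k - c) <+> P) (carrier R)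
    + ilen R (mpow k <+> P') (carrier R) \<le> ilen R (mpow k <+> P) (carrier R)"
proof -
  have Pi: "ideal P R" by (rule primeideal.axioms(1)[OF P])
  obtain x where x: "x \<in> P'" "x \<notin> P" using sub by blast
  have xc: "x \<in> carrier R" by (rule ideal_closed(7)[OF P' x(1)])
  note px = cgenideal_ideal[OF xc]
  let ?T = "P <+> PIdl x"
  have T: "ideal ?T R" by (rule add_ideals[OF Pi px])
  obtain c where c: "\<And>a. a \<ge> c \<Longrightarrow> mpow a \<inter> ?T \<subseteq> mpow (a - c) \<cdot> ?T"
    using artin_rees[OF noetherian max_ideal T] by blast
  \<comment> \<open>\<open>Suc c\<close> because the constant has to be positive for the recursion to descend\<close>
  have colon: "ideal_colon R (mpow k <+> P) {x} \<subseteq> mpow (k - Suc c) <+> P" if k: "k \<ge> Suc c" for k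
  proof
    fix y assume "y \<in> ideal_colon R (mpow k <+> P) {x}"
    then have y: "y \<in> carrier R" "y \<otimes> x \<in> mpow k <+> P" by (simp_all add: ideal_colon_def)
    then obtain z p where zp: "z \<in> mpow k" "p \<in> P" "y \<otimes> x = z \<oplus> p" unfolding ideal_sum_mem by blast
    have zc: "z \<in> carrier R" "p \<in> carrier R"
      using ideal_closed(7)[OF mpow_ideal zp(1)] ideal_closed(7)[OF Pi zp(2)] by auto
    have "z = \<ominus> p \<oplus> y \<otimes> x" unfolding zp(3) using zc by algebra
    moreover have "\<ominus> p \<in> P" by (rule ideal_closed(3)[OF Pi zp(2)])
    moreover have "y \<otimes> x \<in> PIdl x" using y(1) cgenideal_mem by blast
    ultimately have "z \<in> ?T" unfolding ideal_sum_mem by blast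
    then have "z \<in> mpow (k - c) \<cdot> ?T" using c[of k] k zp(1) by auto
    also have "mpow (k - c) \<cdot> ?T = (mpow (k - c) \<cdot> P) <+> (mpow (k - c) \<cdot> (PIdl x))"
      by (rule ideal_prod_r_distr[OF mpow_ideal Pi px])
    finally obtain u v where uv: "u \<in> mpow (k - c) \<cdot> P" "v \<in> mpow (k - c) \<cdot> (PIdl x)" "z = u \<oplus> v"
      unfolding ideal_sum_mem by blast
    have uP: "u \<in> P" using uv(1) ideal_prod_inter[OF mpow_ideal Pi] by blast
    have "\<exists>w\<in>mpow (k - c). v = w \<otimes> x" using uv(2)
    proof induction
      case (prod i j)
      then obtain r where r: "r \<in> carrier R" "j = r \<otimes> x" using cgenideal_mem by blast
      have ic: "i \<in> carrier R" by (rule ideal_closed(7)[OF mpow_ideal prod(1)])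
      have "i \<otimes> j = (i \<otimes> r) \<otimes> x" using r ic xc by (simp add: m_assoc)
      then show ?case using ideal_closed(6)[OF mpow_ideal prod(1) r(1)] by blast
    next
      case (sum s t)
      then obtain a b where ab: "a \<in> mpow (k - c)" "b \<in> mpow (k - c)" "s = a \<otimes> x" "t = b \<otimes> x" by blast
      have "a \<in> carrier R" "b \<in> carrier R" using ab(1,2) ideal_closed(7)[OF mpow_ideal] by blast+
      then have "s \<oplus> t = (a \<oplus> b) \<otimes> x" using ab(3,4) xc by (simp add: l_distr)
      then show ?case using ideal_closed(2)[OF mpow_ideal ab(1,2)] by blast
    qed
    then obtain w where w: "w \<in> mpow (k - c)" "v = w \<otimes> x" by blast
    have cc: "w \<in> carrier R" "u \<in> carrier R"
      using ideal_closed(7)[OF mpow_ideal w(1)] ideal_closed(7)[OF Pi uP] by auto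
    have "(y \<ominus> w) \<otimes> x = y \<otimes> x \<ominus> w \<otimes> x" using cc y xc by algebra
    also have "\<dots> = u \<oplus> p" unfolding zp(3) uv(3) w(2) using cc zc xc by algebra
    finally have "(y \<ominus> w) \<otimes> x \<in> P" using ideal_closed(2)[OF Pi uP zp(2)] by simp
    then have ywP: "y \<ominus> w \<in> P"
      using primeideal.I_prime[OF P _ xc, of "y \<ominus> w"] x(2) y(1) cc(1) by auto
    have "mpow (k - c) \<subseteq> mpow (k - Suc c)" by (rule ideal_pow_antimono[OF max_ideal]) simp
    moreover have "y = w \<oplus> (y \<ominus> w)" using cc y by algebra
    ultimately show "y \<in> mpow (k - Suc c) <+> P" unfolding ideal_sum_mem using w(1) ywP by blast
  qed
  show ?thesis
  proof (rule that[of "Suc c"])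
    fix k assume k: "Suc c \<le> k"
    let ?K = "mpow k <+> P"
    have K: "ideal ?K R" by (rule add_ideals[OF mpow_ideal Pi])
    have KJ: "?K \<subseteq> ?K <+> PIdl x" by (rule ideal_sum_upper(1)[OF K px])
    have J: "ideal (?K <+> PIdl x) R" by (rule add_ideals[OF K px])
    have "?K <+> PIdl x \<subseteq> mpow k <+> P'"
    proof (rule ideal_sum_least[OF add_ideals[OF mpow_ideal P']])
      show "?K \<subseteq> mpow k <+> P'" using sub by (intro ideal_sum_mono) auto
      show "PIdl x \<subseteq> mpow k <+> P'"
        using cgenideal_minimal[OF P' x(1)] ideal_sum_upper(2)[OF mpow_ideal P'] by blast
    qed
    then have 1: "ilen R (mpow k <+> P') (carrier R) \<le> ilen R (?K <+> PIdl x) (carrier R)"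
      by (rule ilen_mono) simp
    have "ilen R (mpow (k - Suc c) <+> P) (carrier R) \<le> ilen R (ideal_colon R ?K {x}) (carrier R)"
      by (rule ilen_mono[OF colon[OF k]]) simp
    also have "\<dots> \<le> ilen R ?K (?K <+> PIdl x)" by (rule ilen_cyclic_ge[OF K xc])
    finally have "ilen R (mpow (k - Suc c) <+> P) (carrier R) + ilen R (mpow k <+> P') (carrier R)
        \<le> ilen R ?K (?K <+> PIdl x) + ilen R (?K <+> PIdl x) (carrier R)" using 1 by (rule add_mono)
    also have "\<dots> = ilen R ?K (carrier R)"
      by (rule ilen_additive[OF K J oneideal KJ ideal_subset_carrier[OF J], symmetric])
    finally show "ilen R (mpow (k - Suc c) <+> P) (carrier R) + ilen R (mpow k <+> P') (carrier R)
        \<le> ilen R ?K (carrier R)" .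
  qed simp
qed

end

text \<open>  Telescoping the recursion between \<open>c p\<close> and \<open>2 c p\<close> gives \<open>p * h p \<le> g (2 c p)\<close>. So \<open>h\<close> grows with
  one degree less than \<open>g\<close>, and \<open>g\<close> cannot be bounded since \<open>h\<close> is positive.\<close>
lemma growth_degree_drops:
  fixes g h :: "nat \<Rightarrow> enat"
  assumes c: "c \<ge> 1" and rec: "\<And>k. k \<ge> c \<Longrightarrow> g (k - c) + h k \<le> g k"
    and g: "\<And>k. g k \<le> enat (D * k ^ \<delta>)"
    and mono: "\<And>k l. k \<le> l \<Longrightarrow> h k \<le> h l" and pos: "\<And>k. k \<ge> 1 \<Longrightarrow> 1 \<le> h k"
  shows "\<exists>\<delta>' E. \<delta> = Suc \<delta>' \<and> (\<forall>k\<ge>1. h k \<le> enat (E * k ^ \<delta>'))"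
proof -
  have sum: "of_nat i * h (c * j) \<le> g (c * (j + i))" for i j
  proof (induction i)
    case (Suc i)
    have "h (c * j) + of_nat i * h (c * j) \<le> h (c * (j + Suc i)) + g (c * (j + i))"
      by (rule add_mono[OF mono Suc]) (rule mult_le_mono2, simp)
    also have "\<dots> = g (c * (j + Suc i) - c) + h (c * (j + Suc i))" by (simp add: add.commute)
    also have "\<dots> \<le> g (c * (j + Suc i))" by (rule rec) simp
    finally show ?case by (simp add: distrib_right)
  qed simp
  define E where "E = D * (2 * c) ^ \<delta>"
  have bound: "of_nat p * h p \<le> enat (E * p ^ \<delta>)" for p
  proof -
    have "of_nat p * h p \<le> of_nat p * h (c * p)"
      by (rule mult_left_mono[OF mono]) (use c in auto)
    also have "\<dots> \<le> g (c * (p + p))" by (rule sum)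
    also have "\<dots> \<le> enat (D * (c * (p + p)) ^ \<delta>)" by (rule g)
    also have "c * (p + p) = (2 * c) * p" by simp
    also have "D * ((2 * c) * p) ^ \<delta> = E * p ^ \<delta>" by (simp add: E_def power_mult_distrib)
    finally show ?thesis .
  qed
  have nat: "\<exists>m\<ge>1. h p = enat m \<and> p * m \<le> E * p ^ \<delta>" if p: "p \<ge> 1" for p
  proof (cases "h p")
    case (enat m)
    have "enat (p * m) \<le> enat (E * p ^ \<delta>)" using bound[of p] enat by (simp add: of_nat_eq_enat)
    moreover have "enat 1 \<le> enat m" using pos[OF p] enat by (simp add: one_enat_def)
    ultimately show ?thesis using enat by simp
  next
    case infinity
    then show ?thesis using bound[of p] p by (simp add: of_nat_eq_enat)
  qed
  show ?thesis
  proof (cases \<delta>)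
    case 0
    obtain m where "m \<ge> 1" "Suc E * m \<le> E" using nat[of "Suc E"] 0 by auto
    then have "Suc E * 1 \<le> E" using mult_le_mono2[of 1 m "Suc E"] by linarith
    then show ?thesis by simp
  next
    case (Suc \<delta>')
    have "h k \<le> enat (E * k ^ \<delta>')" if k: "k \<ge> 1" for k
    proof -
      obtain m where m: "h k = enat m" "k * m \<le> E * k ^ \<delta>" using nat[OF k] by blast
      then have "k * m \<le> k * (E * k ^ \<delta>')" by (simp add: Suc mult_ac)
      then show ?thesis using m(1) k by simp
    qed
    then show ?thesis using Suc by blast
  qed
qed

context noetherian_local_ring begin

lemma prime_chain_le_growth_degree:
  assumes "\<forall>i\<le>t. primeideal (P i) R" "\<forall>i<t. P i \<subset> P (Suc i)"
    and "\<And>k. ilen R (mpow k <+> P 0) (carrier R) \<le> enat (D * k ^ \<delta>)"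
  shows "t \<le> \<delta>"
  using assms
proof (induction t arbitrary: P D \<delta>)
  case 0 then show ?case by simp
next
  case (Suc t)
  have P: "primeideal (P 0) R" "primeideal (P 1) R" "P 0 \<subset> P 1" using Suc.prems(1,2) by auto
  have P1: "ideal (P 1) R" by (rule primeideal.axioms(1)[OF P(2)])
  let ?g = "\<lambda>k. ilen R (mpow k <+> P 0) (carrier R)" and ?h = "\<lambda>k. ilen R (mpow k <+> P 1) (carrier R)"
  obtain c where c: "c \<ge> 1" "\<And>k. k \<ge> c \<Longrightarrow> ?g (k - c) + ?h k \<le> ?g k"
    using ilen_mpow_recursion[OF P(1) P1 P(3)] by blast
  have mono: "?h k \<le> ?h l" if "k \<le> l" for k l
    by (rule ilen_mono[OF ideal_sum_mono[OF ideal_pow_antimono[OF max_ideal that]]]) simp_all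
  obtain \<delta>' E where E: "\<delta> = Suc \<delta>'" "\<forall>k\<ge>1. ?h k \<le> enat (E * k ^ \<delta>')"
    using growth_degree_drops[of c ?g ?h D \<delta>, OF c Suc.prems(3) mono one_le_ilen_mpow[OF P(2)]] by blast
  have "?h k \<le> enat (E * k ^ \<delta>')" for k
  proof (cases "k \<ge> 1")
    case False
    then have "k = 0" by simp
    have "ideal (carrier R <+> P 1) R" by (rule add_ideals[OF oneideal P1])
    then have "carrier R <+> P 1 = carrier R"
      using ideal_subset_carrier ideal_sum_upper(1)[OF oneideal P1] by blast
    then show ?thesis using \<open>k = 0\<close> by (simp add: ideal_pow_simps ilen_trivial)
  qed (use E(2) in blast)
  then have "t \<le> \<delta>'"
    using Suc.IH[of "\<lambda>i. P (Suc i)" E \<delta>'] Suc.prems(1,2) by simp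
  then show ?case using E(1) by simp
qed

theorem krull_dim_finite: "\<exists>d. krull_dim R = ereal (real d)"
proof -
  let ?A = "{n. \<exists>P :: nat \<Rightarrow> 'a set. (\<forall>i\<le>n. primeideal (P i) R) \<and> (\<forall>i<n. P i \<subset> P (Suc i))}"
  obtain r where r: "\<And>k A. ideal A R \<Longrightarrow> ilen R (mpow k <+> A) (carrier R) \<le> enat (k ^ r)"
    using ilen_mpow_polynomial by blast
  have bd: "n \<le> r" if n: "n \<in> ?A" for n
  proof -
    obtain P where P: "\<forall>i\<le>n. primeideal (P i) R" "\<forall>i<n. P i \<subset> P (Suc i)" using n by blast
    have "ideal (P 0) R" using P(1) primeideal.axioms(1) by blast
    then show ?thesis using prime_chain_le_growth_degree[OF P, of 1 r] r[of "P 0"] by simp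
  qed
  have "0 \<in> ?A" using max_prime by (auto intro!: exI[of _ "\<lambda>_. \<mm>"])
  have fin: "finite ?A" using bd by (intro finite_subset[of ?A "{..r}"]) auto
  have "Max ?A \<in> ?A" using \<open>0 \<in> ?A\<close> fin by (intro Max_in) auto
  have eq: "krull_dim R = Sup ((\<lambda>n. ereal (real n)) ` ?A)"
    unfolding krull_dim_def by (rule arg_cong[where f = Sup]) blast
  have "Sup ((\<lambda>n. ereal (real n)) ` ?A) = ereal (real (Max ?A))"
  proof (rule antisym)
    show "Sup ((\<lambda>n. ereal (real n)) ` ?A) \<le> ereal (real (Max ?A))"
    proof (rule SUP_least)
      fix n assume "n \<in> ?A"
      then show "ereal (real n) \<le> ereal (real (Max ?A))" using Max_ge[OF fin] by simp
    qed
    show "ereal (real (Max ?A)) \<le> Sup ((\<lambda>n. ereal (real n)) ` ?A)"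
      by (rule SUP_upper[OF \<open>Max ?A \<in> ?A\<close>])
  qed
  then have "krull_dim R = ereal (real (Max ?A))" using eq by (rule trans[rotated])
  then show ?thesis by (rule exI)
qed

text \<open>  The element added to the list avoids those primes, among finitely many whose product lies in the
  ideal generated so far, that are not maximal. Hence a prime that contains the new list and is not
  maximal lies strictly above one of them, which ends a shorter chain.\<close>
lemma parameters_chain:
  assumes A: "ideal A R"
  shows "\<exists>xs. length xs = i \<and> set xs \<subseteq> \<mm> \<and> (\<forall>P. primeideal P R \<longrightarrow> add_gens R A xs \<subseteq> P \<longrightarrow> P \<noteq> \<mm> \<longrightarrow>
    (\<exists>p. prime_chain R A i p \<and> p i = P))"
proof (induction i)
  case 0
  have "\<exists>p. prime_chain R A 0 p \<and> p 0 = P" if "primeideal P R" "A \<subseteq> P" for P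
    using that by (intro exI[of _ "\<lambda>_. P"]) (simp add: prime_chain_def)
  then show ?case by (intro exI[of _ "[]"]) simp
next
  case (Suc i)
  then obtain xs where xs: "length xs = i" "set xs \<subseteq> \<mm>"
    and chain: "\<And>P. primeideal P R \<Longrightarrow> add_gens R A xs \<subseteq> P \<Longrightarrow> P \<noteq> \<mm> \<Longrightarrow>
      \<exists>p. prime_chain R A i p \<and> p i = P" by blast
  have xc: "set xs \<subseteq> carrier R" using xs(2) ideal_subset_carrier[OF max_ideal] by blast
  have G: "ideal (add_gens R A xs) R" by (rule add_gens_ideal[OF A xc])
  obtain Ps where Ps: "\<And>P. P \<in> set Ps \<Longrightarrow> primeideal P R \<and> add_gens R A xs \<subseteq> P"
    "ideals_prod Ps \<subseteq> add_gens R A xs"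
    by (rule ideal_contains_prime_product[OF noetherian G]) (rule that)
  have "\<exists>x\<in>\<mm>. \<forall>Q\<in>set Ps - {\<mm>}. x \<notin> Q"
  proof (rule prime_avoidance[OF _ _ max_ideal])
    fix Q assume Q: "Q \<in> set Ps - {\<mm>}"
    then have "primeideal Q R" using Ps(1) by blast
    then show "primeideal Q R \<and> \<not> \<mm> \<subseteq> Q" using prime_subset_max[of Q] Q by blast
  qed simp
  then obtain x where x: "x \<in> \<mm>" "\<And>Q. Q \<in> set Ps \<Longrightarrow> Q \<noteq> \<mm> \<Longrightarrow> x \<notin> Q" by blast
  have xcc: "x \<in> carrier R" by (rule ideal_closed(7)[OF max_ideal x(1)])
  have xxc: "set (x # xs) \<subseteq> carrier R" using xcc xc by simp
  have "\<exists>p. prime_chain R A (Suc i) p \<and> p (Suc i) = P"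
    if P: "primeideal P R" "add_gens R A (x # xs) \<subseteq> P" "P \<noteq> \<mm>" for P
  proof -
    note u = add_gens_upper[OF A xxc]
    have Pi: "ideal P R" by (rule primeideal.axioms(1)[OF P(1)])
    have xP: "x \<in> P" "A \<subseteq> P" "set xs \<subseteq> P" using u P(2) by auto
    have "add_gens R A xs \<subseteq> P" by (rule add_gens_least[OF A Pi xP(2,3)])
    then have "ideals_prod Ps \<subseteq> P" using Ps(2) by blast
    then obtain Q where Q: "Q \<in> set Ps" "Q \<subseteq> P"
      using prime_contains_factor[OF P(1) primeideal.axioms(1)[OF conjunct1[OF Ps(1)]]] by blast
    have Qm: "Q \<noteq> \<mm>" using Q(2) P(3) prime_subset_max[OF P(1)] by blast
    have QP: "Q \<subset> P" using Q(2) xP(1) x(2)[OF Q(1) Qm] by blast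
    obtain p where "prime_chain R A i p" and pi: "p i = Q"
      using chain[of Q] Ps(1)[OF Q(1)] Qm by blast
    then have p: "\<forall>j\<le>i. primeideal (p j) R \<and> A \<subseteq> p j" "\<forall>j<i. p j \<subset> p (Suc j)" "p i = Q"
      unfolding prime_chain_def by auto
    let ?p = "p(Suc i := P)"
    have "\<forall>j\<le>Suc i. primeideal (?p j) R \<and> A \<subseteq> ?p j" using p(1) P(1) xP(2) by (auto simp: le_Suc_eq)
    moreover have "\<forall>j<Suc i. ?p j \<subset> ?p (Suc j)" using p(2,3) QP by (auto simp: less_Suc_eq)
    ultimately show ?thesis unfolding prime_chain_def by (intro exI[of _ ?p]) simp
  qed
  then show ?case using xs x(1) by (intro exI[of _ "x # xs"]) simp
qed

text \<open>  A prime other than \<open>\<mm>\<close> above the ideal would end a chain of length \<open>i\<close>, and \<open>\<mm>\<close> would prolong it.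
  So all primes in the product contained in the ideal are \<open>\<mm>\<close>, and the product is a power of \<open>\<mm>\<close>.\<close>
lemma parameters_exist:
  assumes A: "ideal A R"
    and no_chain: "\<nexists>p. prime_chain R A (Suc i) p"
  obtains xs f where "length xs = i" "set xs \<subseteq> \<mm>" "mpow f \<subseteq> add_gens R A xs"
proof -
  obtain xs where xs: "length xs = i" "set xs \<subseteq> \<mm>"
    and chain: "\<And>P. primeideal P R \<Longrightarrow> add_gens R A xs \<subseteq> P \<Longrightarrow> P \<noteq> \<mm> \<Longrightarrow>
      \<exists>p. prime_chain R A i p \<and> p i = P"
    using parameters_chain[OF A, of i] by blast
  have xc: "set xs \<subseteq> carrier R" using xs(2) ideal_subset_carrier[OF max_ideal] by blast
  have G: "ideal (add_gens R A xs) R" by (rule add_gens_ideal[OF A xc])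
  have only: "P = \<mm>" if P: "primeideal P R" "add_gens R A xs \<subseteq> P" for P
  proof (rule ccontr)
    assume neq: "P \<noteq> \<mm>"
    then obtain p where "prime_chain R A i p" and pi: "p i = P" using chain[OF P] by blast
    then have p: "\<forall>j\<le>i. primeideal (p j) R \<and> A \<subseteq> p j" "\<forall>j<i. p j \<subset> p (Suc j)" "p i = P"
      unfolding prime_chain_def by auto
    have Pm: "P \<subset> \<mm>" "A \<subseteq> \<mm>" using prime_subset_max[OF P(1)] neq p(1,3) by blast+
    let ?p = "p(Suc i := \<mm>)"
    have "\<forall>j\<le>Suc i. primeideal (?p j) R \<and> A \<subseteq> ?p j" using p(1) max_prime Pm(2) by (auto simp: le_Suc_eq)
    moreover have "\<forall>j<Suc i. ?p j \<subset> ?p (Suc j)" using p(2,3) Pm(1) by (auto simp: less_Suc_eq)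
    ultimately have "prime_chain R A (Suc i) ?p" unfolding prime_chain_def by blast
    then show False using no_chain by blast
  qed
  obtain Ps where Ps: "\<And>P. P \<in> set Ps \<Longrightarrow> primeideal P R \<and> add_gens R A xs \<subseteq> P"
    "ideals_prod Ps \<subseteq> add_gens R A xs"
    by (rule ideal_contains_prime_product[OF noetherian G]) (rule that)
  have "\<forall>P\<in>set Ps. P = \<mm>" using Ps(1) only by blast
  then have "ideals_prod Ps = mpow (length Ps)"
  proof (induction Ps)
    case (Cons P Ps)
    then show ?case
      using ideal_prod_commute[OF max_ideal mpow_ideal[of "length Ps"]] by (simp add: ideal_pow_simps)
  qed (simp add: ideal_pow_simps)
  then show ?thesis using that[OF xs] Ps(2) by auto
qed

text \<open>  \<open>N/\<mm> ^ k N\<close> is generated by a fixed number of elements killed by \<open>\<mm> ^ k + A\<close>; it remains to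
  bound the length of \<open>R/(\<mm> ^ k + A)\<close> by means of parameters for \<open>A\<close>.\<close>
theorem ilen_mpow_prod_bound:
  assumes N: "ideal N R" and A: "ideal A R" and AN: "\<And>a x. a \<in> A \<Longrightarrow> x \<in> N \<Longrightarrow> a \<otimes> x = \<zero>"
    and no_chain: "\<nexists>p. prime_chain R A (Suc i) p"
  obtains C where "\<And>k. ilen R (mpow k \<cdot> N) N \<le> enat (C * k ^ i)"
proof -
  obtain xs f where xs: "length xs = i" "set xs \<subseteq> \<mm>" "mpow f \<subseteq> add_gens R A xs"
    using parameters_exist[OF A no_chain] by blast
  obtain r where r: "\<And>k A. ideal A R \<Longrightarrow> ilen R (mpow k <+> A) (carrier R) \<le> enat (k ^ r)"
    using ilen_mpow_polynomial by blast
  obtain ys where ys: "set ys \<subseteq> N" "add_gens R {\<zero>} ys = N" using finite_generators[OF N] .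
  have "mpow f <+> {\<zero>} = mpow f" by (rule ideal_sum_absorb[OF mpow_ideal zeroideal])
    (use ideal_closed(1)[OF mpow_ideal] in simp)
  then have "ilen R (add_gens R A xs) (carrier R) \<le> enat (f ^ r)"
    using ilen_mono[OF xs(3) subset_refl, of R "carrier R"] r[OF zeroideal, of f] by (metis order_trans)
  then obtain l where l: "ilen R (add_gens R A xs) (carrier R) = enat l"
    by (cases "ilen R (add_gens R A xs) (carrier R)") auto
  have yc: "set ys \<subseteq> carrier R" using ys(1) ideal_subset_carrier[OF N] by blast
  show ?thesis
  proof (rule that[of "length ys * l"])
    fix k
    let ?K = "mpow k \<cdot> N"
    have K: "ideal ?K R" by (rule ideal_prod_is_ideal[OF mpow_ideal N])
    have KN: "?K \<subseteq> N" using ideal_prod_inter[OF mpow_ideal N] by blast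
    have zK: "{\<zero>} \<subseteq> ?K" using ideal_closed(1)[OF K] by simp
    have G: "ideal (add_gens R ?K ys) R" by (rule add_gens_ideal[OF K yc])
    have "add_gens R ?K ys = N"
    proof
      show "add_gens R ?K ys \<subseteq> N" by (rule add_gens_least[OF K N KN ys(1)])
      have "add_gens R {\<zero>} ys \<subseteq> add_gens R ?K ys"
        by (rule add_gens_least[OF zeroideal G]) (use add_gens_upper[OF K yc] zK in auto)
      then show "N \<subseteq> add_gens R ?K ys" using ys(2) by simp
    qed
    moreover have "mpow k <+> A \<subseteq> ideal_colon R ?K {y}" if "y \<in> set ys" for y
    proof (rule ideal_sum_least)
      have y: "y \<in> N" "y \<in> carrier R" using that ys(1) yc by auto
      show "ideal (ideal_colon R ?K {y}) R" by (rule ideal_colon_ideal[OF K]) (use y in simp)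
      show "mpow k \<subseteq> ideal_colon R ?K {y}"
        using ideal_subset_carrier[OF mpow_ideal] y(1) by (auto simp: ideal_colon_def intro: ideal_prod.prod)
      show "A \<subseteq> ideal_colon R ?K {y}"
        using ideal_subset_carrier[OF A] AN[OF _ y(1)] zK by (auto simp: ideal_colon_def)
    qed
    ultimately have "ilen R ?K N \<le> of_nat (length ys) * ilen R (mpow k <+> A) (carrier R)"
      using ilen_add_gens_le[OF K yc, of "mpow k <+> A"] by simp
    also have "\<dots> \<le> of_nat (length ys) * (of_nat (k ^ i) * enat l)"
      using ilen_ideal_pow_le[OF A max_ideal xs(2), of k] unfolding xs(1) l
      by (rule mult_left_mono) simp
    also have "\<dots> = enat (length ys * l * k ^ i)" by (simp add: of_nat_eq_enat mult_ac)
    finally show "ilen R ?K N \<le> enat (length ys * l * k ^ i)" .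
  qed
qed

end

section \<open>Ideals of quotient rings\<close>

locale quotient_ring = cring R for R (structure) +
  fixes J assumes kernel: "ideal J R"
begin

abbreviation "Q \<equiv> R Quot J"
abbreviation "\<pi> \<equiv> (+>) J"

definition pre where "pre V = {r \<in> carrier R. \<pi> r \<in> V}"

sublocale Q: cring Q by (rule ideal.quotient_is_cring[OF kernel is_cring])
sublocale \<pi>: ring_hom_ring R Q \<pi> by (rule ideal.rcos_ring_hom_ring[OF kernel])

lemma carrier_Q: "carrier Q = \<pi> ` carrier R"
  unfolding FactRing_def partial_object.select_convs A_RCOSETS_def' by blast

lemma zero_Q: "\<zero>\<^bsub>Q\<^esub> = J"
  unfolding FactRing_def by (rule ring.select_convs)

lemma \<pi>_zero_iff: "a \<in> carrier R \<Longrightarrow> \<pi> a = \<zero>\<^bsub>Q\<^esub> \<longleftrightarrow> a \<in> J"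
  unfolding zero_Q
  by (rule iffI[OF ideal.rcos_const_imp_mem[OF kernel] a_rcos_zero[OF kernel]])

lemma \<pi>_eq_imp: 
  assumes "a \<in> carrier R" "b \<in> carrier R" "\<pi> a = \<pi> b"
  shows "a \<ominus> b \<in> J"
proof -
  have "\<pi> (a \<ominus> b) = \<pi> a \<ominus>\<^bsub>Q\<^esub> \<pi> b" using assms by (simp add: a_minus_def)
  also have "\<dots> = \<zero>\<^bsub>Q\<^esub>" unfolding assms(3) by (rule Q.r_right_minus_eq[THEN iffD2]) (use assms in auto)
  finally show ?thesis using \<pi>_zero_iff[of "a \<ominus> b"] assms by simp
qed

lemma pre_ideal: "ideal V Q \<Longrightarrow> ideal (pre V) R"
  unfolding pre_def by (rule \<pi>.ideal_vimage)

lemma pre_upper: "ideal V Q \<Longrightarrow> J \<subseteq> pre V"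
proof
  fix x assume V: "ideal V Q" and x: "x \<in> J"
  have "x \<in> carrier R" by (rule ideal_closed(7)[OF kernel x])
  moreover from this have "\<pi> x = \<zero>\<^bsub>Q\<^esub>" using \<pi>_zero_iff x by blast
  ultimately show "x \<in> pre V" using Q.ideal_closed(1)[OF V] unfolding pre_def by simp
qed

lemma img_pre: "V \<subseteq> carrier Q \<Longrightarrow> \<pi> ` pre V = V"
  unfolding pre_def carrier_Q by auto

lemma img_ideal: "ideal V R \<Longrightarrow> ideal (\<pi> ` V) Q"
  by (rule ring_ideal_imp_quot_ideal[OF kernel])

lemma \<pi>_mem_img:
  assumes "ideal V R" "J \<subseteq> V" "a \<in> carrier R"
  shows "\<pi> a \<in> \<pi> ` V \<longleftrightarrow> a \<in> V"
proof
  assume "\<pi> a \<in> \<pi> ` V"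
  then obtain v where v: "v \<in> V" "\<pi> a = \<pi> v" by blast
  have vc: "v \<in> carrier R" by (rule ideal_closed(7)[OF assms(1) v(1)])
  have "a \<ominus> v \<in> V" using \<pi>_eq_imp[OF assms(3) vc v(2)] assms(2) by blast
  then have "(a \<ominus> v) \<oplus> v \<in> V" by (rule ideal_closed(2)[OF assms(1) _ v(1)])
  moreover have "(a \<ominus> v) \<oplus> v = a" using vc assms(3) by algebra
  ultimately show "a \<in> V" by simp
qed simp

lemma pre_img: "ideal V R \<Longrightarrow> J \<subseteq> V \<Longrightarrow> pre (\<pi> ` V) = V"
  using \<pi>_mem_img ideal_subset_carrier unfolding pre_def by blast

lemma pre_strict:
  assumes "V \<subset> W" "W \<subseteq> carrier Q"
  shows "pre V \<subset> pre W"
proof -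
  have "\<pi> ` pre V = V" "\<pi> ` pre W = W" using assms by (intro img_pre, blast)+
  then have "pre V \<noteq> pre W" using assms(1) by (metis psubset_eq)
  then show ?thesis using assms(1) unfolding pre_def by blast
qed

lemma img_strict:
  assumes "ideal V R" "ideal W R" "J \<subseteq> V" "V \<subset> W"
  shows "\<pi> ` V \<subset> \<pi> ` W"
proof -
  have "pre (\<pi> ` V) = V" "pre (\<pi> ` W) = W" using assms by (intro pre_img, blast, blast)+
  then have "\<pi> ` V \<noteq> \<pi> ` W" using assms(4) by (metis psubset_eq)
  then show ?thesis using assms(4) by blast
qed

lemma img_sum_kernel:
  assumes V: "ideal V R"
  shows "\<pi> ` (V <+> J) = \<pi> ` V"
proof
  show "\<pi> ` V \<subseteq> \<pi> ` (V <+> J)" using ideal_sum_upper(1)[OF V kernel] by blast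
  show "\<pi> ` (V <+> J) \<subseteq> \<pi> ` V"
  proof safe
    fix x assume "x \<in> V <+> J"
    then obtain v j where vj: "v \<in> V" "j \<in> J" "x = v \<oplus> j" unfolding ideal_sum_mem by blast
    have c: "v \<in> carrier R" "j \<in> carrier R"
      using ideal_closed(7)[OF V vj(1)] ideal_closed(7)[OF kernel vj(2)] by auto
    have "\<pi> x = \<pi> v \<oplus>\<^bsub>Q\<^esub> \<pi> j" unfolding vj(3) using c by simp
    also have "\<pi> j = \<zero>\<^bsub>Q\<^esub>" using \<pi>_zero_iff[OF c(2)] vj(2) by simp
    also have "\<pi> v \<oplus>\<^bsub>Q\<^esub> \<zero>\<^bsub>Q\<^esub> = \<pi> v" using c by simp
    finally show "\<pi> x \<in> \<pi> ` V" using vj(1) by blast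
  qed
qed

lemma img_ideal_prod:
  assumes V: "ideal V R" and W: "ideal W R"
  shows "\<pi> ` (V \<cdot> W) = ideal_prod Q (\<pi> ` V) (\<pi> ` W)"
proof
  have VW: "ideal (V \<cdot> W) R" by (rule ideal_prod_is_ideal[OF V W])
  show "ideal_prod Q (\<pi> ` V) (\<pi> ` W) \<subseteq> \<pi> ` (V \<cdot> W)"
  proof (rule Q.ideal_prod_least[OF img_ideal[OF VW]])
    fix i j assume "i \<in> \<pi> ` V" "j \<in> \<pi> ` W"
    then obtain v w where vw: "v \<in> V" "w \<in> W" "i = \<pi> v" "j = \<pi> w" by blast
    then have "i \<otimes>\<^bsub>Q\<^esub> j = \<pi> (v \<otimes> w)" using ideal_closed(7)[OF V] ideal_closed(7)[OF W] by simp
    then show "i \<otimes>\<^bsub>Q\<^esub> j \<in> \<pi> ` (V \<cdot> W)" using ideal_prod.prod[OF vw(1,2)] by blast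
  qed
  have "ideal (pre (ideal_prod Q (\<pi> ` V) (\<pi> ` W))) R"
    by (rule pre_ideal[OF Q.ideal_prod_is_ideal[OF img_ideal[OF V] img_ideal[OF W]]])
  then have "V \<cdot> W \<subseteq> pre (ideal_prod Q (\<pi> ` V) (\<pi> ` W))"
  proof (rule ideal_prod_least)
    fix v w assume vw: "v \<in> V" "w \<in> W"
    then have c: "v \<in> carrier R" "w \<in> carrier R"
      using ideal_closed(7)[OF V] ideal_closed(7)[OF W] by auto
    have "\<pi> v \<otimes>\<^bsub>Q\<^esub> \<pi> w \<in> ideal_prod Q (\<pi> ` V) (\<pi> ` W)" using vw by (intro ideal_prod.prod) auto
    then show "v \<otimes> w \<in> pre (ideal_prod Q (\<pi> ` V) (\<pi> ` W))" using c by (simp add: pre_def)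
  qed
  then show "\<pi> ` (V \<cdot> W) \<subseteq> ideal_prod Q (\<pi> ` V) (\<pi> ` W)" by (auto simp: pre_def)
qed

lemma img_ideal_pow: "ideal V R \<Longrightarrow> \<pi> ` ideal_pow R V n = ideal_pow Q (\<pi> ` V) n"
proof (induction n)
  case 0 then show ?case by (simp add: ideal_pow_simps Q.ideal_pow_simps carrier_Q)
next
  case (Suc n)
  then show ?case
    unfolding ideal_pow_simps Q.ideal_pow_simps using img_ideal_prod[OF ideal_pow_ideal Suc.prems] by simp
qed

lemma ilen_img:
  assumes V: "ideal V R" and W: "ideal W R" and sub: "J \<subseteq> V" "J \<subseteq> W"
  shows "ilen Q (\<pi> ` V) (\<pi> ` W) = ilen R V W"
proof (rule antisym)
  show "ilen Q (\<pi> ` V) (\<pi> ` W) \<le> ilen R V W"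
  proof (rule ilen_le_map[where f = pre])
    fix H assume H: "ideal H Q" "\<pi> ` V \<subseteq> H" "H \<subseteq> \<pi> ` W"
    have "pre (\<pi> ` V) \<subseteq> pre H" "pre H \<subseteq> pre (\<pi> ` W)" using H(2,3) unfolding pre_def by blast+
    then show "ideal (pre H) R \<and> V \<subseteq> pre H \<and> pre H \<subseteq> W"
      using pre_ideal[OF H(1)] pre_img[OF V sub(1)] pre_img[OF W sub(2)] by simp
  next
    fix H H' assume H: "ideal H Q" "ideal H' Q" "H \<subseteq> H'"
    show "pre H \<subseteq> pre H'" using H(3) unfolding pre_def by blast
    assume "pre H = pre H'"
    then have "\<pi> ` pre H = \<pi> ` pre H'" by (rule arg_cong)
    then show "H' \<subseteq> H"
      unfolding img_pre[OF Q.ideal_subset_carrier[OF H(1)]] img_pre[OF Q.ideal_subset_carrier[OF H(2)]]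
      by (rule equalityD2)
  qed
  show "ilen R V W \<le> ilen Q (\<pi> ` V) (\<pi> ` W)"
  proof (rule ilen_le_map[where f = "\<lambda>H. \<pi> ` H"])
    fix H assume H: "ideal H R" "V \<subseteq> H" "H \<subseteq> W"
    show "ideal (\<pi> ` H) Q \<and> \<pi> ` V \<subseteq> \<pi> ` H \<and> \<pi> ` H \<subseteq> \<pi> ` W"
      using img_ideal[OF H(1)] H(2,3) by blast
  next
    fix H H' assume H: "ideal H R" "ideal H' R" "V \<subseteq> H" "H \<subseteq> H'"
    show "\<pi> ` H \<subseteq> \<pi> ` H'" using H(4) by blast
    have "J \<subseteq> H" "J \<subseteq> H'" using H sub by auto
    then have eqs: "pre (\<pi> ` H) = H" "pre (\<pi> ` H') = H'" using pre_img[OF H(1)] pre_img[OF H(2)] by blast+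
    assume "\<pi> ` H = \<pi> ` H'"
    then have "pre (\<pi> ` H) = pre (\<pi> ` H')" by (rule arg_cong)
    then show "H' \<subseteq> H" unfolding eqs by (rule equalityD2)
  qed
qed

lemma pre_prime:
  assumes "primeideal V Q"
  shows "primeideal (pre V) R"
proof (rule primeidealI[OF pre_ideal[OF primeideal.axioms(1)[OF assms]] is_cring])
  have sub: "V \<subseteq> carrier Q" by (rule Q.ideal_subset_carrier[OF primeideal.axioms(1)[OF assms]])
  show "carrier R \<noteq> pre V"
  proof
    assume "carrier R = pre V"
    then have "carrier Q = V" using img_pre[OF sub] carrier_Q by simp
    then show False using primeideal.I_notcarr[OF assms] by simp
  qed
  fix a b assume ab: "a \<in> carrier R" "b \<in> carrier R" "a \<otimes> b \<in> pre V"
  then have "\<pi> a \<otimes>\<^bsub>Q\<^esub> \<pi> b \<in> V" by (simp add: pre_def)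
  then have "\<pi> a \<in> V \<or> \<pi> b \<in> V" using primeideal.I_prime[OF assms, of "\<pi> a" "\<pi> b"] ab by simp
  then show "a \<in> pre V \<or> b \<in> pre V" using ab by (simp add: pre_def)
qed

lemma img_prime:
  assumes P: "primeideal P R" and sub: "J \<subseteq> P"
  shows "primeideal (\<pi> ` P) Q"
proof (rule primeidealI[OF img_ideal[OF primeideal.axioms(1)[OF P]] Q.is_cring])
  have Pi: "ideal P R" by (rule primeideal.axioms(1)[OF P])
  show "carrier Q \<noteq> \<pi> ` P"
  proof
    assume "carrier Q = \<pi> ` P"
    then have "pre (carrier Q) = P" using pre_img[OF Pi sub] by simp
    then have "carrier R = P" by (auto simp: pre_def)
    then show False using primeideal.I_notcarr[OF P] by simp
  qed
  fix x y assume "x \<in> carrier Q" "y \<in> carrier Q" and xy: "x \<otimes>\<^bsub>Q\<^esub> y \<in> \<pi> ` P"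
  then obtain a b where ab: "a \<in> carrier R" "b \<in> carrier R" "x = \<pi> a" "y = \<pi> b"
    unfolding carrier_Q by blast
  then have "\<pi> (a \<otimes> b) \<in> \<pi> ` P" using xy by simp
  then have "a \<otimes> b \<in> P" using \<pi>_mem_img[OF Pi sub, of "a \<otimes> b"] ab by simp
  then have "a \<in> P \<or> b \<in> P" using primeideal.I_prime[OF P ab(1,2)] by blast
  then show "x \<in> \<pi> ` P \<or> y \<in> \<pi> ` P" using ab by blast
qed

text \<open>The primes of \<open>R/J\<close> are the images of the primes of \<open>R\<close> that contain \<open>J\<close>.\<close>
lemma krull_dim_quotient: "krull_dim Q = Sup {ereal (real n) | n. \<exists>p. prime_chain R J n p}"
proof -
  have "(\<exists>P. (\<forall>i\<le>n. primeideal (P i) Q) \<and> (\<forall>i<n. P i \<subset> P (Suc i))) \<longleftrightarrow> (\<exists>p. prime_chain R J n p)" for n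
  proof
    assume "\<exists>P. (\<forall>i\<le>n. primeideal (P i) Q) \<and> (\<forall>i<n. P i \<subset> P (Suc i))"
    then obtain P where P: "\<forall>i\<le>n. primeideal (P i) Q" "\<forall>i<n. P i \<subset> P (Suc i)" by blast
    have idl: "ideal (P i) Q" if "i \<le> n" for i using P(1) that primeideal.axioms(1) by blast
    have "pre (P i) \<subset> pre (P (Suc i))" if "i < n" for i
      using P(2) that by (intro pre_strict Q.ideal_subset_carrier idl) auto
    moreover have "primeideal (pre (P i)) R \<and> J \<subseteq> pre (P i)" if "i \<le> n" for i
      using pre_prime[OF P(1)[rule_format, OF that]] pre_upper[OF idl[OF that]] by (rule conjI)
    ultimately have "prime_chain R J n (\<lambda>i. pre (P i))"
      unfolding prime_chain_def by simp
    then show "\<exists>p. prime_chain R J n p" by blast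
  next
    assume "\<exists>p. prime_chain R J n p"
    then obtain p where p: "\<forall>i\<le>n. primeideal (p i) R \<and> J \<subseteq> p i" "\<forall>i<n. p i \<subset> p (Suc i)"
      unfolding prime_chain_def by blast
    have idl: "ideal (p i) R" if "i \<le> n" for i using p(1) that primeideal.axioms(1) by blast
    have "\<pi> ` p i \<subset> \<pi> ` p (Suc i)" if "i < n" for i
      using p that by (intro img_strict idl) auto
    moreover have "primeideal (\<pi> ` p i) Q" if "i \<le> n" for i
      using p(1)[rule_format, OF that] img_prime[of "p i"] by blast
    ultimately show "\<exists>P. (\<forall>i\<le>n. primeideal (P i) Q) \<and> (\<forall>i<n. P i \<subset> P (Suc i))"
      by (intro exI[of _ "\<lambda>i. \<pi> ` p i"] conjI allI impI)
  qed
  then show ?thesis unfolding krull_dim_def by simp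
qed

end

lemma (in cring) quotient_ringI: "ideal J R \<Longrightarrow> quotient_ring R J"
  by (intro quotient_ring.intro quotient_ring_axioms.intro is_cring)

section \<open>Local cohomology as an interval of ideals\<close>

context cring begin

text \<open>The exponent \<open>0\<close> may be admitted, because the powers of the maximal ideal decrease.\<close>
lemma saturation_mem:
  assumes \<mm>: "ideal (max_ideal R) R"
  shows "x \<in> saturation R K \<longleftrightarrow> x \<in> carrier R \<and> (\<exists>i. \<forall>a\<in>ideal_pow R (max_ideal R) i. x \<otimes> a \<in> K)"
proof
  assume "x \<in> carrier R \<and> (\<exists>i. \<forall>a\<in>ideal_pow R (max_ideal R) i. x \<otimes> a \<in> K)"
  then obtain i where "x \<in> carrier R" "\<forall>a\<in>ideal_pow R (max_ideal R) i. x \<otimes> a \<in> K" by blast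
  then have "x \<in> ideal_colon R K (ideal_pow R (max_ideal R) (Suc i))"
    using ideal_pow_antimono[OF \<mm>, of i "Suc i"] by (auto simp: ideal_colon_def)
  then show "x \<in> saturation R K" unfolding saturation_def by (rule UN_I[rotated]) simp
qed (auto simp: saturation_def ideal_colon_def)

lemma saturation_ideal:
  assumes \<mm>: "ideal (max_ideal R) R" and K: "ideal K R"
  shows "ideal (saturation R K) R" "K \<subseteq> saturation R K"
proof -
  let ?m = "ideal_pow R (max_ideal R)"
  have mc: "a \<in> carrier R" if "a \<in> ?m i" for a i by (rule ideal_closed(7)[OF ideal_pow_ideal[OF \<mm>] that])
  show "ideal (saturation R K) R"
  proof (rule idealI_comm)
    show "saturation R K \<subseteq> carrier R" using saturation_mem[OF \<mm>] by blast
    have "\<forall>a\<in>?m 0. \<zero> \<otimes> a \<in> K" using mc ideal_closed(1)[OF K] by simp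
    then show "\<zero> \<in> saturation R K" unfolding saturation_mem[OF \<mm>] by blast
    show "x \<oplus> y \<in> saturation R K" if xy: "x \<in> saturation R K" "y \<in> saturation R K" for x y
    proof -
      obtain i j where ij: "x \<in> carrier R" "y \<in> carrier R"
        "\<forall>a\<in>?m i. x \<otimes> a \<in> K" "\<forall>a\<in>?m j. y \<otimes> a \<in> K"
        using xy unfolding saturation_mem[OF \<mm>] by blast
      have "(x \<oplus> y) \<otimes> a \<in> K" if a: "a \<in> ?m (max i j)" for a
      proof -
        have "a \<in> ?m i" "a \<in> ?m j" using a ideal_pow_antimono[OF \<mm>] by (meson max.cobounded1 max.cobounded2 subsetD)+
        then have "x \<otimes> a \<oplus> y \<otimes> a \<in> K" using ij ideal_closed(2)[OF K] by blast
        then show ?thesis using l_distr[OF ij(1,2) mc[OF a]] by simp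
      qed
      then show ?thesis unfolding saturation_mem[OF \<mm>] using ij(1,2) by blast
    qed
    show "r \<otimes> x \<in> saturation R K" if x: "x \<in> saturation R K" and r: "r \<in> carrier R" for x r
    proof -
      obtain i where i: "x \<in> carrier R" "\<forall>a\<in>?m i. x \<otimes> a \<in> K" using x unfolding saturation_mem[OF \<mm>] by blast
      have "(r \<otimes> x) \<otimes> a \<in> K" if a: "a \<in> ?m i" for a
        using i(2) a ideal_closed(5)[OF K _ r] m_assoc[OF r i(1) mc[OF a]] by simp
      then show ?thesis unfolding saturation_mem[OF \<mm>] using i(1) r by blast
    qed
  qed
  show "K \<subseteq> saturation R K"
  proof
    fix x assume x: "x \<in> K"
    have "\<forall>a\<in>?m 0. x \<otimes> a \<in> K" using ideal_closed(6)[OF K x] mc by blast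
    then show "x \<in> saturation R K" unfolding saturation_mem[OF \<mm>] using ideal_closed(7)[OF K x] by blast
  qed
qed

text \<open>  The elements of \<open>R/K\<close> killed by a power of the maximal ideal form the image of the saturation of
  \<open>K\<close>, and submodules of this image are images of ideals between \<open>K\<close> and its saturation.\<close>
theorem length_local_cohomology:
  assumes \<mm>: "ideal (max_ideal R) R" and K: "ideal K R"
  shows "module_length R (local_cohomology_0 R (quot_module R K)) = ilen R K (saturation R K)"
proof -
  interpret q: quotient_ring R K by (rule quotient_ringI[OF K])
  let ?m = "ideal_pow R (max_ideal R)" and ?M = "local_cohomology_0 R (quot_module R K)"
  let ?S = "saturation R K"
  have S: "ideal ?S R" and KS: "K \<subseteq> ?S" using saturation_ideal[OF assms] .
  have mc: "a \<in> carrier R" if "a \<in> ?m i" for a i by (rule ideal_closed(7)[OF ideal_pow_ideal[OF \<mm>] that])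
  have Sc: "x \<in> carrier R" if "x \<in> ?S" for x by (rule ideal_closed(7)[OF S that])
  have ops: "x \<oplus>\<^bsub>?M\<^esub> y = x \<oplus>\<^bsub>q.Q\<^esub> y" "\<zero>\<^bsub>?M\<^esub> = \<zero>\<^bsub>q.Q\<^esub>" "r \<odot>\<^bsub>?M\<^esub> x = q.\<pi> r \<otimes>\<^bsub>q.Q\<^esub> x" for x y r
    by (simp_all add: local_cohomology_0_def quot_module_def restr_module_def)
  have carrier: "carrier ?M = q.\<pi> ` ?S"
  proof -
    have kill: "q.\<pi> a \<otimes>\<^bsub>q.Q\<^esub> q.\<pi> y = \<zero>\<^bsub>q.Q\<^esub> \<longleftrightarrow> y \<otimes> a \<in> K" if "y \<in> carrier R" "a \<in> carrier R" for a y
      using that q.\<pi>_zero_iff[of "y \<otimes> a"] q.Q.m_comm[of "q.\<pi> a" "q.\<pi> y"] by simp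
    have "carrier ?M = {x \<in> carrier q.Q. \<exists>i. \<forall>a\<in>?m i. q.\<pi> a \<otimes>\<^bsub>q.Q\<^esub> x = \<zero>\<^bsub>q.Q\<^esub>}"
      by (simp add: local_cohomology_0_def quot_module_def restr_module_def)
    also have "\<dots> = q.\<pi> ` {y \<in> carrier R. \<exists>i. \<forall>a\<in>?m i. q.\<pi> a \<otimes>\<^bsub>q.Q\<^esub> q.\<pi> y = \<zero>\<^bsub>q.Q\<^esub>}"
      unfolding q.carrier_Q by blast
    also have "{y \<in> carrier R. \<exists>i. \<forall>a\<in>?m i. q.\<pi> a \<otimes>\<^bsub>q.Q\<^esub> q.\<pi> y = \<zero>\<^bsub>q.Q\<^esub>} = ?S"
    proof (rule Set.set_eqI)
      fix y
      have "(\<forall>a\<in>?m i. q.\<pi> a \<otimes>\<^bsub>q.Q\<^esub> q.\<pi> y = \<zero>\<^bsub>q.Q\<^esub>) \<longleftrightarrow> (\<forall>a\<in>?m i. y \<otimes> a \<in> K)"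
        if "y \<in> carrier R" for i
        by (rule ball_cong[OF refl kill[OF that mc]])
      then show "y \<in> {y \<in> carrier R. \<exists>i. \<forall>a\<in>?m i. q.\<pi> a \<otimes>\<^bsub>q.Q\<^esub> q.\<pi> y = \<zero>\<^bsub>q.Q\<^esub>} \<longleftrightarrow> y \<in> ?S"
        unfolding saturation_mem[OF \<mm>] by blast
    qed
    finally show ?thesis .
  qed
  \<comment> \<open>being a submodule refers to inverses computed inside \<open>?M\<close>; they agree with those of \<open>R/K\<close>\<close>
  have inv: "inv\<^bsub>add_monoid ?M\<^esub> (q.\<pi> x) = q.\<pi> (\<ominus> x)" if x: "x \<in> ?S" for x
  proof -
    have xc: "x \<in> carrier R" by (rule Sc[OF x])
    have nx: "\<ominus> x \<in> ?S" by (rule ideal_closed(3)[OF S x])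
    have z: "q.\<pi> x \<oplus>\<^bsub>q.Q\<^esub> q.\<pi> (\<ominus> x) = \<zero>\<^bsub>q.Q\<^esub>" "q.\<pi> (\<ominus> x) \<oplus>\<^bsub>q.Q\<^esub> q.\<pi> x = \<zero>\<^bsub>q.Q\<^esub>"
      using xc by (simp_all add: q.Q.r_neg q.Q.l_neg)
    show ?thesis unfolding m_inv_def
    proof (rule the_equality)
      show "q.\<pi> (\<ominus> x) \<in> carrier (add_monoid ?M) \<and>
        q.\<pi> x \<otimes>\<^bsub>add_monoid ?M\<^esub> q.\<pi> (\<ominus> x) = \<one>\<^bsub>add_monoid ?M\<^esub> \<and>
        q.\<pi> (\<ominus> x) \<otimes>\<^bsub>add_monoid ?M\<^esub> q.\<pi> x = \<one>\<^bsub>add_monoid ?M\<^esub>"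
        using nx z by (simp add: carrier ops)
      fix y assume "y \<in> carrier (add_monoid ?M) \<and> q.\<pi> x \<otimes>\<^bsub>add_monoid ?M\<^esub> y = \<one>\<^bsub>add_monoid ?M\<^esub> \<and>
        y \<otimes>\<^bsub>add_monoid ?M\<^esub> q.\<pi> x = \<one>\<^bsub>add_monoid ?M\<^esub>"
      then have y: "y \<in> q.\<pi> ` ?S" "y \<oplus>\<^bsub>q.Q\<^esub> q.\<pi> x = \<zero>\<^bsub>q.Q\<^esub>" by (simp_all add: carrier ops)
      have yc: "y \<in> carrier q.Q" using y(1) Sc unfolding q.carrier_Q by blast
      show "y = q.\<pi> (\<ominus> x)" using q.Q.minus_equality[OF y(2)] yc xc by simp
    qed
  qed
  have sub_of_ideal: "submodule (q.\<pi> ` H) R ?M" if H: "ideal H R" "H \<subseteq> ?S" for H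
  proof (intro submodule.intro subgroup.intro submodule_axioms.intro)
    note Hc = ideal_closed[OF H(1)]
    show "q.\<pi> ` H \<subseteq> carrier (add_monoid ?M)" using H(2) by (auto simp: carrier)
    show "x \<otimes>\<^bsub>add_monoid ?M\<^esub> y \<in> q.\<pi> ` H" if xy: "x \<in> q.\<pi> ` H" "y \<in> q.\<pi> ` H" for x y
    proof -
      obtain a b where ab: "a \<in> H" "b \<in> H" "x = q.\<pi> a" "y = q.\<pi> b" using xy by blast
      have "x \<oplus>\<^bsub>q.Q\<^esub> y = q.\<pi> (a \<oplus> b)" using ab Hc(7) by simp
      then show ?thesis using Hc(2)[OF ab(1,2)] by (simp add: ops)
    qed
    have "\<zero>\<^bsub>q.Q\<^esub> = q.\<pi> \<zero>" by simp
    then show "\<one>\<^bsub>add_monoid ?M\<^esub> \<in> q.\<pi> ` H" using Hc(1) by (simp add: ops del: q.\<pi>.hom_zero)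
    show "inv\<^bsub>add_monoid ?M\<^esub> x \<in> q.\<pi> ` H" if x: "x \<in> q.\<pi> ` H" for x
    proof -
      obtain a where a: "a \<in> H" "x = q.\<pi> a" using x by blast
      have aS: "a \<in> ?S" using a(1) H(2) by blast
      show ?thesis unfolding a(2) inv[OF aS] using Hc(3)[OF a(1)] by (rule imageI)
    qed
    show "r \<odot>\<^bsub>?M\<^esub> x \<in> q.\<pi> ` H" if rx: "r \<in> carrier R" "x \<in> q.\<pi> ` H" for r x
    proof -
      obtain a where a: "a \<in> H" "x = q.\<pi> a" using rx(2) by blast
      have "q.\<pi> r \<otimes>\<^bsub>q.Q\<^esub> x = q.\<pi> (r \<otimes> a)" using rx(1) a Hc(7) by simp
      then show ?thesis using Hc(5)[OF a(1) rx(1)] by (simp add: ops)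
    qed
  qed
  have ideal_of_sub: "ideal (q.pre H) R \<and> K \<subseteq> q.pre H \<and> q.pre H \<subseteq> ?S \<and> q.\<pi> ` q.pre H = H"
    if H: "submodule H R ?M" for H
  proof -
    have H_sub: "H \<subseteq> q.\<pi> ` ?S" using subgroup.subset[OF submodule.axioms(1)[OF H]] by (simp add: carrier)
    have H_zero: "\<zero>\<^bsub>q.Q\<^esub> \<in> H" using subgroup.one_closed[OF submodule.axioms(1)[OF H]] by (simp add: ops)
    have H_add: "x \<oplus>\<^bsub>q.Q\<^esub> y \<in> H" if "x \<in> H" "y \<in> H" for x y
      using subgroup.m_closed[OF submodule.axioms(1)[OF H] that] by (simp add: ops)
    have H_smult: "q.\<pi> r \<otimes>\<^bsub>q.Q\<^esub> x \<in> H" if "r \<in> carrier R" "x \<in> H" for r x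
      using submodule.smult_closed[OF H that] by (simp add: ops)
    have "q.\<pi> ` ?S \<subseteq> carrier q.Q" using Sc unfolding q.carrier_Q by blast
    then have "q.\<pi> ` q.pre H = H" using q.img_pre[of H] H_sub by blast
    moreover have "ideal (q.pre H) R"
    proof (rule idealI_comm)
      show "q.pre H \<subseteq> carrier R" by (auto simp: q.pre_def)
      show "\<zero> \<in> q.pre H" using H_zero by (simp add: q.pre_def)
      show "x \<oplus> y \<in> q.pre H" if "x \<in> q.pre H" "y \<in> q.pre H" for x y
        using that H_add by (simp add: q.pre_def)
      show "r \<otimes> x \<in> q.pre H" if "x \<in> q.pre H" "r \<in> carrier R" for x r
        using that H_smult by (simp add: q.pre_def)
    qed
    moreover have "K \<subseteq> q.pre H"
    proof
      fix x assume x: "x \<in> K"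
      have xc: "x \<in> carrier R" by (rule ideal_closed(7)[OF K x])
      then have "q.\<pi> x = \<zero>\<^bsub>q.Q\<^esub>" using q.\<pi>_zero_iff x by blast
      then show "x \<in> q.pre H" using H_zero xc unfolding q.pre_def by simp
    qed
    moreover have "q.pre H \<subseteq> q.pre (q.\<pi> ` ?S)" using H_sub unfolding q.pre_def by blast
    ultimately show ?thesis using q.pre_img[OF S KS] by blast
  qed
  have "(\<exists>H. (\<forall>i\<le>n. submodule (H i) R ?M) \<and> (\<forall>i<n. H i \<subset> H (Suc i))) \<longleftrightarrow> has_chain R K ?S n" for n
  proof
    assume "\<exists>H. (\<forall>i\<le>n. submodule (H i) R ?M) \<and> (\<forall>i<n. H i \<subset> H (Suc i))"
    then obtain H where H: "\<forall>i\<le>n. submodule (H i) R ?M" "\<forall>i<n. H i \<subset> H (Suc i)" by blast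
    have Hc: "H i \<subseteq> carrier q.Q" if "i \<le> n" for i
      using subgroup.subset[OF submodule.axioms(1)[OF H(1)[rule_format, OF that]]] Sc
      by (auto simp: carrier)
    have "q.pre (H i) \<subset> q.pre (H (Suc i))" if "i < n" for i
      using H(2) that by (intro q.pre_strict Hc) auto
    moreover have "ideal (q.pre (H i)) R \<and> K \<subseteq> q.pre (H i) \<and> q.pre (H i) \<subseteq> ?S" if "i \<le> n" for i
      using ideal_of_sub[OF H(1)[rule_format, OF that]] by blast
    ultimately show "has_chain R K ?S n"
      unfolding has_chain_def by (intro exI[of _ "\<lambda>i. q.pre (H i)"]) simp
  next
    assume "has_chain R K ?S n"
    then obtain H where H: "\<forall>i\<le>n. ideal (H i) R \<and> K \<subseteq> H i \<and> H i \<subseteq> ?S" "\<forall>i<n. H i \<subset> H (Suc i)"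
      unfolding has_chain_def by blast
    have "q.\<pi> ` H i \<subset> q.\<pi> ` H (Suc i)" if "i < n" for i
      using H that by (intro q.img_strict) auto
    moreover have "submodule (q.\<pi> ` H i) R ?M" if "i \<le> n" for i
      using H(1)[rule_format, OF that] sub_of_ideal[of "H i"] by blast
    ultimately show "\<exists>H. (\<forall>i\<le>n. submodule (H i) R ?M) \<and> (\<forall>i<n. H i \<subset> H (Suc i))"
      by (intro exI[of _ "\<lambda>i. q.\<pi> ` H i"] conjI allI impI)
  qed
  then show ?thesis unfolding module_length_def ilen_def by simp
qed

end

section \<open>The nilradical\<close>

lemma (in cring) nilradical_subset_prime:
  assumes P: "primeideal P R"
  shows "nilradical R \<subseteq> P"
proof
  fix x assume "x \<in> nilradical R"
  then obtain n :: nat where x: "x \<in> carrier R" "x [^] n = \<zero>" unfolding nilradical_def by blast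
  have Pi: "ideal P R" by (rule primeideal.axioms(1)[OF P])
  have one: "\<one> \<notin> P" using ideal.one_imp_carrier[OF Pi] primeideal.I_notcarr[OF P] by blast
  have "x \<in> P" if "x [^] n \<in> P" for n :: nat
    using that
  proof (induction n)
    case (Suc n)
    then have "x [^] n \<otimes> x \<in> P" by simp
    then show ?case using primeideal.I_prime[OF P _ x(1), of "x [^] n"] x(1) Suc.IH by auto
  qed (use one in simp)
  then show "x \<in> P" using x(2) ideal_closed(1)[OF Pi] by metis
qed

text \<open>  If a product of primes is zero, an element that lies in all of them is nilpotent: the nilradical is the
  intersection of these primes.\<close>
lemma (in cring) nilradical_ideal:
  assumes noeth: "noetherian_ring R"
  shows "ideal (nilradical R) R"
proof -
  obtain Ps where Ps: "\<And>P. P \<in> set Ps \<Longrightarrow> primeideal P R \<and> {\<zero>} \<subseteq> P" "ideals_prod Ps \<subseteq> {\<zero>}"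
    by (rule ideal_contains_prime_product[OF noeth zeroideal]) (rule that)
  have pow: "x [^] length Qs \<in> ideals_prod Qs" if "x \<in> carrier R" "\<And>P. P \<in> set Qs \<Longrightarrow> x \<in> P" for x Qs
    using that
  proof (induction Qs)
    case (Cons P Qs)
    then have "x \<otimes> x [^] length Qs \<in> P \<cdot> ideals_prod Qs" by (intro ideal_prod.prod) auto
    then show ?case using nat_pow_Suc2[OF Cons.prems(1)] by simp
  qed simp
  let ?E = "{x \<in> carrier R. \<forall>P\<in>set Ps. x \<in> P}"
  have eq: "nilradical R = ?E"
  proof (intro equalityI subsetI)
    fix x assume x: "x \<in> nilradical R"
    have "x \<in> P" if "P \<in> set Ps" for P using nilradical_subset_prime[of P] Ps(1)[OF that] x by blast
    then show "x \<in> ?E" using x unfolding nilradical_def by blast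
  next
    fix x assume x: "x \<in> ?E"
    then have "x [^] length Ps \<in> {\<zero>}" using pow[of x Ps] Ps(2) by blast
    then show "x \<in> nilradical R" unfolding nilradical_def using x by blast
  qed
  have Pi: "ideal P R" if "P \<in> set Ps" for P using Ps(1)[OF that] primeideal.axioms(1) by blast
  show ?thesis unfolding eq
  proof (rule idealI_comm)
    show "\<zero> \<in> ?E" using ideal_closed(1)[OF Pi] by simp
    show "x \<oplus> y \<in> ?E"
      if "x \<in> ?E" "y \<in> ?E" for x y
      using that ideal_closed(2)[OF Pi] by simp
    show "r \<otimes> x \<in> ?E"
      if "x \<in> ?E" "r \<in> carrier R" for x r
      using that ideal_closed(5)[OF Pi] by simp
  qed blast
qed

section \<open>Epsilon multiplicities\<close>

context cring begin

lemma annihilator_ideal_module: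
  "annihilator R (ideal_module R N) = {r \<in> carrier R. \<forall>x\<in>N. r \<otimes> x = \<zero>}"
  by (simp add: annihilator_def ideal_module_def restr_module_def)

lemma annihilator_ideal:
  assumes N: "ideal N R"
  shows "ideal (annihilator R (ideal_module R N)) R"
  unfolding annihilator_ideal_module
proof (rule idealI_comm)
  note c = ideal_closed(7)[OF N]
  let ?A = "{r \<in> carrier R. \<forall>x\<in>N. r \<otimes> x = \<zero>}"
  show "\<zero> \<in> ?A" using c by simp
  show "x \<oplus> y \<in> ?A" if "x \<in> ?A" "y \<in> ?A" for x y using that c by (simp add: l_distr)
  show "r \<otimes> x \<in> ?A" if "x \<in> ?A" "r \<in> carrier R" for x r using that c by (simp add: m_assoc)
qed blast

lemma no_prime_chain_over_annihilator:
  assumes N: "ideal N R" and dim: "module_dim R (ideal_module R N) < ereal (real d)"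
  shows "\<nexists>p. prime_chain R (annihilator R (ideal_module R N)) d p"
proof
  let ?A = "annihilator R (ideal_module R N)"
  interpret q: quotient_ring R ?A
    by (rule quotient_ringI[OF annihilator_ideal[OF N]])
  assume "\<exists>p. prime_chain R ?A d p"
  then have "ereal (real d) \<le> Sup {ereal (real n) | n. \<exists>p. prime_chain R ?A n p}"
    by (intro Sup_upper) blast
  then have "ereal (real d) \<le> module_dim R (ideal_module R N)"
    unfolding module_dim_def q.krull_dim_quotient .
  then show False using dim by simp
qed

end

text \<open>  Eventually \<open>u + v \<le> u + e\<close> for every \<open>e > 0\<close>, and adding the constant \<open>e\<close> commutes with the limes
  superior even if that is infinite.\<close>
lemma limsup_add_null:
  fixes u v :: "nat \<Rightarrow> ereal" and w :: "nat \<Rightarrow> real"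
  assumes v: "\<And>n. 0 \<le> v n" "\<forall>\<^sub>F n in sequentially. v n \<le> ereal (w n)" and w: "w \<longlonglongrightarrow> 0"
  shows "limsup (\<lambda>n. u n + v n) = limsup u"
proof (rule antisym)
  show "limsup u \<le> limsup (\<lambda>n. u n + v n)"
    by (rule Limsup_mono) (use v(1) in \<open>simp add: ereal_le_add_self\<close>)
  show "limsup (\<lambda>n. u n + v n) \<le> limsup u"
  proof (rule ereal_le_epsilon2)
    fix e :: real assume e: "0 < e"
    have "\<forall>\<^sub>F n in sequentially. w n < e" using order_tendstoD(2)[OF w e] .
    with v(2) have "\<forall>\<^sub>F n in sequentially. u n + v n \<le> u n + ereal e"
    proof eventually_elim
      case (elim n)
      then have "v n \<le> ereal e" by (meson ereal_less_eq(3) less_imp_le order_trans)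
      then show ?case by (rule add_left_mono)
    qed
    then have "limsup (\<lambda>n. u n + v n) \<le> limsup (\<lambda>n. u n + ereal e)" by (rule Limsup_mono)
    also have "\<dots> = limsup u + ereal e" by (rule Limsup_add_ereal_right) simp_all
    finally show "limsup (\<lambda>n. u n + v n) \<le> limsup u + ereal e" .
  qed
qed

context noetherian_local_ring begin

text \<open>  The quotient is again local: its unique maximal ideal is the image of \<open>\<mm>\<close>, and \<open>max_ideal\<close>, which is
  defined by a description, therefore denotes an ideal.\<close>
lemma quotient_max_ideal:
  assumes J: "ideal J R" and proper: "J \<noteq> carrier R"
  shows "ideal (max_ideal (R Quot J)) (R Quot J)"
proof -
  interpret q: quotient_ring R J by (rule quotient_ringI[OF J])
  have Jm: "J \<subseteq> \<mm>" by (rule proper_ideal_subset_max[OF J proper])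
  have below: "V \<subseteq> q.\<pi> ` \<mm>" if V: "ideal V q.Q" "V \<noteq> carrier q.Q" for V
  proof -
    have imgV: "q.\<pi> ` q.pre V = V" by (rule q.img_pre[OF q.Q.ideal_subset_carrier[OF V(1)]])
    have "q.pre V \<noteq> carrier R" using V(2) imgV q.carrier_Q by metis
    then have "q.pre V \<subseteq> \<mm>" by (rule proper_ideal_subset_max[OF q.pre_ideal[OF V(1)]])
    then have "q.\<pi> ` q.pre V \<subseteq> q.\<pi> ` \<mm>" by (rule image_mono)
    then show ?thesis unfolding imgV .
  qed
  have prime: "primeideal (q.\<pi> ` \<mm>) q.Q" by (rule q.img_prime[OF max_prime Jm])
  have max: "maximalideal (q.\<pi> ` \<mm>) q.Q"
  proof (rule maximalidealI[OF primeideal.axioms(1)[OF prime] primeideal.I_notcarr[OF prime]])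
    fix V assume "ideal V q.Q" "q.\<pi> ` \<mm> \<subseteq> V"
    then show "V = q.\<pi> ` \<mm> \<or> V = carrier q.Q" using below[of V] by blast
  qed
  have unique: "V = q.\<pi> ` \<mm>" if V: "maximalideal V q.Q" for V
  proof -
    have "V \<subseteq> q.\<pi> ` \<mm>"
      using below[OF maximalideal.axioms(1)[OF V]] maximalideal.I_notcarr[OF V] by blast
    then show ?thesis
      using maximalideal.I_maximal[OF V primeideal.axioms(1)[OF prime]] primeideal.I_notcarr[OF prime]
        q.Q.ideal_subset_carrier[OF primeideal.axioms(1)[OF prime]] by blast
  qed
  have "max_ideal q.Q = q.\<pi> ` \<mm>"
    unfolding max_ideal_def[of q.Q] by (rule the_equality) (rule max, rule unique)
  then show ?thesis using primeideal.axioms(1)[OF prime] by simp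
qed

abbreviation "\<NN> \<equiv> nilradical R"

lemma ideal_nilradical: "ideal \<NN> R" by (rule nilradical_ideal[OF noetherian])

lemma nilradical_proper: "\<NN> \<noteq> carrier R"
  using nilradical_subset_prime[OF max_prime] max_proper ideal_subset_carrier[OF max_ideal] by blast

lemma extend_red_eq: "ideal V R \<Longrightarrow> extend_red R V = (+>) \<NN> ` V"
proof -
  assume V: "ideal V R"
  interpret q: quotient_ring R \<NN>
    by (rule quotient_ringI[OF ideal_nilradical])
  have img: "ideal (q.\<pi> ` V) q.Q" by (rule q.img_ideal[OF V])
  show ?thesis unfolding extend_red_def reduced_ring_def
    using q.Q.genideal_minimal[OF img subset_refl] q.Q.genideal_self[OF q.Q.ideal_subset_carrier[OF img]]
    by blast
qed

lemma krull_dim_reduced: "krull_dim (reduced_ring R) = krull_dim R"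
proof -
  interpret q: quotient_ring R \<NN>
    by (rule quotient_ringI[OF ideal_nilradical])
  have "prime_chain R \<NN> n p \<longleftrightarrow> (\<forall>i\<le>n. primeideal (p i) R) \<and> (\<forall>i<n. p i \<subset> p (Suc i))" for n p
    unfolding prime_chain_def using nilradical_subset_prime by blast
  then have eq: "prime_chain R \<NN> = (\<lambda>n p. (\<forall>i\<le>n. primeideal (p i) R) \<and> (\<forall>i<n. p i \<subset> p (Suc i)))"
    by (intro ext)
  show ?thesis unfolding reduced_ring_def q.krull_dim_quotient unfolding krull_dim_def eq ..
qed

lemma length_reduced:
  assumes K: "ideal K R" and sat: "extend_red R (saturation R K) = saturation (reduced_ring R) (extend_red R K)"
  shows "module_length (reduced_ring R)
      (local_cohomology_0 (reduced_ring R) (quot_module (reduced_ring R) (extend_red R K)))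
    = ilen R (K <+> \<NN>) (saturation R K <+> \<NN>)"
proof -
  interpret q: quotient_ring R \<NN>
    by (rule quotient_ringI[OF ideal_nilradical])
  have S: "ideal (saturation R K) R" by (rule saturation_ideal[OF max_ideal K])
  have "module_length q.Q (local_cohomology_0 q.Q (quot_module q.Q (q.\<pi> ` K)))
      = ilen q.Q (q.\<pi> ` K) (saturation q.Q (q.\<pi> ` K))"
    by (rule q.Q.length_local_cohomology[OF quotient_max_ideal[OF ideal_nilradical nilradical_proper] q.img_ideal[OF K]])
  also have "saturation q.Q (q.\<pi> ` K) = q.\<pi> ` saturation R K"
    using sat unfolding extend_red_eq[OF K] extend_red_eq[OF S] unfolding reduced_ring_def by (rule sym)
  also have "ilen q.Q (q.\<pi> ` K) (q.\<pi> ` saturation R K)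
      = ilen q.Q (q.\<pi> ` (K <+> \<NN>)) (q.\<pi> ` (saturation R K <+> \<NN>))"
    unfolding q.img_sum_kernel[OF K] q.img_sum_kernel[OF S] ..
  also have "\<dots> = ilen R (K <+> \<NN>) (saturation R K <+> \<NN>)"
    by (rule q.ilen_img[OF add_ideals[OF K ideal_nilradical] add_ideals[OF S ideal_nilradical]
          ideal_sum_upper(2)[OF K ideal_nilradical] ideal_sum_upper(2)[OF S ideal_nilradical]])
  finally show ?thesis unfolding extend_red_eq[OF K] unfolding reduced_ring_def .
qed

text \<open>  The defect \<open>(S \<inter> N)/(S \<inter> N \<inter> I ^ n)\<close> embeds into \<open>N/\<mm> ^ (c n) N\<close>: by linear growth of saturations,
  \<open>\<mm> ^ (c n) \<inter> S \<subseteq> I ^ n\<close>. For \<open>d = 0\<close> the dimension hypothesis forces \<open>N = 0\<close>; for \<open>d = i + 1\<close>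
  the bound has degree \<open>i\<close>.\<close>
lemma saturation_length_bound:
  assumes N: "ideal N R" and dim: "module_dim R (ideal_module R N) < ereal (real d)" and I: "ideal I R"
  obtains B :: "nat \<Rightarrow> nat" where
    "\<And>n. ilen R (saturation R (ideal_pow R I n) \<inter> N \<inter> ideal_pow R I n) (saturation R (ideal_pow R I n) \<inter> N)
      \<le> enat (B n)"
    "(\<lambda>n. real (B n) / (real n ^ d / fact d)) \<longlonglongrightarrow> 0"
proof (cases d)
  case 0
  let ?A = "annihilator R (ideal_module R N)"
  have "?A = carrier R"
  proof (rule ccontr)
    assume "?A \<noteq> carrier R"
    then have "?A \<subseteq> \<mm>" by (rule proper_ideal_subset_max[OF annihilator_ideal[OF N]])
    then have "prime_chain R ?A 0 (\<lambda>_. \<mm>)" unfolding prime_chain_def using max_prime by simp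
    then show False using no_prime_chain_over_annihilator[OF N dim] 0 by blast
  qed
  then have "\<one> \<in> ?A" by simp
  then have zero: "N \<subseteq> {\<zero>}" unfolding annihilator_ideal_module using ideal_closed(7)[OF N] by auto
  show ?thesis
  proof (rule that[of "\<lambda>_. 0"])
    fix n
    let ?K = "ideal_pow R I n" and ?S = "saturation R (ideal_pow R I n)"
    have K: "ideal ?K R" by (rule ideal_pow_ideal[OF I])
    have "?S \<inter> N \<subseteq> ?S \<inter> N \<inter> ?K"
      using zero ideal_closed(1)[OF K] by blast
    then show "ilen R (?S \<inter> N \<inter> ?K) (?S \<inter> N) \<le> enat 0"
      by (simp add: ilen_trivial)
  qed simp
next
  case (Suc i)
  let ?A = "annihilator R (ideal_module R N)"
  have AN: "a \<otimes> x = \<zero>" if "a \<in> ?A" "x \<in> N" for a x using that unfolding annihilator_ideal_module by blast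
  obtain C where C: "\<And>k. ilen R (mpow k \<cdot> N) N \<le> enat (C * k ^ i)"
    using ilen_mpow_prod_bound[OF N annihilator_ideal[OF N] AN]
      no_prime_chain_over_annihilator[OF N dim] Suc by blast
  obtain c where c: "\<And>n l x. x \<in> mpow (c * n) \<Longrightarrow> \<forall>y\<in>mpow l. x \<otimes> y \<in> ideal_pow R I n \<Longrightarrow> x \<in> ideal_pow R I n"
    using saturation_linear_growth[OF noetherian max_ideal I] by blast
  show ?thesis
  proof (rule that[of "\<lambda>n. C * (c * n) ^ i"])
    fix n
    let ?K = "ideal_pow R I n" and ?B = "mpow (c * n) \<cdot> N"
    let ?S = "saturation R ?K"
    have K: "ideal ?K R" by (rule ideal_pow_ideal[OF I])
    have S: "ideal ?S R" by (rule saturation_ideal(1)[OF max_ideal K])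
    have B: "ideal ?B R" "?B \<subseteq> mpow (c * n) \<inter> N"
      by (rule ideal_prod_is_ideal[OF mpow_ideal N])
        (rule ideal_prod_inter[OF mpow_ideal N])
    have "?B \<inter> (?S \<inter> N) \<subseteq> ?S \<inter> N \<inter> ?K"
    proof
      fix x assume x: "x \<in> ?B \<inter> (?S \<inter> N)"
      then have "x \<in> ?S" by blast
      then obtain l where "\<forall>y\<in>mpow l. x \<otimes> y \<in> ?K" unfolding saturation_mem[OF max_ideal] by blast
      moreover have "x \<in> mpow (c * n)" using x B(2) by blast
      ultimately have "x \<in> ?K" using c by blast
      then show "x \<in> ?S \<inter> N \<inter> ?K" using x by blast
    qed
    then have "ilen R (?S \<inter> N \<inter> ?K) (?S \<inter> N) \<le> ilen R ?B N"
      by (rule ilen_sum_le[OF i_intersect[OF S N] B(1) N]) (use B(2) in auto)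
    also have "\<dots> \<le> enat (C * (c * n) ^ i)" by (rule C)
    finally show "ilen R (?S \<inter> N \<inter> ?K) (?S \<inter> N) \<le> enat (C * (c * n) ^ i)" .
  next
    have "(\<lambda>n. real C * real c ^ i * fact d * inverse (real n)) \<longlonglongrightarrow> real C * real c ^ i * fact d * 0"
      by (intro tendsto_mult_left lim_inverse_n)
    moreover have "\<forall>\<^sub>F n in sequentially. real C * real c ^ i * fact d * inverse (real n)
        = real (C * (c * n) ^ i) / (real n ^ d / fact d)"
      using eventually_gt_at_top[of 0]
      by eventually_elim (simp add: Suc power_mult_distrib field_simps)
    ultimately show "(\<lambda>n. real (C * (c * n) ^ i) / (real n ^ d / fact d)) \<longlonglongrightarrow> 0"
      using Lim_transform_eventually by fastforce
  qed
qed

end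

theorem theorem1p7:
  fixes R :: "('a, 'b) ring_scheme"
  assumes "noetherian_local_ring R" and "nagata_ring R"
    and "module_dim R (ideal_module R (nilradical R)) < krull_dim R"
    and "\<And>I. ideal I R \<Longrightarrow>
      extend_red R (saturation R I) = saturation (reduced_ring R) (extend_red R I)"
    and "ideal I R"
  shows "epsilon_mult R I = epsilon_mult (reduced_ring R) (extend_red R I)"
proof -
  interpret noetherian_local_ring R by (rule assms(1))
  let ?N = "nilradical R" and ?A = "reduced_ring R"
  have N: "ideal ?N R" by (rule ideal_nilradical)
  interpret q: quotient_ring R ?N
    by (rule quotient_ringI[OF N])
  obtain d where d: "krull_dim R = ereal (real d)" using krull_dim_finite by blast
  have "fin_krull_dim R = d" unfolding fin_krull_dim_def d by (rule the_equality) simp_all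
  moreover have "fin_krull_dim ?A = fin_krull_dim R" unfolding fin_krull_dim_def krull_dim_reduced ..
  ultimately have dims: "fin_krull_dim R = d" "fin_krull_dim ?A = d" by auto
  define K where "K n = ideal_pow R I n" for n
  define S where "S n = saturation R (K n)" for n
  define a where "a n = ilen R (K n <+>\<^bsub>R\<^esub> ?N) (S n <+>\<^bsub>R\<^esub> ?N)" for n
  define b where "b n = ilen R (S n \<inter> ?N \<inter> K n) (S n \<inter> ?N)" for n
  define D where "D n = real n ^ d / fact d" for n :: nat
  have K: "ideal (K n) R" for n unfolding K_def by (rule ideal_pow_ideal[OF assms(5)])
  have S: "ideal (S n) R" "K n \<subseteq> S n" for n
    unfolding S_def by (rule saturation_ideal[OF max_ideal K])+
  have R_len: "module_length R (local_cohomology_0 R (quot_module R (ideal_pow R I n))) = b n + a n" for n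
    using length_local_cohomology[OF max_ideal K, of n] length_split[OF K S(1) N S(2), of n]
    by (simp add: a_def b_def S_def K_def)
  have "ideal_pow ?A (extend_red R I) n = extend_red R (K n)" for n
    unfolding extend_red_eq[OF K] extend_red_eq[OF assms(5)] unfolding K_def reduced_ring_def
    by (rule q.img_ideal_pow[OF assms(5), symmetric])
  then have A_len: "module_length ?A (local_cohomology_0 ?A (quot_module ?A (ideal_pow ?A (extend_red R I) n))) = a n" for n
    using length_reduced[OF K assms(4)[OF K], of n] by (simp add: a_def S_def)
  obtain B :: "nat \<Rightarrow> nat" where B: "\<And>n. b n \<le> enat (B n)" "(\<lambda>n. real (B n) / D n) \<longlonglongrightarrow> 0"
    using saturation_length_bound[OF N assms(3)[unfolded d] assms(5)]
    unfolding b_def S_def K_def D_def by blast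
  have "ereal_of_enat (b n + a n) / ereal (D n) = ereal_of_enat (a n) / ereal (D n) + ereal_of_enat (b n) / ereal (D n)" for n
    unfolding divide_ereal_def ereal_of_enat_add
    by (subst ereal_left_distrib) (simp_all add: ereal_of_enat_nonneg add.commute)
  then have "limsup (\<lambda>n. ereal_of_enat (b n + a n) / ereal (D n))
      = limsup (\<lambda>n. ereal_of_enat (a n) / ereal (D n) + ereal_of_enat (b n) / ereal (D n))" by simp
  also have "\<dots> = limsup (\<lambda>n. ereal_of_enat (a n) / ereal (D n))"
  proof (rule limsup_add_null[OF _ _ B(2)])
    show "0 \<le> ereal_of_enat (b n) / ereal (D n)" for n
      by (rule zero_le_divide_ereal) (simp_all add: ereal_of_enat_nonneg D_def)
    show "\<forall>\<^sub>F n in sequentially. ereal_of_enat (b n) / ereal (D n) \<le> ereal (real (B n) / D n)"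
      using eventually_gt_at_top[of 0]
    proof eventually_elim
      case (elim n)
      then have D: "D n > 0" by (simp add: D_def)
      have "ereal_of_enat (b n) \<le> ereal_of_enat (enat (B n))" using B(1)[of n] by (simp only: ereal_of_enat_le_iff)
      then have "ereal_of_enat (b n) / ereal (D n) \<le> ereal (real (B n)) / ereal (D n)"
        using D by (intro ereal_divide_right_mono) simp_all
      then show ?case using D by simp
    qed
  qed
  finally show ?thesis unfolding epsilon_mult_def R_len A_len dims D_def .
qed

end
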